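(* Let $\tau\in\mathbb{C}$ with $\mathrm{Im}(\tau)>0$, $q=e^{i\pi\tau}$ (with $q^{s}=e^{i\pi\tau s}$), and let $z=\alpha+\beta\tau$ with $(\alpha,\beta)\in\mathbb{R}^2$. Put $ND(z,\tau)=\frac{2k'K}{\pi}\mathrm{nd}(2Kz)$, $CD(z,\tau)=\frac{Kk}{2\pi}\mathrm{cd}(2Kz)$ and $SD(z,\tau)=\frac{Kkk'}{2\pi}\mathrm{sd}(2Kz)$. If $|\beta|<\tfrac12$, then $$ND(z,\tau)=1+4\sum_{n=1}^{+\infty}\frac{(-1)^nq^n\cos(2n\pi z)}{1+q^{2n}}=1+2\sum_{n=1}^{+\infty}\frac{(-1)^n\cos(2n\pi z)}{\cos(n\pi\tau)},$$ $$CD(z,\tau)=\sum_{n=0}^{+\infty}\frac{(-1)^nq^{n+\frac12}\cos((2n+1)\pi z)}{1-q^{2n+1}}=\frac{i}{2}\sum_{n=0}^{+\infty}\frac{(-1)^n\cos((2n+1)\pi z)}{\sin((n+\frac12)\pi\tau)},$$ $$SD(z,\tau)=\sum_{n=0}^{+\infty}\frac{(-1)^nq^{n+\frac12}\sin((2n+1)\pi z)}{1+q^{2n+1}}=\frac12\sum_{n=0}^{+\infty}\frac{(-1)^n\sin((2n+1)\pi z)}{\cos((n+\frac12)\pi\tau)}.$$ If $|\alpha|<\tfrac12$, then $$ND(z,\tau)=\frac{2}{\tau}\sum_{n=0}^{+\infty}\frac{(-1)^n\cos((2n+1)\pi z/\tau)}{\sin((n+\frac12)\pi/\tau)},$$ $$CD(z,\tau)=\frac{i}{4\tau}+\frac{i}{2\tau}\sum_{n=1}^{+\infty}\frac{(-1)^n\cos(2n\pi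 z/\tau)}{\cos(n\pi/\tau)},$$ $$SD(z,\tau)=-\frac{1}{2\tau}\sum_{n=0}^{+\infty}\frac{(-1)^n\sin((2n+1)\pi z/\tau)}{\cos((n+\frac12)\pi/\tau)}.$$
   Context: The Jacobi functions are taken with parameter $\tau=iK'/K$ and nome $q=e^{i\pi\tau}$. Explicitly, with $q^s=e^{i\pi\tau s}$, let $\theta_1(v)=2\sum_{n\ge0}(-1)^nq^{(n+1/2)^2}\sin((2n+1)v)$, $\theta_2(v)=2\sum_{n\ge0}q^{(n+1/2)^2}\cos((2n+1)v)$, $\theta_3(v)=1+2\sum_{n\ge1}q^{n^2}\cos(2nv)$, $\theta_4(v)=1+2\sum_{n\ge1}(-1)^nq^{n^2}\cos(2nv)$, and $\theta_j=\theta_j(0)$. Then $k=\theta_2^2/\theta_3^2$, $k'=\theta_4^2/\theta_3^2$, $K=\frac{\pi}{2}\theta_3^2$, $\mathrm{sn}(2Kz)=\frac{\theta_3}{\theta_2}\frac{\theta_1(\pi z)}{\theta_4(\pi z)}$, $\mathrm{cn}(2Kz)=\frac{\theta_4}{\theta_2}\frac{\theta_2(\pi z)}{\theta_4(\pi z)}$, $\mathrm{dn}(2Kz)=\frac{\theta_4}{\theta_3}\frac{\theta_3(\pi z)}{\theta_4(\pi z)}$, and $\mathrm{nd}=1/\mathrm{dn}$, $\mathrm{cd}=\mathrm{cn}/\mathrm{dn}$, $\mathrm{sd}=\mathrm{sn}/\mathrm{dn}$. When $\tau$ is purely imaginary these are the classical Jacobi quantities and functions. *)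

theory Defs
  imports "HOL-Complex_Analysis.Complex_Analysis"
begin

text \<open>The branch of \<open>q\<^sup>s\<close> is fixed by \<open>\<tau>\<close>, not by the number \<open>q\<close>; hence powers of the nome are
  written as a function of \<open>\<tau>\<close> and \<open>s\<close>.\<close>

definition qpow :: "complex \<Rightarrow> complex \<Rightarrow> complex" where
  "qpow \<tau> s = exp (\<i> * of_real pi * \<tau> * s)"

definition theta1 :: "complex \<Rightarrow> complex \<Rightarrow> complex" where
  "theta1 \<tau> v = 2 * (\<Sum>n. (-1) ^ n * qpow \<tau> ((of_nat n + 1/2)^2) * sin ((2 * of_nat n + 1) * v))"

definition theta2 :: "complex \<Rightarrow> complex \<Rightarrow> complex" where
  "theta2 \<tau> v = 2 * (\<Sum>n. qpow \<tau> ((of_nat n + 1/2)^2) * cos ((2 * of_nat n + 1) * v))"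

definition theta3 :: "complex \<Rightarrow> complex \<Rightarrow> complex" where
  "theta3 \<tau> v = 1 + 2 * (\<Sum>n. qpow \<tau> ((of_nat (Suc n))^2) * cos (2 * of_nat (Suc n) * v))"

definition theta4 :: "complex \<Rightarrow> complex \<Rightarrow> complex" where
  "theta4 \<tau> v =
     1 + 2 * (\<Sum>n. (-1) ^ Suc n * qpow \<tau> ((of_nat (Suc n))^2) * cos (2 * of_nat (Suc n) * v))"

definition jacobi_k :: "complex \<Rightarrow> complex" where
  "jacobi_k \<tau> = theta2 \<tau> 0 ^ 2 / theta3 \<tau> 0 ^ 2"

definition jacobi_k' :: "complex \<Rightarrow> complex" where
  "jacobi_k' \<tau> = theta4 \<tau> 0 ^ 2 / theta3 \<tau> 0 ^ 2"

definition jacobi_K :: "complex \<Rightarrow> complex" where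
  "jacobi_K \<tau> = of_real pi / 2 * theta3 \<tau> 0 ^ 2"

text \<open>The theta quotients are usually given at the argument \<open>u = 2 K z\<close>; here \<open>u\<close> is the
  argument, so the theta functions are evaluated at \<open>\<pi> z = \<pi> u / (2 K)\<close>.\<close>

definition jacobi_sn :: "complex \<Rightarrow> complex \<Rightarrow> complex" where
  "jacobi_sn \<tau> u = (let v = of_real pi * (u / (2 * jacobi_K \<tau>)) in
     theta3 \<tau> 0 / theta2 \<tau> 0 * (theta1 \<tau> v / theta4 \<tau> v))"

definition jacobi_cn :: "complex \<Rightarrow> complex \<Rightarrow> complex" where
  "jacobi_cn \<tau> u = (let v = of_real pi * (u / (2 * jacobi_K \<tau>)) in
     theta4 \<tau> 0 / theta2 \<tau> 0 * (theta2 \<tau> v / theta4 \<tau> v))"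

definition jacobi_dn :: "complex \<Rightarrow> complex \<Rightarrow> complex" where
  "jacobi_dn \<tau> u = (let v = of_real pi * (u / (2 * jacobi_K \<tau>)) in
     theta4 \<tau> 0 / theta3 \<tau> 0 * (theta3 \<tau> v / theta4 \<tau> v))"

text \<open>The functions nd, cd, sd are quotients of meromorphic functions. At the common poles of sn, cn
  and dn (the zeros of \<open>theta4\<close>) they are regular, whereas the pointwise quotient would take the
  value \<open>0 / 0 = 0\<close> in HOL; \<open>remove_sings\<close> gives the value of the meromorphic quotient there.\<close>

definition jacobi_nd :: "complex \<Rightarrow> complex \<Rightarrow> complex" where
  "jacobi_nd \<tau> = remove_sings (\<lambda>u. 1 / jacobi_dn \<tau> u)"

definition jacobi_cd :: "complex \<Rightarrow> complex \<Rightarrow> complex" where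
  "jacobi_cd \<tau> = remove_sings (\<lambda>u. jacobi_cn \<tau> u / jacobi_dn \<tau> u)"

definition jacobi_sd :: "complex \<Rightarrow> complex \<Rightarrow> complex" where
  "jacobi_sd \<tau> = remove_sings (\<lambda>u. jacobi_sn \<tau> u / jacobi_dn \<tau> u)"

definition ND :: "complex \<Rightarrow> complex \<Rightarrow> complex" where
  "ND z \<tau> = 2 * jacobi_k' \<tau> * jacobi_K \<tau> / of_real pi * jacobi_nd \<tau> (2 * jacobi_K \<tau> * z)"

definition CD :: "complex \<Rightarrow> complex \<Rightarrow> complex" where
  "CD z \<tau> = jacobi_K \<tau> * jacobi_k \<tau> / (2 * of_real pi) * jacobi_cd \<tau> (2 * jacobi_K \<tau> * z)"

definition SD :: "complex \<Rightarrow> complex \<Rightarrow> complex" where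
  "SD z \<tau> = jacobi_K \<tau> * jacobi_k \<tau> * jacobi_k' \<tau> / (2 * of_real pi) *
     jacobi_sd \<tau> (2 * jacobi_K \<tau> * z)"

end

theory Submission
  imports Defs
begin

text \<open>Write \<open>x = exp (2\<pi>iz)\<close>, \<open>y = exp (2\<pi>iw)\<close> and let \<open>\<vartheta>\<close> be the bilateral theta series \<open>\<Sum>n. q\<^bsup>n\<^sup>2\<^esup> x\<^sup>n\<close>.
  Comparing coefficients in the product of the bilateral series \<open>\<Sum>n. (-1)\<^sup>n q\<^sup>n x\<^sup>n / (1 - y q\<^bsup>2n\<^esup>)\<close>
  with \<open>\<vartheta>(z)\<close> shows that the product equals \<open>B(w) \<vartheta>(z + w)\<close> (Kronecker). As this holds for all \<open>w\<close>,
  a zero of \<open>\<vartheta>\<close> other than the obvious ones would force \<open>\<vartheta>\<close> to vanish identically, and the residue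
  at the obvious zero expresses every \<open>B(w)\<close> by the single constant \<open>B(1/2)\<close>. The latter is
  \<open>\<theta>\<^sub>3\<theta>\<^sub>4/2\<close>: their ratio is invariant under \<open>\<tau> \<mapsto> 2\<tau>\<close> and known in the limit \<open>q \<rightarrow> 0\<close>. Taking \<open>y = -1, q, -q\<close>
  gives the expansions for \<open>|\<beta>| < 1/2\<close>. Those for \<open>|\<alpha>| < 1/2\<close> follow from them at \<open>-1/\<tau>\<close>, because
  \<open>ND(z,\<tau>)\<close> and \<open>(4i/\<tau>) CD(z/\<tau>,-1/\<tau>)\<close>, and likewise the other pairs, have the same multipliers
  \<open>\<plusminus>1\<close> under the periods and the same simple poles and residues, so that Liouville's theorem applies.\<close>

definition epi :: "complex \<Rightarrow> complex" where
  "epi u = exp (\<i> * of_real pi * u)"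

lemma epi_add: "epi (a + b) = epi a * epi b"
  by (simp add: epi_def exp_add algebra_simps)

lemma epi_diff: "epi (a - b) = epi a / epi b"
  by (simp add: epi_def exp_diff algebra_simps)

lemma epi_minus: "epi (- a) = inverse (epi a)"
  by (simp add: epi_def exp_minus)

lemma epi_nonzero [simp]: "epi a \<noteq> 0"
  by (simp add: epi_def)

lemma epi_0 [simp]: "epi 0 = 1"
  by (simp add: epi_def)

lemma epi_1 [simp]: "epi 1 = -1"
  by (simp add: epi_def)

lemma epi_half: "epi (1/2) = \<i>"
  using exp_pi_i by (simp add: epi_def exp_eq_polar cis.ctr complex_eq_iff Re_exp Im_exp)

lemma epi_eq_1_iff: "epi u = 1 \<longleftrightarrow> (\<exists>n::int. u = 2 * of_int n)"
proof -
  have "epi u = 1 \<longleftrightarrow> (\<exists>n::int. \<i> * of_real pi * u = \<i> * of_real pi * (2 * of_int n))"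
    unfolding epi_def exp_eq_1 by (auto simp: complex_eq_iff)
  thus ?thesis by simp
qed

lemma epi_even [simp]: "epi (2 * of_int n) = 1"
  by (subst epi_eq_1_iff) blast

lemma epi_2 [simp]: "epi 2 = 1"
  using epi_even[of 1] by simp

lemma epi_of_int: "epi (of_int n) = (if even n then 1 else -1)"
proof (cases "even n")
  case True
  then obtain m where "n = 2 * m" by auto
  thus ?thesis using epi_even[of m] by simp
next
  case False
  then obtain m where "n = 2 * m + 1" by (auto elim: oddE)
  thus ?thesis using epi_even[of m] by (simp add: epi_add)
qed

lemma epi_of_nat: "epi (of_nat n) = (-1) ^ n"
  using epi_of_int[of "int n"] by simp

lemma norm_epi: "norm (epi u) = exp (- (pi * Im u))"
  by (simp add: epi_def)

lemma holomorphic_epi [holomorphic_intros]: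
  "f holomorphic_on A \<Longrightarrow> (\<lambda>z. epi (f z)) holomorphic_on A"
  unfolding epi_def by (intro holomorphic_intros)

lemma qpow_eq_epi: "qpow \<tau> s = epi (\<tau> * s)"
  by (simp add: qpow_def epi_def mult_ac)

lemma cos_pi_eq_epi: "cos (of_real pi * z) = (epi z + epi (- z)) / 2"
  by (simp add: cos_exp_eq epi_def mult_ac)

lemma sin_pi_eq_epi: "sin (of_real pi * z) = (epi z - epi (- z)) / (2 * \<i>)"
  by (simp add: sin_exp_eq epi_def mult_ac)

subsection \<open>Series over the integers\<close>

lemma int_eq_range_Un: "range int \<union> range (\<lambda>n. - 1 - int n) = UNIV"
proof -
  have "n \<in> range int \<union> range (\<lambda>n. - 1 - int n)" for n
  proof (cases "n \<ge> 0")
    case True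
    thus ?thesis by (metis UnI1 nonneg_int_cases rangeI)
  next
    case False
    hence "n = - 1 - int (nat (- 1 - n))"
      by simp
    thus ?thesis by (metis UnI2 rangeI)
  qed
  thus ?thesis by blast
qed

lemma inj_int_reflect: "inj (\<lambda>n. - 1 - int n)"
  by (simp add: inj_on_def)

lemma
  fixes f :: "int \<Rightarrow> 'a :: banach"
  assumes "(f has_sum S) UNIV"
  shows has_sum_int_imp_sums_half: "(\<lambda>n. f (int n) + f (- 1 - int n)) sums S"
    and has_sum_int_imp_sums_pair: "(\<lambda>n. f (int (Suc n)) + f (- int (Suc n))) sums (S - f 0)"
proof -
  have sub: "f summable_on A" for A
    by (rule summable_on_subset_banach[OF has_sum_imp_summable[OF assms]]) simp
  define a b where "a = infsum f (range int)" and "b = infsum f (range (\<lambda>n. - 1 - int n))"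
  have a: "(f has_sum a) (range int)" and b: "(f has_sum b) (range (\<lambda>n. - 1 - int n))"
    unfolding a_def b_def by (intro has_sum_infsum sub)+
  have disj: "range int \<inter> range (\<lambda>n. - 1 - int n) = {}"
    by auto
  have S: "S = a + b"
    using has_sum_Un_disjoint[OF a b disj] assms unfolding int_eq_range_Un by (rule has_sum_unique[OF _ _, rotated])
  have a': "(\<lambda>n. f (int n)) sums a"
    using a has_sum_reindex[of int UNIV f a] by (simp add: o_def has_sum_imp_sums)
  have b': "(\<lambda>n. f (- 1 - int n)) sums b"
    using b has_sum_reindex[OF inj_int_reflect, of f b] by (simp add: o_def has_sum_imp_sums)
  show "(\<lambda>n. f (int n) + f (- 1 - int n)) sums S"
    unfolding S by (intro sums_add a' b')
  have a'': "(\<lambda>n. f (int (Suc n))) sums (a - f 0)"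
    by (subst sums_Suc_iff) (use a' in simp)
  have "(\<lambda>n. f (int (Suc n)) + f (- 1 - int n)) sums (a - f 0 + b)"
    by (intro sums_add a'' b')
  moreover have "- 1 - int n = - int (Suc n)" for n
    by simp
  moreover have "a - f 0 + b = S - f 0"
    by (simp add: S)
  ultimately show "(\<lambda>n. f (int (Suc n)) + f (- int (Suc n))) sums (S - f 0)"
    by (simp only:)
qed

lemma summable_on_int_geometric:
  fixes r :: real
  assumes "0 \<le> r" "r < 1"
  shows "(\<lambda>n. r ^ nat \<bar>n\<bar>) summable_on (UNIV :: int set)"
proof -
  have geo: "(\<lambda>n. r ^ n) summable_on UNIV"
    using assms by (intro norm_summable_imp_summable_on) auto
  hence geo': "(\<lambda>n. r * r ^ n) summable_on UNIV"
    by (rule summable_on_cmult_right)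
  have 1: "(\<lambda>n. r ^ nat \<bar>n\<bar>) summable_on (range int)"
    by (subst summable_on_reindex) (use geo in \<open>simp_all add: o_def\<close>)
  have eq: "r ^ nat \<bar>- 1 - int n\<bar> = r * r ^ n" for n
  proof -
    have "nat \<bar>- 1 - int n\<bar> = Suc n" by simp
    thus ?thesis by simp
  qed
  have 2: "(\<lambda>n. r ^ nat \<bar>n\<bar>) summable_on (range (\<lambda>n. - 1 - int n))"
    using summable_on_reindex[OF inj_int_reflect, of "\<lambda>n. r ^ nat \<bar>n\<bar>"] geo'
    by (simp only: o_def eq)
  have "range int \<inter> range (\<lambda>n. - 1 - int n) = {}"
    by auto
  from summable_on_Un_disjoint[OF 1 2 this] show ?thesis
    by (simp only: int_eq_range_Un)
qed

lemma abs_summable_on_int_geometric: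
  fixes f :: "int \<Rightarrow> complex"
  assumes "0 \<le> r" "r < 1" "\<And>n. norm (f n) \<le> C * r ^ nat \<bar>n\<bar>"
  shows "(\<lambda>n. norm (f n)) summable_on UNIV"
  using assms by (intro Infinite_Sum.abs_summable_on_comparison_test'[of "\<lambda>n. C * r ^ nat \<bar>n\<bar>"]
      summable_on_cmult_right summable_on_int_geometric) auto

lemma has_sum_int_convolution:
  fixes f g :: "int \<Rightarrow> complex"
  assumes f: "(\<lambda>n. norm (f n)) summable_on UNIV" and g: "(\<lambda>n. norm (g n)) summable_on UNIV"
  shows "((\<lambda>k. \<Sum>\<^sub>\<infinity>n. f n * g (k - n)) has_sum (infsum f UNIV * infsum g UNIV)) UNIV"
proof -
  define h where "h = (\<lambda>(n, m). f n * g m)"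
  have abs: "(\<lambda>p. norm (h p)) summable_on (UNIV \<times> UNIV)"
  proof (subst Infinite_Sum.abs_summable_on_Sigma_iff, intro conjI ballI)
    fix n show "(\<lambda>m. norm (h (n, m))) summable_on UNIV"
      using g by (auto simp: h_def norm_mult intro!: summable_on_cmult_right)
  next
    have "(\<lambda>n. norm (norm (f n) * (\<Sum>\<^sub>\<infinity>m. norm (g m)))) summable_on UNIV"
      using f by (auto simp: norm_mult infsum_nonneg intro!: summable_on_cmult_left)
    thus "(\<lambda>n. norm (\<Sum>\<^sub>\<infinity>m. norm (h (n, m)))) summable_on UNIV"
      by (simp add: h_def norm_mult infsum_cmult_right')
  qed
  hence sm: "h summable_on (UNIV \<times> UNIV)"
    by (rule abs_summable_summable)
  have "infsum h (UNIV \<times> UNIV) = (\<Sum>\<^sub>\<infinity>n. \<Sum>\<^sub>\<infinity>m. f n * g m)"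
    using infsum_Sigma'_banach[of "\<lambda>n m. f n * g m" UNIV "\<lambda>_. UNIV"] sm by (simp add: h_def)
  also have "\<dots> = infsum f UNIV * infsum g UNIV"
    by (simp add: infsum_cmult_right' infsum_cmult_left')
  finally have hs: "(h has_sum (infsum f UNIV * infsum g UNIV)) (UNIV \<times> UNIV)"
    using sm by (metis has_sum_infsum)
  have hs': "((\<lambda>(k, n). f n * g (k - n)) has_sum (infsum f UNIV * infsum g UNIV)) (UNIV \<times> UNIV)"
    using hs by (subst has_sum_reindex_bij_witness[where j = "\<lambda>(k, n). (n, k - n)"
        and i = "\<lambda>(n, m). (n + m, n)" and T = "UNIV \<times> UNIV" and h = h, OF _ _ _ _ _ refl])
      (auto simp: h_def)
  show ?thesis
  proof (rule has_sum_SigmaD[OF hs'], goal_cases)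
    case (1 k)
    have "(\<lambda>(k, n). f n * g (k - n)) summable_on (UNIV \<times> UNIV)"
      using hs' by (rule has_sum_imp_summable)
    hence "(\<lambda>n. f n * g (k - n)) summable_on UNIV"
      by (rule summable_on_SigmaD1) simp
    thus ?case
      by simp
  qed
qed

lemma holomorphic_on_infsum:
  fixes f :: "'a \<Rightarrow> complex \<Rightarrow> complex"
  assumes "open S" "\<And>n. f n holomorphic_on S"
    and "\<And>n z. z \<in> S \<Longrightarrow> norm (f n z) \<le> M n" and "M summable_on UNIV"
  shows "(\<lambda>z. \<Sum>\<^sub>\<infinity>n. f n z) holomorphic_on S"
proof (rule analytic_imp_holomorphic, unfold analytic_on_def, safe)
  fix z assume "z \<in> S"
  with assms(1) obtain r where r: "r > 0" "cball z r \<subseteq> S"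
    using open_contains_cball by blast
  have lim: "uniform_limit (cball z r) (\<lambda>X y. \<Sum>x\<in>X. f x y) (\<lambda>y. \<Sum>\<^sub>\<infinity>x. f x y)
          (finite_subsets_at_top UNIV)"
    using r assms by (intro Weierstrass_m_test_general[where M = M]) auto
  have hol: "continuous_on (cball z r) (\<lambda>y. \<Sum>x\<in>X. f x y) \<and>
                 (\<lambda>y. \<Sum>x\<in>X. f x y) holomorphic_on ball z r" for X
    using r by (intro conjI holomorphic_on_imp_continuous_on holomorphic_on_sum
      holomorphic_on_subset[OF assms(2)] order.trans[OF ball_subset_cball])
  have "(\<lambda>y. \<Sum>\<^sub>\<infinity>x. f x y) holomorphic_on ball z r"
    using holomorphic_uniform_limit[OF always_eventually[OF allI[OF hol]] lim] by simp
  thus "\<exists>e>0. (\<lambda>z. \<Sum>\<^sub>\<infinity>n. f n z) holomorphic_on ball z e"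
    using r by blast
qed

subsection \<open>The theta series\<close>

definition jtheta :: "complex \<Rightarrow> complex \<Rightarrow> complex" where
  "jtheta \<tau> z = (\<Sum>\<^sub>\<infinity>n::int. epi (\<tau> * of_int n ^ 2 + 2 * of_int n * z))"

lemma exp_minus_power_nat_abs: "exp (- a) ^ nat \<bar>n\<bar> = exp (- (a * \<bar>of_int n\<bar>))"
  for a :: real and n :: int
proof -
  have "exp (- a) ^ nat \<bar>n\<bar> = exp (real (nat \<bar>n\<bar>) * (- a))"
    by (simp only: exp_of_nat_mult)
  thus ?thesis
    by (simp add: mult.commute)
qed

lemma jtheta_term_bound:
  assumes "Im \<tau> > 0"
  shows "\<exists>C. \<forall>n z. \<bar>Im z\<bar> \<le> R \<longrightarrow>
    norm (epi (\<tau> * of_int n ^ 2 + 2 * of_int n * z)) \<le> C * exp (- 1) ^ nat \<bar>n\<bar>"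
proof (intro exI allI impI)
  fix n :: int and z :: complex
  assume z: "\<bar>Im z\<bar> \<le> R"
  define a b m where "a = pi * Im \<tau>" and "b = 2 * pi * R + 1" and "m = \<bar>real_of_int n\<bar>"
  have a: "a > 0" using assms by (simp add: a_def)
  have "0 \<le> (2 * a * m - b)\<^sup>2 / (4 * a)"
    using a by simp
  also have "\<dots> = a * m\<^sup>2 - b * m + b\<^sup>2 / (4 * a)"
    using a by (simp add: power2_eq_square field_simps)
  finally have 1: "b * m - a * m\<^sup>2 \<le> b\<^sup>2 / (4 * a)"
    by simp
  have "- (2 * pi * (of_int n * Im z)) \<le> \<bar>2 * pi * (of_int n * Im z)\<bar>"
    by linarith
  also have "\<dots> = 2 * pi * (m * \<bar>Im z\<bar>)"
    by (simp add: abs_mult m_def)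
  also have "\<dots> \<le> 2 * pi * (m * R)"
    using z by (intro mult_left_mono) (auto simp: m_def)
  finally have 2: "- (2 * pi * (of_int n * Im z)) \<le> 2 * pi * (m * R)" .
  have im: "Im (\<tau> * of_int n ^ 2 + 2 * of_int n * z) = Im \<tau> * m\<^sup>2 + 2 * (of_int n * Im z)"
    by (simp add: m_def power2_eq_square)
  have "- (pi * (Im \<tau> * m\<^sup>2 + 2 * (of_int n * Im z))) = - (2 * pi * (of_int n * Im z)) - a * m\<^sup>2"
    by (simp add: a_def algebra_simps)
  also have "\<dots> \<le> 2 * pi * (m * R) - a * m\<^sup>2"
    using 2 by simp
  also have "\<dots> = (b * m - a * m\<^sup>2) - m"
    by (simp add: b_def algebra_simps)
  also have "\<dots> \<le> b\<^sup>2 / (4 * a) - m"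
    using 1 by simp
  finally have "norm (epi (\<tau> * of_int n ^ 2 + 2 * of_int n * z)) \<le> exp (b\<^sup>2 / (4 * a) - m)"
    unfolding norm_epi im by simp
  also have "\<dots> = exp (b\<^sup>2 / (4 * a)) * exp (- 1) ^ nat \<bar>n\<bar>"
    unfolding exp_minus_power_nat_abs by (simp add: m_def exp_diff exp_minus field_simps)
  finally show "norm (epi (\<tau> * of_int n ^ 2 + 2 * of_int n * z))
      \<le> exp ((2 * pi * R + 1)\<^sup>2 / (4 * (pi * Im \<tau>))) * exp (- 1) ^ nat \<bar>n\<bar>"
    unfolding a_def b_def .
qed

lemma abs_summable_jtheta:
  assumes "Im \<tau> > 0"
  shows "(\<lambda>n::int. norm (epi (\<tau> * of_int n ^ 2 + 2 * of_int n * z))) summable_on UNIV"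
proof -
  obtain C where "\<And>n. norm (epi (\<tau> * of_int n ^ 2 + 2 * of_int n * z)) \<le> C * exp (- 1) ^ nat \<bar>n\<bar>"
    using jtheta_term_bound[OF assms, of "\<bar>Im z\<bar>"] by blast
  thus ?thesis
    by (intro abs_summable_on_int_geometric[where r = "exp (-1)" and C = C]) auto
qed

lemma has_sum_jtheta:
  assumes "Im \<tau> > 0"
  shows "((\<lambda>n::int. epi (\<tau> * of_int n ^ 2 + 2 * of_int n * z)) has_sum jtheta \<tau> z) UNIV"
  unfolding jtheta_def
  by (rule has_sum_infsum[OF abs_summable_summable[OF abs_summable_jtheta[OF assms]]])

lemma holomorphic_jtheta:
  assumes "Im \<tau> > 0"
  shows "jtheta \<tau> holomorphic_on UNIV"
proof -
  have "jtheta \<tau> holomorphic_on {z. \<bar>Im z\<bar> < R}" for R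
  proof -
    obtain C where C: "\<And>n z. \<bar>Im z\<bar> \<le> R \<Longrightarrow>
        norm (epi (\<tau> * of_int n ^ 2 + 2 * of_int n * z)) \<le> C * exp (- 1) ^ nat \<bar>n\<bar>"
      using jtheta_term_bound[OF assms, of R] by blast
    have "open {z. \<bar>Im z\<bar> < R}"
      by (intro open_Collect_less continuous_intros)
    thus ?thesis unfolding jtheta_def using C
      by (intro holomorphic_on_infsum[where M = "\<lambda>n. C * exp (- 1) ^ nat \<bar>n\<bar>"] holomorphic_intros
          summable_on_cmult_right summable_on_int_geometric) auto
  qed
  hence "jtheta \<tau> field_differentiable (at z)" for z
    by (rule holomorphic_on_imp_differentiable_at[of _ "{u. \<bar>Im u\<bar> < \<bar>Im z\<bar> + 1}"])
       (auto intro!: open_Collect_less continuous_intros)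
  thus ?thesis
    by (simp add: holomorphic_on_def)
qed

lemma holomorphic_jtheta' [holomorphic_intros]:
  assumes "Im \<tau> > 0" "f holomorphic_on A"
  shows "(\<lambda>z. jtheta \<tau> (f z)) holomorphic_on A"
  using holomorphic_on_compose_gen[OF assms(2) holomorphic_jtheta[OF assms(1)]] by (simp add: o_def)

lemma isCont_jtheta: "Im \<tau> > 0 \<Longrightarrow> isCont (jtheta \<tau>) z"
  using holomorphic_jtheta[of \<tau>] holomorphic_on_imp_continuous_on continuous_on_eq_continuous_at
  by blast

lemma jtheta_add_1: "jtheta \<tau> (z + 1) = jtheta \<tau> z"
  unfolding jtheta_def
proof (rule infsum_cong)
  fix n :: int
  have "\<tau> * of_int n ^ 2 + 2 * of_int n * (z + 1) = (\<tau> * of_int n ^ 2 + 2 * of_int n * z) + 2 * of_int n"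
    by (simp add: algebra_simps)
  thus "epi (\<tau> * of_int n ^ 2 + 2 * of_int n * (z + 1)) = epi (\<tau> * of_int n ^ 2 + 2 * of_int n * z)"
    by (simp only: epi_add epi_even) simp
qed

lemma jtheta_minus: "jtheta \<tau> (- z) = jtheta \<tau> z"
  unfolding jtheta_def
  by (rule infsum_reindex_bij_witness[where i = uminus and j = uminus]) auto

lemma jtheta_add_tau: "jtheta \<tau> (z + \<tau>) = epi (- \<tau> - 2 * z) * jtheta \<tau> z"
proof -
  have "jtheta \<tau> (z + \<tau>) = (\<Sum>\<^sub>\<infinity>n::int. epi (- \<tau> - 2 * z) * epi (\<tau> * of_int n ^ 2 + 2 * of_int n * z))"
    unfolding jtheta_def
  proof (rule infsum_reindex_bij_witness[where i = "\<lambda>n. n - 1" and j = "\<lambda>n. n + 1"])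
    fix n :: int
    have eq: "- \<tau> - 2 * z + (\<tau> * of_int (n + 1) ^ 2 + 2 * of_int (n + 1) * z)
            = \<tau> * of_int n ^ 2 + 2 * of_int n * (z + \<tau>)"
      by (simp add: power2_eq_square algebra_simps)
    show "epi (- \<tau> - 2 * z) * epi (\<tau> * of_int (n + 1) ^ 2 + 2 * of_int (n + 1) * z) =
          epi (\<tau> * of_int n ^ 2 + 2 * of_int n * (z + \<tau>))"
      unfolding epi_add[symmetric] eq ..
  qed auto
  thus ?thesis
    by (simp add: infsum_cmult_right' jtheta_def)
qed

lemma jtheta_add_of_int: "jtheta \<tau> (z + of_int n) = jtheta \<tau> z"
proof (induction n rule: int_induct[where k = 0])
  case (step1 i) thus ?case using jtheta_add_1[of \<tau> "z + of_int i"] by (simp add: add_ac)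
next
  case (step2 i) thus ?case using jtheta_add_1[of \<tau> "z + of_int (i - 1)"] by (simp add: add_ac)
qed simp

lemma jtheta_add_of_int_tau:
  "\<exists>c. c \<noteq> 0 \<and> jtheta \<tau> (z + of_int n * \<tau>) = c * jtheta \<tau> z"
proof (induction n rule: int_induct[where k = 0])
  case base thus ?case by (intro exI[of _ 1]) auto
next
  case (step1 i)
  then obtain c where c: "c \<noteq> 0" "jtheta \<tau> (z + of_int i * \<tau>) = c * jtheta \<tau> z" by blast
  have eq: "z + of_int (i + 1) * \<tau> = (z + of_int i * \<tau>) + \<tau>" by (simp add: algebra_simps)
  show ?case unfolding eq jtheta_add_tau c(2)
    by (intro exI[of _ "epi (- \<tau> - 2 * (z + of_int i * \<tau>)) * c"]) (simp add: c(1))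
next
  case (step2 i)
  then obtain c where c: "c \<noteq> 0" "jtheta \<tau> (z + of_int i * \<tau>) = c * jtheta \<tau> z" by blast
  define u where "u = z + of_int (i - 1) * \<tau>"
  have "z + of_int i * \<tau> = u + \<tau>" by (simp add: u_def algebra_simps)
  hence "c * jtheta \<tau> z = epi (- \<tau> - 2 * u) * jtheta \<tau> u"
    using c jtheta_add_tau[of \<tau> u] by simp
  thus ?case using c(1) unfolding u_def[symmetric]
    by (intro exI[of _ "c / epi (- \<tau> - 2 * u)"]) (simp add: field_simps)
qed

definition jsigma :: "complex \<Rightarrow> complex" where
  "jsigma \<tau> = (1 - \<tau>) / 2"

lemma jtheta_jsigma_term:
  "epi (\<tau> * of_int n ^ 2 + 2 * of_int n * (z + jsigma \<tau>)) =
   epi (\<tau> * of_int n ^ 2 + 2 * of_int n * jsigma \<tau>) * epi (2 * of_int n * z)"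
  unfolding epi_add[symmetric] by (simp add: algebra_simps)

lemma jtheta_jsigma: "jtheta \<tau> (jsigma \<tau>) = 0"
proof -
  have "jtheta \<tau> (jsigma \<tau>) = (\<Sum>\<^sub>\<infinity>n::int. - epi (\<tau> * of_int n ^ 2 + 2 * of_int n * jsigma \<tau>))"
    unfolding jtheta_def
  proof (rule infsum_reindex_bij_witness[where i = "\<lambda>n. 1 - n" and j = "\<lambda>n. 1 - n"])
    fix n :: int
    have eq: "\<tau> * of_int n ^ 2 + 2 * of_int n * jsigma \<tau>
        = (\<tau> * of_int (1 - n) ^ 2 + 2 * of_int (1 - n) * jsigma \<tau>) + 2 * of_int n - 1"
      by (simp add: power2_eq_square field_simps jsigma_def)
    show "- epi (\<tau> * of_int (1 - n) ^ 2 + 2 * of_int (1 - n) * jsigma \<tau>)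
        = epi (\<tau> * of_int n ^ 2 + 2 * of_int n * jsigma \<tau>)"
      by (subst eq) (simp only: epi_add epi_diff epi_even epi_1, simp)
  qed auto
  hence "jtheta \<tau> (jsigma \<tau>) = - jtheta \<tau> (jsigma \<tau>)"
    by (simp add: infsum_uminus jtheta_def)
  thus ?thesis
    by simp
qed

subsection \<open>The coefficients of the Lambert series\<close>

definition period_lattice :: "complex \<Rightarrow> complex set" where
  "period_lattice \<tau> = {of_int m + of_int n * \<tau> | m n. True}"

definition lcoeff :: "complex \<Rightarrow> complex \<Rightarrow> int \<Rightarrow> complex" where
  "lcoeff \<tau> w n = 1 / (1 - epi (2 * w + 2 * of_int n * \<tau>))"

lemma uminus_in_period_lattice: "w \<in> period_lattice \<tau> \<Longrightarrow> - w \<in> period_lattice \<tau>"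
proof -
  assume "w \<in> period_lattice \<tau>"
  then obtain m n where "w = of_int m + of_int n * \<tau>" by (auto simp: period_lattice_def)
  hence "- w = of_int (- m) + of_int (- n) * \<tau>" by simp
  thus ?thesis unfolding period_lattice_def by blast
qed

lemma lcoeff_denominator_nonzero:
  assumes "w \<notin> period_lattice \<tau>"
  shows "1 - epi (2 * w + 2 * of_int n * \<tau>) \<noteq> 0"
proof
  assume "1 - epi (2 * w + 2 * of_int n * \<tau>) = 0"
  then obtain m :: int where "2 * w + 2 * of_int n * \<tau> = 2 * of_int m"
    using epi_eq_1_iff by (metis right_minus_eq)
  hence "2 * (w + of_int n * \<tau>) = 2 * of_int m"
    by (simp only: distrib_left mult.assoc)
  hence "w + of_int n * \<tau> = of_int m"
    by (subst (asm) mult_cancel_left) simp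
  hence "w = of_int m + of_int (- n) * \<tau>"
    by (simp add: eq_diff_eq)
  thus False using assms unfolding period_lattice_def by blast
qed

lemma lcoeff_reflect:
  assumes "w \<notin> period_lattice \<tau>"
  shows "lcoeff \<tau> w (- n) = 1 - lcoeff \<tau> (- w) n"
proof -
  define Y where "Y = epi (2 * w + 2 * of_int (- n) * \<tau>)"
  have eq: "epi (2 * (- w) + 2 * of_int n * \<tau>) = inverse Y"
    unfolding Y_def epi_minus[symmetric] by simp
  have "Y \<noteq> 0" "1 - Y \<noteq> 0"
    unfolding Y_def by (rule epi_nonzero, rule lcoeff_denominator_nonzero[OF assms])
  thus ?thesis
    unfolding lcoeff_def Y_def[symmetric] eq by (simp add: field_simps)
qed

lemma lcoeff_nat_bound:
  assumes "Im \<tau> > 0" "w \<notin> period_lattice \<tau>"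
  shows "\<exists>C\<ge>0. \<forall>m. norm (lcoeff \<tau> w (int m) - 1) \<le> C * exp (- (2 * pi * Im \<tau>)) ^ m"
proof -
  define \<rho> where "\<rho> = exp (- (2 * pi * Im \<tau>))"
  define Y where "Y m = epi (2 * w + 2 * of_int (int m) * \<tau>)" for m
  have nz: "1 - Y m \<noteq> 0" for m
    using lcoeff_denominator_nonzero[OF assms(2)] unfolding Y_def .
  have norm_Y: "norm (Y m) = norm (epi (2 * w)) * \<rho> ^ m" for m
    by (simp add: Y_def epi_add norm_mult \<rho>_def norm_epi exp_minus_power_nat_abs[of _ "int m", simplified] mult_ac)
  have "(\<lambda>m. norm (epi (2 * w)) * \<rho> ^ m) \<longlonglongrightarrow> norm (epi (2 * w)) * 0"
    using assms(1) by (intro tendsto_intros LIMSEQ_realpow_zero) (auto simp: \<rho>_def)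
  hence "Y \<longlonglongrightarrow> 0"
    by (subst tendsto_norm_zero_iff[symmetric]) (simp add: norm_Y)
  hence "(\<lambda>m. inverse (1 - Y m)) \<longlonglongrightarrow> inverse (1 - 0)"
    by (intro tendsto_intros) auto
  hence "Bseq (\<lambda>m. inverse (1 - Y m))"
    by (rule convergent_imp_Bseq[OF convergentI])
  then obtain K where K: "K > 0" "\<And>m. norm (inverse (1 - Y m)) \<le> K"
    by (auto elim: BseqE)
  have "norm (lcoeff \<tau> w (int m) - 1) \<le> (norm (epi (2 * w)) * K) * \<rho> ^ m" for m
  proof -
    have "lcoeff \<tau> w (int m) - 1 = Y m * inverse (1 - Y m)"
      using nz[of m] unfolding lcoeff_def Y_def[symmetric] by (simp add: field_simps)
    hence "norm (lcoeff \<tau> w (int m) - 1) = norm (Y m) * norm (inverse (1 - Y m))"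
      by (simp only: norm_mult)
    also have "\<dots> \<le> norm (Y m) * K"
      by (intro mult_left_mono K) auto
    finally show ?thesis by (simp add: norm_Y mult_ac)
  qed
  thus ?thesis
    using K(1) unfolding \<rho>_def by (intro exI[of _ "norm (epi (2 * w)) * K"]) auto
qed

lemma lcoeff_bounds:
  assumes "Im \<tau> > 0" "w \<notin> period_lattice \<tau>"
  obtains C where "C \<ge> 0"
    "\<And>m. norm (lcoeff \<tau> w (int m) - 1) \<le> C * exp (- (2 * pi * Im \<tau>)) ^ m"
    "\<And>m. norm (lcoeff \<tau> w (- int m)) \<le> C * exp (- (2 * pi * Im \<tau>)) ^ m"
    "\<And>n. norm (lcoeff \<tau> w n) \<le> C"
proof -
  define \<rho> where "\<rho> = exp (- (2 * pi * Im \<tau>))"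
  have \<rho>: "0 \<le> \<rho>" "\<rho> \<le> 1" using assms(1) by (auto simp: \<rho>_def)
  obtain C1 where C1: "C1 \<ge> 0" "\<And>m. norm (lcoeff \<tau> w (int m) - 1) \<le> C1 * \<rho> ^ m"
    using lcoeff_nat_bound[OF assms] unfolding \<rho>_def by blast
  have "- w \<notin> period_lattice \<tau>"
    using assms(2) uminus_in_period_lattice[of "- w"] by auto
  then obtain C2 where C2: "C2 \<ge> 0" "\<And>m. norm (lcoeff \<tau> (- w) (int m) - 1) \<le> C2 * \<rho> ^ m"
    using lcoeff_nat_bound[OF assms(1)] unfolding \<rho>_def by blast
  have neg: "norm (lcoeff \<tau> w (- int m)) \<le> C2 * \<rho> ^ m" for m
    using C2(2)[of m] by (simp add: lcoeff_reflect[OF assms(2)] norm_minus_commute)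
  define C where "C = C1 + C2 + 1"
  have le: "C1 * \<rho> ^ m \<le> C * \<rho> ^ m" "C2 * \<rho> ^ m \<le> C * \<rho> ^ m" for m
    using \<rho> C1(1) C2(1) by (auto simp: C_def intro!: mult_right_mono)
  have \<rho>1: "\<rho> ^ m \<le> 1" for m using \<rho> by (simp add: power_le_one)
  show ?thesis
  proof (rule that[of C])
    show "C \<ge> 0" using C1(1) C2(1) by (simp add: C_def)
    show "norm (lcoeff \<tau> w (int m) - 1) \<le> C * exp (- (2 * pi * Im \<tau>)) ^ m" for m
      using order.trans[OF C1(2) le(1)] unfolding \<rho>_def .
    show "norm (lcoeff \<tau> w (- int m)) \<le> C * exp (- (2 * pi * Im \<tau>)) ^ m" for m
      using order.trans[OF neg le(2)] unfolding \<rho>_def .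
    show "norm (lcoeff \<tau> w n) \<le> C" for n
    proof (cases "n \<ge> 0")
      case True
      then obtain m where m: "n = int m" using nonneg_int_cases by blast
      have "norm (lcoeff \<tau> w n) \<le> norm (lcoeff \<tau> w n - 1) + 1"
        using norm_triangle_ineq[of "lcoeff \<tau> w n - 1" 1] by simp
      also have "\<dots> \<le> C1 * 1 + 1"
        using C1(2)[of m] mult_left_mono[OF \<rho>1 C1(1), of m] by (simp add: m)
      also have "\<dots> \<le> C" using C2(1) by (simp add: C_def)
      finally show ?thesis .
    next
      case False
      then obtain m where m: "n = - int m" by (metis int_cases2 nle_le of_nat_0_le_iff)
      have "norm (lcoeff \<tau> w n) \<le> C2 * 1"
        using neg[of m] mult_left_mono[OF \<rho>1 C2(1), of m] by (simp add: m)
      also have "\<dots> \<le> C" using C1(1) by (simp add: C_def)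
      finally show ?thesis .
    qed
  qed
qed

lemma lcoeff_diff_bound:
  assumes "Im \<tau> > 0" "w \<notin> period_lattice \<tau>"
  obtains C where "C \<ge> 0"
    "\<And>n. norm (lcoeff \<tau> w n - lcoeff \<tau> w (n - 1)) \<le> C * exp (- (2 * pi * Im \<tau>)) ^ nat \<bar>n\<bar>"
proof -
  define \<rho> where "\<rho> = exp (- (2 * pi * Im \<tau>))"
  have \<rho>: "0 < \<rho>" "\<rho> \<le> 1" using assms(1) by (auto simp: \<rho>_def)
  obtain C where C: "C \<ge> 0" "\<And>m. norm (lcoeff \<tau> w (int m) - 1) \<le> C * \<rho> ^ m"
      "\<And>m. norm (lcoeff \<tau> w (- int m)) \<le> C * \<rho> ^ m"
    using lcoeff_bounds[OF assms] unfolding \<rho>_def by metis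
  have \<rho>': "1 \<le> 1 / \<rho>" using \<rho> by simp
  have "norm (lcoeff \<tau> w n - lcoeff \<tau> w (n - 1)) \<le> (C + C / \<rho>) * \<rho> ^ nat \<bar>n\<bar>" for n
  proof (cases "n \<ge> 1")
    case True
    define m where "m = nat (n - 1)"
    have n: "n = int (Suc m)" "n - 1 = int m" using True by (simp_all add: m_def)
    have "norm (lcoeff \<tau> w n - lcoeff \<tau> w (n - 1)) \<le>
        norm (lcoeff \<tau> w n - 1) + norm (lcoeff \<tau> w (n - 1) - 1)"
      using norm_triangle_ineq4[of "lcoeff \<tau> w n - 1" "lcoeff \<tau> w (n - 1) - 1"] by simp
    also have "\<dots> \<le> C * \<rho> ^ Suc m + C * \<rho> ^ m"
      using C(2)[of "Suc m"] C(2)[of m] by (intro add_mono) (simp_all only: n[symmetric])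
    also have "\<dots> = (C + C / \<rho>) * \<rho> ^ nat \<bar>n\<bar>"
      using \<rho> unfolding n(1) by (simp add: field_simps del: of_nat_Suc)
    finally show ?thesis .
  next
    case False
    define m where "m = nat (- n)"
    have n: "n = - int m" "n - 1 = - int (Suc m)" using False by (simp_all add: m_def)
    have "norm (lcoeff \<tau> w n - lcoeff \<tau> w (n - 1)) \<le> norm (lcoeff \<tau> w n) + norm (lcoeff \<tau> w (n - 1))"
      by (rule norm_triangle_ineq4)
    also have "\<dots> \<le> C * \<rho> ^ m + C * \<rho> ^ Suc m"
      using C(3)[of "Suc m"] C(3)[of m] by (intro add_mono) (simp_all only: n[symmetric])
    also have "C * \<rho> ^ Suc m \<le> C / \<rho> * \<rho> ^ m"
    proof -
      have "\<rho> \<le> 1 / \<rho>" using \<rho> \<rho>' by linarith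
      from mult_left_mono[OF this, of "C * \<rho> ^ m"] C(1) \<rho> show ?thesis
        by (simp add: mult_ac)
    qed
    finally show ?thesis
      unfolding n(1) by (simp add: algebra_simps)
  qed
  thus ?thesis
    using that[of "C + C / \<rho>"] C(1) \<rho> unfolding \<rho>_def by auto
qed

lemma lcoeff_tendsto:
  assumes "Im \<tau> > 0" "w \<notin> period_lattice \<tau>"
  shows "(\<lambda>m. lcoeff \<tau> w (int m)) \<longlonglongrightarrow> 1" and "(\<lambda>m. lcoeff \<tau> w (- int m)) \<longlonglongrightarrow> 0"
proof -
  define \<rho> where "\<rho> = exp (- (2 * pi * Im \<tau>))"
  obtain C where C: "C \<ge> 0" "\<And>m. norm (lcoeff \<tau> w (int m) - 1) \<le> C * \<rho> ^ m"
      "\<And>m. norm (lcoeff \<tau> w (- int m)) \<le> C * \<rho> ^ m"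
    using lcoeff_bounds[OF assms] unfolding \<rho>_def by metis
  have "(\<lambda>m. C * \<rho> ^ m) \<longlonglongrightarrow> C * 0"
    using assms(1) by (intro tendsto_intros LIMSEQ_realpow_zero) (auto simp: \<rho>_def)
  hence lim: "(\<lambda>m. C * \<rho> ^ m) \<longlonglongrightarrow> 0" by simp
  show "(\<lambda>m. lcoeff \<tau> w (int m)) \<longlonglongrightarrow> 1"
    by (rule Lim_null[THEN iffD2], rule Lim_null_comparison[OF always_eventually lim]) (use C in auto)
  show "(\<lambda>m. lcoeff \<tau> w (- int m)) \<longlonglongrightarrow> 0"
    by (rule Lim_null_comparison[OF always_eventually lim]) (use C in auto)
qed

lemma lcoeff_diff_has_sum:
  assumes "Im \<tau> > 0" "w \<notin> period_lattice \<tau>"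
  shows "((\<lambda>n. lcoeff \<tau> w n - lcoeff \<tau> w (n - 1)) has_sum 1) UNIV"
proof -
  define \<kappa> where "\<kappa> n = lcoeff \<tau> w n - lcoeff \<tau> w (n - 1)" for n
  obtain C where C: "\<And>n. norm (\<kappa> n) \<le> C * exp (- (2 * pi * Im \<tau>)) ^ nat \<bar>n\<bar>"
    using lcoeff_diff_bound[OF assms] unfolding \<kappa>_def by metis
  have "(\<lambda>n. norm (\<kappa> n)) summable_on UNIV"
    using assms(1) by (intro abs_summable_on_int_geometric[OF _ _ C]) auto
  hence hs: "(\<kappa> has_sum infsum \<kappa> UNIV) UNIV"
    by (rule has_sum_infsum[OF abs_summable_summable])
  have partial: "(\<Sum>n<N. \<kappa> (int n) + \<kappa> (- 1 - int n)) = lcoeff \<tau> w (int N - 1) - lcoeff \<tau> w (- 1 - int N)" for N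
    by (induction N) (simp_all add: \<kappa>_def algebra_simps)
  have "(\<lambda>N. lcoeff \<tau> w (int N) - lcoeff \<tau> w (- int (Suc (Suc N)))) \<longlonglongrightarrow> 1 - 0"
    using LIMSEQ_ignore_initial_segment[OF lcoeff_tendsto(2)[OF assms], of 2]
    by (intro tendsto_diff lcoeff_tendsto(1)[OF assms]) simp
  moreover have "lcoeff \<tau> w (int N) - lcoeff \<tau> w (- int (Suc (Suc N))) =
      (\<Sum>n<Suc N. \<kappa> (int n) + \<kappa> (- 1 - int n))" for N
    unfolding partial by (simp add: algebra_simps)
  ultimately have "(\<lambda>N. \<Sum>n<Suc N. \<kappa> (int n) + \<kappa> (- 1 - int n)) \<longlonglongrightarrow> 1"
    by simp
  hence "(\<lambda>n. \<kappa> (int n) + \<kappa> (- 1 - int n)) sums 1"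
    unfolding sums_def by (rule LIMSEQ_imp_Suc)
  with has_sum_int_imp_sums_half[OF hs] have "infsum \<kappa> UNIV = 1"
    by (rule sums_unique2)
  with hs show ?thesis
    unfolding \<kappa>_def by simp
qed

lemma norm_epi_int_power: "norm (epi (2 * of_int n * z)) \<le> exp (2 * pi * \<bar>Im z\<bar>) ^ nat \<bar>n\<bar>"
proof -
  have "- (pi * Im (2 * of_int n * z)) \<le> \<bar>pi * Im (2 * of_int n * z)\<bar>"
    by linarith
  also have "\<dots> = 2 * pi * \<bar>Im z\<bar> * \<bar>of_int n\<bar>"
    by (simp add: abs_mult)
  finally show ?thesis
    using exp_minus_power_nat_abs[of "- (2 * pi * \<bar>Im z\<bar>)" n] by (simp add: norm_epi)
qed

lemma lambert_term_bound:
  assumes "norm (c n) \<le> C * exp (- a) ^ nat \<bar>n\<bar>" "C \<ge> 0" "\<bar>Im z\<bar> \<le> R"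
  shows "norm (c n * epi (2 * of_int n * z)) \<le> C * exp (2 * pi * R - a) ^ nat \<bar>n\<bar>"
proof -
  have "norm (c n * epi (2 * of_int n * z))
      \<le> (C * exp (- a) ^ nat \<bar>n\<bar>) * exp (2 * pi * \<bar>Im z\<bar>) ^ nat \<bar>n\<bar>"
    unfolding norm_mult using assms(1,2) by (intro mult_mono norm_epi_int_power) auto
  also have "\<dots> \<le> (C * exp (- a) ^ nat \<bar>n\<bar>) * exp (2 * pi * R) ^ nat \<bar>n\<bar>"
    using assms(2,3) by (intro mult_left_mono power_mono) auto
  also have "\<dots> = C * exp (2 * pi * R - a) ^ nat \<bar>n\<bar>"
    unfolding mult.assoc power_mult_distrib[symmetric] exp_add[symmetric] by simp
  finally show ?thesis .
qed

text \<open>Multiplying the Lambert series \<open>\<Sum>n. lcoeff \<tau> w n * x\<^sup>n\<close>, \<open>x = epi (2 * z)\<close>, by \<open>1 - x\<close> removes its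
  pole at \<open>x = 1\<close> and extends the annulus of convergence across \<open>|x| = 1\<close>.\<close>

definition lambert_reg :: "complex \<Rightarrow> complex \<Rightarrow> complex \<Rightarrow> complex" where
  "lambert_reg \<tau> w z = (\<Sum>\<^sub>\<infinity>n. (lcoeff \<tau> w n - lcoeff \<tau> w (n - 1)) * epi (2 * of_int n * z))"

definition lambert_const :: "complex \<Rightarrow> complex \<Rightarrow> complex" where
  "lambert_const \<tau> w = (\<Sum>\<^sub>\<infinity>n::int. lcoeff \<tau> w n * epi (\<tau> * of_int n ^ 2 - 2 * of_int n * jsigma \<tau>))"

lemma abs_summable_lambert_reg:
  assumes "Im \<tau> > 0" "w \<notin> period_lattice \<tau>" "\<bar>Im z\<bar> < Im \<tau>"
  shows "(\<lambda>n. norm ((lcoeff \<tau> w n - lcoeff \<tau> w (n - 1)) * epi (2 * of_int n * z))) summable_on UNIV"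
proof -
  obtain C where C: "C \<ge> 0"
      "\<And>n. norm (lcoeff \<tau> w n - lcoeff \<tau> w (n - 1)) \<le> C * exp (- (2 * pi * Im \<tau>)) ^ nat \<bar>n\<bar>"
    using lcoeff_diff_bound[OF assms(1,2)] by metis
  show ?thesis
  proof (rule abs_summable_on_int_geometric[where C = C])
    show "norm ((lcoeff \<tau> w n - lcoeff \<tau> w (n - 1)) * epi (2 * of_int n * z))
        \<le> C * exp (2 * pi * \<bar>Im z\<bar> - 2 * pi * Im \<tau>) ^ nat \<bar>n\<bar>" for n
      by (rule lambert_term_bound[where c = "\<lambda>n. lcoeff \<tau> w n - lcoeff \<tau> w (n - 1)", OF C(2,1) order.refl])
  qed (use assms(3) in auto)
qed

lemma holomorphic_lambert_reg:
  assumes "Im \<tau> > 0" "w \<notin> period_lattice \<tau>"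
  shows "lambert_reg \<tau> w holomorphic_on {z. \<bar>Im z\<bar> < Im \<tau> / 2}"
proof -
  obtain C where C: "C \<ge> 0"
      "\<And>n. norm (lcoeff \<tau> w n - lcoeff \<tau> w (n - 1)) \<le> C * exp (- (2 * pi * Im \<tau>)) ^ nat \<bar>n\<bar>"
    using lcoeff_diff_bound[OF assms(1,2)] by metis
  have op: "open {z. \<bar>Im z\<bar> < Im \<tau> / 2}"
    by (intro open_Collect_less continuous_intros)
  show ?thesis unfolding lambert_reg_def
  proof (rule holomorphic_on_infsum[OF op])
    show "norm ((lcoeff \<tau> w n - lcoeff \<tau> w (n - 1)) * epi (2 * of_int n * z))
        \<le> C * exp (2 * pi * (Im \<tau> / 2) - 2 * pi * Im \<tau>) ^ nat \<bar>n\<bar>"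
      if "z \<in> {z. \<bar>Im z\<bar> < Im \<tau> / 2}" for n z
      using that
      by (intro lambert_term_bound[where c = "\<lambda>n. lcoeff \<tau> w n - lcoeff \<tau> w (n - 1)", OF C(2,1)]) auto
    show "(\<lambda>n. C * exp (2 * pi * (Im \<tau> / 2) - 2 * pi * Im \<tau>) ^ nat \<bar>n\<bar>) summable_on UNIV"
      using assms(1) by (intro summable_on_cmult_right summable_on_int_geometric) auto
  qed (intro holomorphic_intros)
qed

lemma lambert_reg_0:
  assumes "Im \<tau> > 0" "w \<notin> period_lattice \<tau>"
  shows "lambert_reg \<tau> w 0 = 1"
  using infsumI[OF lcoeff_diff_has_sum[OF assms]] by (simp add: lambert_reg_def)

lemma lambert_convolution:
  fixes k :: int
  assumes "Im \<tau> > 0" "w \<notin> period_lattice \<tau>"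
  defines "s \<equiv> \<lambda>n::int. epi (\<tau> * of_int n ^ 2 + 2 * of_int n * jsigma \<tau>)"
  shows "((\<lambda>n. lcoeff \<tau> w n * s (k - n)) has_sum
           (lambert_const \<tau> w * epi (2 * of_int k * w) * s k)) UNIV"
proof -
  obtain C where C: "\<And>n. norm (lcoeff \<tau> w n) \<le> C"
    using lcoeff_bounds[OF assms(1,2)] by metis
  have s_sum: "(\<lambda>n. norm (s n)) summable_on UNIV"
    unfolding s_def by (rule abs_summable_jtheta[OF assms(1)])
  have s_sum': "(\<lambda>n. norm (s (k - n))) summable_on UNIV" for k
    using summable_on_reindex_bij_witness[of UNIV "\<lambda>n. k - n" "\<lambda>n. k - n" UNIV "\<lambda>n. norm (s n)"]
      s_sum by simp
  have "(\<lambda>n. norm (lcoeff \<tau> w n * s (k - n))) summable_on UNIV" for k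
  proof (rule Infinite_Sum.abs_summable_on_comparison_test')
    show "(\<lambda>n. C * norm (s (k - n))) summable_on UNIV"
      by (intro summable_on_cmult_right s_sum')
    show "norm (lcoeff \<tau> w n * s (k - n)) \<le> C * norm (s (k - n))" for n
      unfolding norm_mult by (intro mult_right_mono C) auto
  qed
  hence summ: "(\<lambda>n. lcoeff \<tau> w n * s (k - n)) summable_on UNIV" for k
    by (rule abs_summable_summable)
  define b where "b k = (\<Sum>\<^sub>\<infinity>n. lcoeff \<tau> w n * s (k - n))" for k
  have rec: "b k = - epi (2 * w + 2 * of_int (k - 1) * \<tau>) * b (k - 1)" for k
  proof -
    have "b k + epi (2 * w + 2 * of_int (k - 1) * \<tau>) * b (k - 1)
        = (\<Sum>\<^sub>\<infinity>n. lcoeff \<tau> w n * s (k - n) +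
             epi (2 * w + 2 * of_int (k - 1) * \<tau>) * (lcoeff \<tau> w n * s (k - 1 - n)))"
      unfolding b_def by (simp add: infsum_add summ summable_on_cmult_right infsum_cmult_right')
    also have "\<dots> = (\<Sum>\<^sub>\<infinity>n. s (k - n))"
    proof (rule infsum_cong)
      fix n :: int
      have eq: "2 * w + 2 * of_int (k - 1) * \<tau> + (\<tau> * of_int (k - 1 - n) ^ 2 + 2 * of_int (k - 1 - n) * jsigma \<tau>)
          = (2 * w + 2 * of_int n * \<tau>) + (\<tau> * of_int (k - n) ^ 2 + 2 * of_int (k - n) * jsigma \<tau>) - 1"
        by (simp add: jsigma_def power2_eq_square field_simps)
      have "epi (2 * w + 2 * of_int (k - 1) * \<tau>) * s (k - 1 - n) = - (epi (2 * w + 2 * of_int n * \<tau>) * s (k - n))"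
        unfolding s_def epi_add[symmetric] eq by (simp add: epi_diff epi_add)
      hence "lcoeff \<tau> w n * s (k - n) + epi (2 * w + 2 * of_int (k - 1) * \<tau>) * (lcoeff \<tau> w n * s (k - 1 - n))
          = lcoeff \<tau> w n * (1 - epi (2 * w + 2 * of_int n * \<tau>)) * s (k - n)"
        by (simp add: algebra_simps)
      also have "lcoeff \<tau> w n * (1 - epi (2 * w + 2 * of_int n * \<tau>)) = 1"
        unfolding lcoeff_def using lcoeff_denominator_nonzero[OF assms(2), of n] by simp
      finally show "lcoeff \<tau> w n * s (k - n) +
          epi (2 * w + 2 * of_int (k - 1) * \<tau>) * (lcoeff \<tau> w n * s (k - 1 - n)) = s (k - n)"
        by simp
    qed
    also have "\<dots> = infsum s UNIV"
      by (rule infsum_reindex_bij_witness[where i = "\<lambda>n. k - n" and j = "\<lambda>n. k - n"]) auto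
    also have "\<dots> = 0"
      using jtheta_jsigma[of \<tau>] unfolding s_def jtheta_def by simp
    finally show ?thesis
      by (simp add: add_eq_0_iff)
  qed
  have s_rec: "s k = - epi (2 * of_int (k - 1) * \<tau>) * s (k - 1)" for k
  proof -
    have eq: "\<tau> * of_int k ^ 2 + 2 * of_int k * jsigma \<tau>
        = 2 * of_int (k - 1) * \<tau> + (\<tau> * of_int (k - 1) ^ 2 + 2 * of_int (k - 1) * jsigma \<tau>) + 1"
      by (simp add: jsigma_def power2_eq_square field_simps)
    show ?thesis unfolding s_def eq by (simp add: epi_add)
  qed
  have b0: "b 0 = lambert_const \<tau> w"
    by (simp add: b_def lambert_const_def s_def)
  have step: "b k = epi (2 * w) * (s k / s (k - 1)) * b (k - 1)" for k
    by (subst rec, subst s_rec) (simp add: s_def epi_add)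
  have s_nz: "s k \<noteq> 0" for k by (simp add: s_def)
  have epi_step: "epi (2 * w) * epi (2 * of_int (k - 1) * w) = epi (2 * of_int k * w)" for k
    unfolding epi_add[symmetric] by (simp add: algebra_simps)
  have "b k = lambert_const \<tau> w * epi (2 * of_int k * w) * s k" for k
  proof (induction k rule: int_induct[where k = 0])
    case base show ?case by (simp add: b0 s_def)
  next
    case (step1 i)
    show ?case
      using step[of "i + 1"] step1 epi_step[of "i + 1"] s_nz[of i] by (simp add: field_simps)
  next
    case (step2 i)
    have "epi (2 * w) * (s i / s (i - 1)) * b (i - 1)
        = lambert_const \<tau> w * (epi (2 * w) * epi (2 * of_int (i - 1) * w)) * s i"
      using step[of i] step2 by (simp only: epi_step)
    thus ?case
      using s_nz[of i] s_nz[of "i - 1"] by (simp add: field_simps)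
  qed
  moreover have "((\<lambda>n. lcoeff \<tau> w n * s (k - n)) has_sum b k) UNIV"
    unfolding b_def by (rule has_sum_infsum[OF summ])
  ultimately show ?thesis
    by (simp only:)
qed

text \<open>The coefficients of the product of the Lambert series with the theta series satisfy a
  first-order recurrence, so that the product is again a theta series.\<close>

theorem lambert_reg_theta:
  assumes "Im \<tau> > 0" "w \<notin> period_lattice \<tau>" "\<bar>Im z\<bar> < Im \<tau>"
  shows "lambert_reg \<tau> w z * jtheta \<tau> (z + jsigma \<tau>)
       = (1 - epi (2 * z)) * lambert_const \<tau> w * jtheta \<tau> (z + w + jsigma \<tau>)"
proof -
  define s where "s n = epi (\<tau> * of_int n ^ 2 + 2 * of_int n * jsigma \<tau>)" for n :: int
  define B where "B = lambert_const \<tau> w"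
  have conv: "((\<lambda>n. lcoeff \<tau> w n * s (k - n)) has_sum (B * epi (2 * of_int k * w) * s k)) UNIV" for k
    unfolding s_def B_def by (rule lambert_convolution[OF assms(1,2)])
  have conv': "((\<lambda>n. lcoeff \<tau> w (n - 1) * s (k - n)) has_sum (B * epi (2 * of_int (k - 1) * w) * s (k - 1))) UNIV" for k
    by (rule has_sum_reindex_bij_witness[where i = "\<lambda>n. n + 1" and j = "\<lambda>n. n - 1",
          THEN iffD2, OF _ _ _ _ _ refl conv[of "k - 1"]]) (auto simp: algebra_simps)
  have thterm: "epi (\<tau> * of_int n ^ 2 + 2 * of_int n * (u + jsigma \<tau>)) = epi (2 * of_int n * u) * s n" for n :: int and u
    unfolding s_def jtheta_jsigma_term by simp
  have "((\<lambda>k. \<Sum>\<^sub>\<infinity>n. ((lcoeff \<tau> w n - lcoeff \<tau> w (n - 1)) * epi (2 * of_int n * z)) *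
            epi (\<tau> * of_int (k - n) ^ 2 + 2 * of_int (k - n) * (z + jsigma \<tau>)))
          has_sum (lambert_reg \<tau> w z * jtheta \<tau> (z + jsigma \<tau>))) UNIV"
    unfolding lambert_reg_def jtheta_def
    by (rule has_sum_int_convolution[OF abs_summable_lambert_reg[OF assms] abs_summable_jtheta[OF assms(1)]])
  also have "(\<lambda>k. \<Sum>\<^sub>\<infinity>n. ((lcoeff \<tau> w n - lcoeff \<tau> w (n - 1)) * epi (2 * of_int n * z)) *
            epi (\<tau> * of_int (k - n) ^ 2 + 2 * of_int (k - n) * (z + jsigma \<tau>)))
      = (\<lambda>k. B * (epi (2 * of_int k * (z + w)) * s k)
           - B * epi (2 * z) * (epi (2 * of_int (k - 1) * (z + w)) * s (k - 1)))"
  proof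
    fix k :: int
    have "(\<Sum>\<^sub>\<infinity>n. ((lcoeff \<tau> w n - lcoeff \<tau> w (n - 1)) * epi (2 * of_int n * z)) *
            epi (\<tau> * of_int (k - n) ^ 2 + 2 * of_int (k - n) * (z + jsigma \<tau>)))
        = (\<Sum>\<^sub>\<infinity>n. epi (2 * of_int k * z) * (lcoeff \<tau> w n * s (k - n) - lcoeff \<tau> w (n - 1) * s (k - n)))"
    proof (rule infsum_cong)
      fix n :: int
      have split: "epi (2 * of_int n * z) * epi (2 * of_int (k - n) * z) = epi (2 * of_int k * z)"
        unfolding epi_add[symmetric] by (simp add: algebra_simps)
      show "((lcoeff \<tau> w n - lcoeff \<tau> w (n - 1)) * epi (2 * of_int n * z)) *
            epi (\<tau> * of_int (k - n) ^ 2 + 2 * of_int (k - n) * (z + jsigma \<tau>))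
          = epi (2 * of_int k * z) * (lcoeff \<tau> w n * s (k - n) - lcoeff \<tau> w (n - 1) * s (k - n))"
        unfolding thterm split[symmetric] left_diff_distrib right_diff_distrib by simp
    qed
    also have "\<dots> = epi (2 * of_int k * z) *
        (B * epi (2 * of_int k * w) * s k - B * epi (2 * of_int (k - 1) * w) * s (k - 1))"
      unfolding infsum_cmult_right'
      using infsumI[OF has_sum_add[OF conv[of k] has_sum_uminusI[OF conv'[of k]]]] by simp
    also have "\<dots> = B * (epi (2 * of_int k * (z + w)) * s k)
           - B * epi (2 * z) * (epi (2 * of_int (k - 1) * (z + w)) * s (k - 1))"
    proof -
      have 1: "epi (2 * of_int k * (z + w)) = epi (2 * of_int k * z) * epi (2 * of_int k * w)"
        unfolding epi_add[symmetric] by (simp add: algebra_simps)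
      have 2: "epi (2 * z) * epi (2 * of_int (k - 1) * (z + w)) = epi (2 * of_int k * z) * epi (2 * of_int (k - 1) * w)"
        unfolding epi_add[symmetric] by (simp add: algebra_simps)
      show ?thesis
        unfolding 1 using 2 by (simp add: right_diff_distrib mult_ac)
    qed
    finally show "(\<Sum>\<^sub>\<infinity>n. ((lcoeff \<tau> w n - lcoeff \<tau> w (n - 1)) * epi (2 * of_int n * z)) *
            epi (\<tau> * of_int (k - n) ^ 2 + 2 * of_int (k - n) * (z + jsigma \<tau>))) = \<dots>" .
  qed
  finally have lhs: "((\<lambda>k. B * (epi (2 * of_int k * (z + w)) * s k)
           - B * epi (2 * z) * (epi (2 * of_int (k - 1) * (z + w)) * s (k - 1)))
        has_sum (lambert_reg \<tau> w z * jtheta \<tau> (z + jsigma \<tau>))) UNIV" .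
  have th: "((\<lambda>k. epi (2 * of_int k * (z + w)) * s k) has_sum jtheta \<tau> (z + w + jsigma \<tau>)) UNIV"
    using has_sum_jtheta[OF assms(1), of "z + w + jsigma \<tau>"] unfolding thterm .
  have th': "((\<lambda>k. epi (2 * of_int (k - 1) * (z + w)) * s (k - 1)) has_sum jtheta \<tau> (z + w + jsigma \<tau>)) UNIV"
    by (rule has_sum_reindex_bij_witness[where i = "\<lambda>n. n + 1" and j = "\<lambda>n. n - 1",
          THEN iffD2, OF _ _ _ _ _ refl th]) auto
  have "((\<lambda>k. B * (epi (2 * of_int k * (z + w)) * s k)
           + - (B * epi (2 * z) * (epi (2 * of_int (k - 1) * (z + w)) * s (k - 1))))
        has_sum (B * jtheta \<tau> (z + w + jsigma \<tau>) + - (B * epi (2 * z) * jtheta \<tau> (z + w + jsigma \<tau>)))) UNIV"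
    by (intro has_sum_add has_sum_uminusI has_sum_cmult_right th th')
  with lhs have "lambert_reg \<tau> w z * jtheta \<tau> (z + jsigma \<tau>) =
      B * jtheta \<tau> (z + w + jsigma \<tau>) + - (B * epi (2 * z) * jtheta \<tau> (z + w + jsigma \<tau>))"
    by (simp add: has_sum_unique)
  thus ?thesis
    by (simp add: B_def algebra_simps)
qed

subsection \<open>Zeros of the theta series\<close>

lemma has_sum_int_even_part:
  fixes f :: "int \<Rightarrow> complex"
  assumes "((\<lambda>n. f n + epi (of_int n) * f n) has_sum S) UNIV"
  shows "((\<lambda>n. f (2 * n)) has_sum S / 2) UNIV"
proof -
  have "((\<lambda>n. 2 * f n) has_sum S) {n. even n}"
    by (rule has_sum_cong_neutral[THEN iffD1, OF _ _ _ assms]) (auto simp: epi_of_int)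
  hence "((\<lambda>n. 2 * f (2 * n)) has_sum S) UNIV"
    by (subst has_sum_reindex_bij_witness[where i = "\<lambda>n. n div 2" and j = "\<lambda>n. 2 * n"
          and T = "{n. even n}" and h = "\<lambda>n. 2 * f n" and s' = S]) auto
  from has_sum_cmult_right[OF this, of "1 / 2"] show ?thesis
    by simp
qed

lemma jtheta_add_half_sum:
  assumes "Im \<tau> > 0"
  shows "jtheta \<tau> z + jtheta \<tau> (z + 1/2) = 2 * jtheta (4 * \<tau>) (2 * z)"
proof -
  define t where "t n = epi (\<tau> * of_int n ^ 2 + 2 * of_int n * z)" for n :: int
  have "epi (\<tau> * of_int n ^ 2 + 2 * of_int n * (z + 1/2)) = epi (of_int n) * t n" for n :: int
    unfolding t_def epi_add[symmetric] by (simp add: algebra_simps)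
  with has_sum_add[OF has_sum_jtheta[OF assms, of z] has_sum_jtheta[OF assms, of "z + 1/2"]]
  have "((\<lambda>n. t n + epi (of_int n) * t n) has_sum (jtheta \<tau> z + jtheta \<tau> (z + 1/2))) UNIV"
    by (simp add: t_def)
  from has_sum_int_even_part[OF this]
  have even: "((\<lambda>n. t (2 * n)) has_sum (jtheta \<tau> z + jtheta \<tau> (z + 1/2)) / 2) UNIV" .
  have t_eq: "t (2 * n) = epi (4 * \<tau> * of_int n ^ 2 + 2 * of_int n * (2 * z))" for n
    unfolding t_def by (simp add: power2_eq_square algebra_simps)
  have "Im (4 * \<tau>) > 0" using assms by simp
  from has_sum_unique[OF has_sum_jtheta[OF this, of "2 * z"] even[unfolded t_eq]]
  have "jtheta (4 * \<tau>) (2 * z) = (jtheta \<tau> z + jtheta \<tau> (z + 1/2)) / 2" .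
  thus ?thesis
    by (metis nonzero_mult_div_cancel_left times_divide_eq_right zero_neq_numeral)
qed

lemma norm_jtheta_minus_1:
  assumes "Im \<tau> > 0" "Im z = 0"
  defines "\<rho> \<equiv> exp (- (pi * Im \<tau>))"
  shows "norm (jtheta \<tau> z - 1) \<le> 2 * \<rho> / (1 - \<rho>)"
proof -
  have \<rho>: "0 < \<rho>" "\<rho> < 1" using assms(1) by (auto simp: \<rho>_def)
  define t where "t n = epi (\<tau> * of_int n ^ 2 + 2 * of_int n * z)" for n :: int
  have "(\<lambda>n. t (int (Suc n)) + t (- int (Suc n))) sums (jtheta \<tau> z - t 0)"
    unfolding t_def by (rule has_sum_int_imp_sums_pair[OF has_sum_jtheta[OF assms(1)]])
  hence eq: "jtheta \<tau> z - 1 = (\<Sum>n. t (int (Suc n)) + t (- int (Suc n)))"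
    by (simp add: sums_iff t_def)
  have norm_t: "norm (t n) \<le> \<rho> ^ nat \<bar>n\<bar>" for n
  proof -
    have "real_of_int \<bar>n\<bar> \<le> real_of_int (n ^ 2)"
      by (subst of_int_le_iff, cases "n = 0") (use self_le_power[of "\<bar>n\<bar>" 2] in auto)
    hence "pi * Im \<tau> * \<bar>real_of_int n\<bar> \<le> pi * Im \<tau> * real_of_int n ^ 2"
      using assms(1) by (intro mult_left_mono) auto
    thus ?thesis unfolding \<rho>_def exp_minus_power_nat_abs t_def norm_epi
      using assms(2) by (simp add: mult_ac power2_eq_square)
  qed
  have "norm (t (int (Suc n)) + t (- int (Suc n))) \<le> 2 * \<rho> * \<rho> ^ n" for n
  proof -
    have "nat \<bar>int (Suc n)\<bar> = Suc n" "nat \<bar>- int (Suc n)\<bar> = Suc n" by auto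
    with norm_t[of "int (Suc n)"] norm_t[of "- int (Suc n)"]
    have "norm (t (int (Suc n))) + norm (t (- int (Suc n))) \<le> \<rho> ^ Suc n + \<rho> ^ Suc n"
      by (metis add_mono)
    thus ?thesis
      using norm_triangle_ineq[of "t (int (Suc n))" "t (- int (Suc n))"] by simp
  qed
  moreover have sm: "(\<lambda>n. 2 * \<rho> * \<rho> ^ n) sums (2 * \<rho> * (1 / (1 - \<rho>)))"
    using \<rho> by (intro sums_mult geometric_sums) auto
  ultimately have "norm (\<Sum>n. t (int (Suc n)) + t (- int (Suc n))) \<le> (\<Sum>n. 2 * \<rho> * \<rho> ^ n)"
    by (intro norm_suminf_le) (auto simp: sums_iff)
  thus ?thesis
    unfolding eq using sm by (simp add: sums_iff)
qed

lemma exp_power_scale_tendsto_0: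
  assumes "a > 0" "c > (1::real)"
  shows "(\<lambda>k. exp (- (pi * (c ^ k * a)))) \<longlonglongrightarrow> 0"
proof -
  have "filterlim (\<lambda>k. c ^ k) at_top sequentially"
    using assms(2) by (intro filterlim_at_infinity_imp_filterlim_at_top filterlim_realpow_sequentially_gt1) auto
  hence "filterlim (\<lambda>k. (pi * a) * c ^ k) at_top sequentially"
    using assms(1) by (intro filterlim_tendsto_pos_mult_at_top[OF tendsto_const]) auto
  hence "filterlim (\<lambda>k. - ((pi * a) * c ^ k)) at_bot sequentially"
    by (simp add: filterlim_uminus_at_top)
  from filterlim_compose[OF exp_at_bot this] show ?thesis
    by (simp add: mult_ac)
qed

lemma jtheta_scale_tendsto_1:
  assumes "Im \<tau> > 0" "Im z = 0" "c > (1::real)"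
  shows "(\<lambda>k. jtheta (of_real (c ^ k) * \<tau>) z) \<longlonglongrightarrow> 1"
proof -
  define \<rho> where "\<rho> k = exp (- (pi * (c ^ k * Im \<tau>)))" for k
  have "\<rho> \<longlonglongrightarrow> 0"
    unfolding \<rho>_def by (rule exp_power_scale_tendsto_0[OF assms(1,3)])
  hence "(\<lambda>k. 2 * \<rho> k / (1 - \<rho> k)) \<longlonglongrightarrow> 2 * 0 / (1 - 0)"
    by (intro tendsto_intros) auto
  hence lim: "(\<lambda>k. 2 * \<rho> k / (1 - \<rho> k)) \<longlonglongrightarrow> 0"
    by simp
  have "norm (jtheta (of_real (c ^ k) * \<tau>) z - 1) \<le> 2 * \<rho> k / (1 - \<rho> k)" for k
    using norm_jtheta_minus_1[of "of_real (c ^ k) * \<tau>" z] assms by (simp add: \<rho>_def)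
  hence "(\<lambda>k. jtheta (of_real (c ^ k) * \<tau>) z - 1) \<longlonglongrightarrow> 0"
    by (intro Lim_null_comparison[OF always_eventually lim]) auto
  thus ?thesis
    by (simp add: Lim_null[symmetric])
qed

lemma jtheta_not_identically_0:
  assumes "Im \<tau> > 0"
  shows "\<exists>z. jtheta \<tau> z \<noteq> 0"
proof (rule ccontr)
  assume "\<nexists>z. jtheta \<tau> z \<noteq> 0"
  hence base: "\<forall>z. jtheta \<tau> z = 0" by blast
  have "\<forall>z. jtheta (of_real (4 ^ k) * \<tau>) z = 0" for k
  proof (induction k)
    case 0 thus ?case using base by simp
  next
    case (Suc k)
    have "Im (of_real (4 ^ k) * \<tau>) > 0" using assms by simp
    from jtheta_add_half_sum[OF this, of "z / 2" for z] Suc show ?case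
      by (simp add: mult_ac)
  qed
  hence "(\<lambda>k. 0 :: complex) \<longlonglongrightarrow> 1"
    using jtheta_scale_tendsto_1[OF assms, of 0 4] by simp
  thus False
    by (simp add: LIMSEQ_const_iff)
qed

lemma jtheta_not_eventually_0:
  assumes "Im \<tau> > 0"
  shows "\<not> eventually (\<lambda>z. jtheta \<tau> z = 0) (nhds a)"
proof
  assume "eventually (\<lambda>z. jtheta \<tau> z = 0) (nhds a)"
  then obtain S where S: "open S" "a \<in> S" "\<And>z. z \<in> S \<Longrightarrow> jtheta \<tau> z = 0"
    unfolding eventually_nhds by blast
  have "jtheta \<tau> z = 0" for z
    by (rule analytic_continuation_open[of S UNIV "jtheta \<tau>" "\<lambda>_. 0"])
       (use S holomorphic_jtheta[OF assms] in auto)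
  thus False
    using jtheta_not_identically_0[OF assms] by blast
qed

lemma isCont_lambert_reg:
  assumes "Im \<tau> > 0" "w \<notin> period_lattice \<tau>"
  shows "isCont (lambert_reg \<tau> w) 0"
proof -
  have "open {z. \<bar>Im z\<bar> < Im \<tau> / 2}"
    by (intro open_Collect_less continuous_intros)
  thus ?thesis
    using holomorphic_on_imp_continuous_on[OF holomorphic_lambert_reg[OF assms]] assms(1)
    by (simp add: continuous_on_eq_continuous_at)
qed

lemma eventually_nhds_0_lambert:
  assumes "Im \<tau> > 0" "w \<notin> period_lattice \<tau>"
  shows "eventually (\<lambda>z. lambert_reg \<tau> w z \<noteq> 0 \<and> \<bar>Im z\<bar> < Im \<tau>) (nhds 0)"
proof (rule eventually_conj)
  have "(lambert_reg \<tau> w \<longlongrightarrow> 1) (nhds 0)"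
    using isCont_lambert_reg[OF assms] lambert_reg_0[OF assms]
    by (metis isCont_def tendsto_at_iff_tendsto_nhds)
  thus "eventually (\<lambda>z. lambert_reg \<tau> w z \<noteq> 0) (nhds 0)"
    by (rule tendsto_imp_eventually_ne) auto
  have "open {z. \<bar>Im z\<bar> < Im \<tau>}"
    by (intro open_Collect_less continuous_intros)
  thus "eventually (\<lambda>z. \<bar>Im z\<bar> < Im \<tau>) (nhds 0)"
    using assms(1) by (auto simp: eventually_nhds)
qed

lemma lambert_const_nonzero:
  assumes "Im \<tau> > 0" "w \<notin> period_lattice \<tau>"
  shows "lambert_const \<tau> w \<noteq> 0"
proof
  assume 0: "lambert_const \<tau> w = 0"
  have "eventually (\<lambda>z. jtheta \<tau> (z + jsigma \<tau>) = 0) (nhds 0)"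
    using eventually_nhds_0_lambert[OF assms]
    by eventually_elim (use lambert_reg_theta[OF assms] 0 in auto)
  hence "eventually (\<lambda>z. jtheta \<tau> z = 0) (filtermap (\<lambda>z. z + jsigma \<tau>) (nhds 0))"
    by (simp add: eventually_filtermap)
  hence "eventually (\<lambda>z. jtheta \<tau> z = 0) (nhds (jsigma \<tau>))"
    by (simp add: filtermap_nhds_shift[of "- jsigma \<tau>", simplified])
  thus False
    using jtheta_not_eventually_0[OF assms(1)] by blast
qed

lemma period_lattice_add:
  assumes "u \<in> period_lattice \<tau>" "v \<in> period_lattice \<tau>"
  shows "u + v \<in> period_lattice \<tau>"
proof -
  obtain a b c d where "u = of_int a + of_int b * \<tau>" "v = of_int c + of_int d * \<tau>"
    using assms by (auto simp: period_lattice_def)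
  hence "u + v = of_int (a + c) + of_int (b + d) * \<tau>"
    by (simp add: algebra_simps)
  thus ?thesis unfolding period_lattice_def by blast
qed

lemma of_int_tau_in_period_lattice: "of_int n * \<tau> \<in> period_lattice \<tau>"
  unfolding period_lattice_def by (rule CollectI, rule exI[of _ 0], rule exI[of _ n]) simp

lemma jtheta_add_period_eq_0_iff:
  assumes "v \<in> period_lattice \<tau>"
  shows "jtheta \<tau> (z + v) = 0 \<longleftrightarrow> jtheta \<tau> z = 0"
proof -
  obtain m n where v: "v = of_int m + of_int n * \<tau>"
    using assms by (auto simp: period_lattice_def)
  obtain c where "c \<noteq> 0" "jtheta \<tau> (z + of_int m + of_int n * \<tau>) = c * jtheta \<tau> (z + of_int m)"
    using jtheta_add_of_int_tau by blast
  thus ?thesis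
    by (simp add: v add.assoc[symmetric] jtheta_add_of_int)
qed

lemma exists_period_shift:
  assumes "Im \<tau> > 0"
  shows "\<exists>n::int. 0 \<le> Im (w - of_int n * \<tau>) \<and> Im (w - of_int n * \<tau>) < Im \<tau>"
proof (intro exI conjI)
  let ?n = "\<lfloor>Im w / Im \<tau>\<rfloor>"
  have "of_int ?n * Im \<tau> \<le> Im w" "Im w < (of_int ?n + 1) * Im \<tau>"
    using assms by (simp_all add: pos_le_divide_eq[symmetric] pos_divide_less_eq[symmetric])
  thus "0 \<le> Im (w - of_int ?n * \<tau>)" "Im (w - of_int ?n * \<tau>) < Im \<tau>"
    by (simp_all add: algebra_simps)
qed

theorem jtheta_eq_0_iff:
  assumes "Im \<tau> > 0"
  shows "jtheta \<tau> (w + jsigma \<tau>) = 0 \<longleftrightarrow> w \<in> period_lattice \<tau>"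
proof
  assume "w \<in> period_lattice \<tau>"
  thus "jtheta \<tau> (w + jsigma \<tau>) = 0"
    using jtheta_add_period_eq_0_iff[of w \<tau> "jsigma \<tau>"] jtheta_jsigma[of \<tau>] by (simp add: add.commute)
next
  assume zero: "jtheta \<tau> (w + jsigma \<tau>) = 0"
  show "w \<in> period_lattice \<tau>"
  proof (rule ccontr)
    assume w: "w \<notin> period_lattice \<tau>"
    obtain n :: int where n: "0 \<le> Im (w - of_int n * \<tau>)" "Im (w - of_int n * \<tau>) < Im \<tau>"
      using exists_period_shift[OF assms] by blast
    define w' where "w' = w - of_int n * \<tau>"
    have w': "w' \<notin> period_lattice \<tau>" "\<bar>Im w'\<bar> < Im \<tau>"
      using w n period_lattice_add[OF _ of_int_tau_in_period_lattice, of w' \<tau> n]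
      by (auto simp: w'_def)
    have zero': "jtheta \<tau> (w' + jsigma \<tau>) = 0"
      using zero jtheta_add_period_eq_0_iff[OF of_int_tau_in_period_lattice, of \<tau> "w' + jsigma \<tau>" n]
      by (simp add: w'_def)
    have nz: "1 - epi (2 * w') \<noteq> 0"
      using lcoeff_denominator_nonzero[OF w'(1), of 0] by simp
    have "jtheta \<tau> u = 0" for u
    proof (cases "u - w' - jsigma \<tau> \<in> period_lattice \<tau>")
      case True
      thus ?thesis
        using zero' jtheta_add_period_eq_0_iff[OF True, of "w' + jsigma \<tau>"] by simp
    next
      case False
      show ?thesis
        using lambert_reg_theta[OF assms False w'(2)] zero' nz lambert_const_nonzero[OF assms False]
        by simp
    qed
    thus False
      using jtheta_not_identically_0[OF assms] by blast
  qed
qed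

lemma not_in_period_lattice_strip:
  assumes "0 < Im w" "Im w < Im \<tau>"
  shows "w \<notin> period_lattice \<tau>"
proof
  assume "w \<in> period_lattice \<tau>"
  then obtain m n where "w = of_int m + of_int n * \<tau>" by (auto simp: period_lattice_def)
  hence Im_w: "Im w = of_int n * Im \<tau>" by simp
  have "Im \<tau> > 0" using assms by linarith
  with assms Im_w have "0 < n" "n < 1"
    by (auto simp: zero_less_mult_iff)
  thus False by simp
qed

lemma jtheta_nonzero_strip:
  assumes "Im \<tau> > 0" "\<bar>Im z\<bar> < Im \<tau> / 2"
  shows "jtheta \<tau> z \<noteq> 0"
proof -
  have "z - jsigma \<tau> \<notin> period_lattice \<tau>"
    using assms by (intro not_in_period_lattice_strip) (auto simp: jsigma_def)
  thus ?thesis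
    using jtheta_eq_0_iff[OF assms(1), of "z - jsigma \<tau>"] by simp
qed

lemma eventually_notin_period_lattice:
  assumes "Im \<tau> > 0"
  shows "eventually (\<lambda>z. z \<notin> period_lattice \<tau>) (at a)"
proof -
  have "\<exists>\<beta>. jtheta \<tau> (\<beta> + jsigma \<tau>) \<noteq> 0"
    using jtheta_not_identically_0[OF assms] by (metis diff_add_cancel)
  then obtain \<beta> where \<beta>: "jtheta \<tau> (\<beta> + jsigma \<tau>) \<noteq> 0" by blast
  have hol: "(\<lambda>z. jtheta \<tau> (z + jsigma \<tau>)) holomorphic_on UNIV"
    by (intro holomorphic_intros assms)
  have "eventually (\<lambda>z. jtheta \<tau> (z + jsigma \<tau>) \<noteq> 0) (at a)"
    using non_zero_neighbour_alt[OF hol _ connected_UNIV _ _ \<beta>, of a] by simp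
  thus ?thesis
    by eventually_elim (simp add: jtheta_eq_0_iff[OF assms])
qed

lemma jtheta_pole_limit:
  assumes "Im \<tau> > 0" "w \<notin> period_lattice \<tau>"
  shows "((\<lambda>z. jtheta \<tau> (z + jsigma \<tau>) / (1 - epi (2 * z))) \<longlongrightarrow>
            lambert_const \<tau> w * jtheta \<tau> (w + jsigma \<tau>)) (at 0)"
proof -
  have "eventually (\<lambda>z. lambert_reg \<tau> w z \<noteq> 0 \<and> \<bar>Im z\<bar> < Im \<tau>) (at 0)"
    using eventually_nhds_0_lambert[OF assms] by (simp add: eventually_at_filter eventually_mono)
  moreover have "eventually (\<lambda>z. z \<notin> period_lattice \<tau>) (at 0)"
    by (rule eventually_notin_period_lattice[OF assms(1)])
  ultimately have ev: "eventually (\<lambda>z. lambert_const \<tau> w * jtheta \<tau> (z + w + jsigma \<tau>) / lambert_reg \<tau> w z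
      = jtheta \<tau> (z + jsigma \<tau>) / (1 - epi (2 * z))) (at 0)"
  proof eventually_elim
    case (elim z)
    have "1 - epi (2 * z) \<noteq> 0"
      using lcoeff_denominator_nonzero[OF elim(2), of 0] by simp
    thus ?case
      using lambert_reg_theta[OF assms, of z] elim by (simp add: field_simps)
  qed
  have "isCont (\<lambda>z. jtheta \<tau> (z + w + jsigma \<tau>)) 0"
    by (rule isCont_o2[OF _ isCont_jtheta[OF assms(1)]]) (intro continuous_intros)
  hence "((\<lambda>z. jtheta \<tau> (z + w + jsigma \<tau>)) \<longlongrightarrow> jtheta \<tau> (0 + w + jsigma \<tau>)) (at 0)"
    by (rule isContD)
  moreover have "(lambert_reg \<tau> w \<longlongrightarrow> 1) (at 0)"
    using isContD[OF isCont_lambert_reg[OF assms]] lambert_reg_0[OF assms] by simp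
  ultimately have "((\<lambda>z. lambert_const \<tau> w * jtheta \<tau> (z + w + jsigma \<tau>) / lambert_reg \<tau> w z) \<longlongrightarrow>
      lambert_const \<tau> w * jtheta \<tau> (0 + w + jsigma \<tau>) / 1) (at 0)"
    by (intro tendsto_intros) auto
  from Lim_transform_eventually[OF this ev] show ?thesis
    by simp
qed

lemma lambert_const_mult_jtheta_eq:
  assumes "Im \<tau> > 0" "w \<notin> period_lattice \<tau>" "w' \<notin> period_lattice \<tau>"
  shows "lambert_const \<tau> w * jtheta \<tau> (w + jsigma \<tau>) = lambert_const \<tau> w' * jtheta \<tau> (w' + jsigma \<tau>)"
  by (rule tendsto_unique[OF _ jtheta_pole_limit jtheta_pole_limit]) (use assms in auto)

lemma jtheta_inverse_limit:
  assumes "Im \<tau> > 0" "w \<notin> period_lattice \<tau>"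
  shows "((\<lambda>z. z / jtheta \<tau> (z + jsigma \<tau>)) \<longlongrightarrow>
            \<i> / (2 * of_real pi * lambert_const \<tau> w * jtheta \<tau> (w + jsigma \<tau>))) (at 0)"
proof -
  define P where "P = lambert_const \<tau> w * jtheta \<tau> (w + jsigma \<tau>)"
  have P: "P \<noteq> 0"
    using lambert_const_nonzero[OF assms] jtheta_eq_0_iff[OF assms(1), of w] assms(2) by (simp add: P_def)
  have "((\<lambda>z. 1 - epi (2 * z)) has_field_derivative - (2 * \<i> * of_real pi)) (at 0)"
    unfolding epi_def by (auto intro!: derivative_eq_intros)
  hence 1: "((\<lambda>z. (1 - epi (2 * z)) / z) \<longlongrightarrow> - (2 * \<i> * of_real pi)) (at 0)"
    by (simp add: has_field_derivative_iff)
  have "((\<lambda>z. inverse (((1 - epi (2 * z)) / z) * (jtheta \<tau> (z + jsigma \<tau>) / (1 - epi (2 * z))))) \<longlongrightarrow>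
      inverse (- (2 * \<i> * of_real pi) * P)) (at 0)"
    using P unfolding P_def by (intro tendsto_intros 1 jtheta_pole_limit assms) auto
  moreover have "inverse (- (2 * \<i> * of_real pi) * P) = \<i> / (2 * of_real pi * P)"
    using P by (simp add: field_simps)
  ultimately have lim: "((\<lambda>z. inverse (((1 - epi (2 * z)) / z) * (jtheta \<tau> (z + jsigma \<tau>) / (1 - epi (2 * z))))) \<longlongrightarrow>
      \<i> / (2 * of_real pi * P)) (at 0)"
    by (simp only:)
  have ev: "eventually (\<lambda>z. inverse (((1 - epi (2 * z)) / z) * (jtheta \<tau> (z + jsigma \<tau>) / (1 - epi (2 * z))))
      = z / jtheta \<tau> (z + jsigma \<tau>)) (at 0)"
    using eventually_notin_period_lattice[OF assms(1), of 0] eventually_neq_at_within[of 0 0 UNIV]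
  proof eventually_elim
    case (elim z)
    have "1 - epi (2 * z) \<noteq> 0"
      using lcoeff_denominator_nonzero[OF elim(1), of 0] by simp
    moreover have "jtheta \<tau> (z + jsigma \<tau>) \<noteq> 0"
      using elim(1) jtheta_eq_0_iff[OF assms(1), of z] by simp
    ultimately show ?case using elim(2) by simp
  qed
  from Lim_transform_eventually[OF lim ev] show ?thesis
    by (simp add: P_def mult.assoc)
qed

subsection \<open>Lambert series as theta quotients\<close>

theorem lambert_has_sum:
  assumes "Im \<tau> > 0" "w \<notin> period_lattice \<tau>" "\<bar>Im z\<bar> < Im \<tau> / 2"
  shows "((\<lambda>n. lcoeff \<tau> w n * epi (2 * of_int n * (z - jsigma \<tau>))) has_sum
           (lambert_const \<tau> w * jtheta \<tau> (z + w) / jtheta \<tau> z)) UNIV"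
proof -
  define u where "u = z - jsigma \<tau>"
  have u: "0 < Im u" "Im u < Im \<tau>"
    using assms by (auto simp: u_def jsigma_def)
  define r where "r = max (exp (- (2 * pi * Im u))) (exp (2 * pi * Im u - 2 * pi * Im \<tau>))"
  have r: "0 \<le> r" "r < 1"
    using u by (auto simp: r_def less_max_iff_disj le_max_iff_disj)
  obtain C where C: "C \<ge> 0" "\<And>m. norm (lcoeff \<tau> w (- int m)) \<le> C * exp (- (2 * pi * Im \<tau>)) ^ m"
      "\<And>n. norm (lcoeff \<tau> w n) \<le> C"
    using lcoeff_bounds[OF assms(1,2)] by metis
  define t where "t n = lcoeff \<tau> w n * epi (2 * of_int n * u)" for n
  have "norm (t n) \<le> C * r ^ nat \<bar>n\<bar>" for n
  proof (cases "n \<ge> 0")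
    case True
    have "norm (epi (2 * of_int n * u)) = exp (- (2 * pi * Im u)) ^ nat \<bar>n\<bar>"
      unfolding exp_minus_power_nat_abs norm_epi using True by simp
    also have "\<dots> \<le> r ^ nat \<bar>n\<bar>"
      by (intro power_mono) (auto simp: r_def)
    finally show ?thesis
      unfolding t_def norm_mult using C by (intro mult_mono) auto
  next
    case False
    define m where "m = nat \<bar>n\<bar>"
    have n: "n = - int m" using False by (simp add: m_def)
    have "norm (epi (2 * of_int n * u)) = exp (2 * pi * Im u) ^ m"
      using exp_minus_power_nat_abs[of "- (2 * pi * Im u)" n] False
      by (simp add: norm_epi m_def)
    hence "norm (t n) \<le> C * exp (- (2 * pi * Im \<tau>)) ^ m * exp (2 * pi * Im u) ^ m"
      unfolding t_def norm_mult using C(2)[of m] by (simp add: n mult_right_mono)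
    also have "\<dots> = C * exp (2 * pi * Im u - 2 * pi * Im \<tau>) ^ m"
      unfolding mult.assoc power_mult_distrib[symmetric] exp_add[symmetric] by simp
    also have "\<dots> \<le> C * r ^ m"
      using C(1) by (intro mult_left_mono power_mono) (auto simp: r_def)
    finally show ?thesis unfolding m_def .
  qed
  hence "(\<lambda>n. norm (t n)) summable_on UNIV"
    by (rule abs_summable_on_int_geometric[OF r])
  hence hs: "(t has_sum infsum t UNIV) UNIV"
    by (rule has_sum_infsum[OF abs_summable_summable])
  have "((\<lambda>n. epi (2 * u) * t (n - 1)) has_sum epi (2 * u) * infsum t UNIV) UNIV"
    by (rule has_sum_cmult_right, rule has_sum_reindex_bij_witness[where i = "\<lambda>n. n + 1" and j = "\<lambda>n. n - 1",
          THEN iffD2, OF _ _ _ _ _ refl hs]) auto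
  from has_sum_add[OF hs has_sum_uminusI[OF this]]
  have "((\<lambda>n. t n - epi (2 * u) * t (n - 1)) has_sum (1 - epi (2 * u)) * infsum t UNIV) UNIV"
    by (simp add: algebra_simps)
  moreover have "t n - epi (2 * u) * t (n - 1) = (lcoeff \<tau> w n - lcoeff \<tau> w (n - 1)) * epi (2 * of_int n * u)" for n
  proof -
    have split: "epi (2 * of_int n * u) = epi (2 * u) * epi (2 * of_int (n - 1) * u)"
      unfolding epi_add[symmetric] by (simp add: algebra_simps)
    show ?thesis
      unfolding t_def split by (simp only: left_diff_distrib) (simp only: mult_ac)
  qed
  ultimately have reg: "lambert_reg \<tau> w u = (1 - epi (2 * u)) * infsum t UNIV"
    unfolding lambert_reg_def by (intro infsumI) simp
  have "u \<notin> period_lattice \<tau>"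
    using u by (rule not_in_period_lattice_strip)
  hence nz: "1 - epi (2 * u) \<noteq> 0"
    using lcoeff_denominator_nonzero[of u \<tau> 0] by simp
  have "(1 - epi (2 * u)) * (infsum t UNIV * jtheta \<tau> z)
      = (1 - epi (2 * u)) * (lambert_const \<tau> w * jtheta \<tau> (z + w))"
    using lambert_reg_theta[OF assms(1,2), of u] u reg by (simp add: u_def mult.assoc add_ac)
  hence "infsum t UNIV * jtheta \<tau> z = lambert_const \<tau> w * jtheta \<tau> (z + w)"
    using nz by simp
  hence "infsum t UNIV = lambert_const \<tau> w * jtheta \<tau> (z + w) / jtheta \<tau> z"
    using jtheta_nonzero_strip[OF assms(1,3)] by (simp add: field_simps)
  with hs show ?thesis
    unfolding t_def u_def by simp
qed

subsection \<open>Normalisation\<close>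

lemma half_notin_period_lattice:
  assumes "Im \<tau> > 0"
  shows "1/2 \<notin> period_lattice \<tau>"
proof
  assume "1/2 \<in> period_lattice \<tau>"
  then obtain m n where eq: "(1/2 :: complex) = of_int m + of_int n * \<tau>"
    by (auto simp: period_lattice_def)
  from arg_cong[OF eq, of Im] have "n = 0" using assms by simp
  with arg_cong[OF eq, of Re] have "real_of_int (2 * m) = real_of_int 1" by simp
  hence "2 * m = 1" by (simp only: of_int_eq_iff)
  thus False by presburger
qed

lemma tau_half_notin_period_lattice:
  assumes "Im \<tau> > 0"
  shows "\<tau>/2 \<notin> period_lattice \<tau>" "1/2 + \<tau>/2 \<notin> period_lattice \<tau>"
  by (rule not_in_period_lattice_strip; use assms in simp)+

lemma jtheta_half_add_jsigma: "jtheta \<tau> (1/2 + jsigma \<tau>) = jtheta \<tau> (\<tau>/2)"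
proof -
  have "1/2 + jsigma \<tau> = - (\<tau>/2) + 1" by (simp add: jsigma_def field_simps)
  thus ?thesis by (simp only: jtheta_add_1 jtheta_minus)
qed

lemma jtheta_constants_nonzero:
  assumes "Im \<tau> > 0"
  shows "jtheta \<tau> 0 \<noteq> 0" "jtheta \<tau> (1/2) \<noteq> 0" "jtheta \<tau> (\<tau>/2) \<noteq> 0"
proof -
  show "jtheta \<tau> 0 \<noteq> 0" "jtheta \<tau> (1/2) \<noteq> 0"
    by (rule jtheta_nonzero_strip; use assms in simp)+
  show "jtheta \<tau> (\<tau>/2) \<noteq> 0"
    using jtheta_eq_0_iff[OF assms, of "1/2"] half_notin_period_lattice[OF assms]
    by (simp only: jtheta_half_add_jsigma) simp
qed

lemma jtheta_square_landen:
  assumes "Im \<tau> > 0"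
  shows "jtheta \<tau> 0 ^ 2 + jtheta \<tau> (1/2) ^ 2 = 2 * jtheta (2 * \<tau>) 0 ^ 2"
proof -
  define f where "f n = epi (\<tau> * of_int n ^ 2)" for n :: int
  define c where "c k = (\<Sum>\<^sub>\<infinity>n. f n * f (k - n))" for k
  have "Im (2 * \<tau>) > 0" using assms by simp
  note th2 = has_sum_jtheta[OF this, of 0]
  have f_abs: "(\<lambda>n. norm (f n)) summable_on UNIV"
    using abs_summable_jtheta[OF assms, of 0] by (simp add: f_def)
  have half: "epi (\<tau> * of_int n ^ 2 + 2 * of_int n * (1/2)) = epi (of_int n) * f n" for n :: int
    by (simp add: f_def epi_add)
  have f_half_abs: "(\<lambda>n. norm (epi (of_int n) * f n)) summable_on UNIV"
    using abs_summable_jtheta[OF assms, of "1/2"] unfolding half .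
  have inf_f: "infsum f UNIV = jtheta \<tau> 0"
    by (simp add: jtheta_def f_def[abs_def])
  have inf_f_half: "(\<Sum>\<^sub>\<infinity>n. epi (of_int n) * f n) = jtheta \<tau> (1/2)"
    unfolding jtheta_def half ..
  have 1: "(c has_sum jtheta \<tau> 0 ^ 2) UNIV"
    using has_sum_int_convolution[OF f_abs f_abs] unfolding c_def inf_f power2_eq_square .
  have "((\<lambda>k. \<Sum>\<^sub>\<infinity>n. epi (of_int n) * f n * (epi (of_int (k - n)) * f (k - n)))
      has_sum jtheta \<tau> (1/2) ^ 2) UNIV"
    using has_sum_int_convolution[OF f_half_abs f_half_abs] unfolding inf_f_half power2_eq_square .
  also have "(\<lambda>k. \<Sum>\<^sub>\<infinity>n. epi (of_int n) * f n * (epi (of_int (k - n)) * f (k - n)))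
      = (\<lambda>k. epi (of_int k) * c k)"
  proof
    fix k :: int
    have "epi (of_int n) * f n * (epi (of_int (k - n)) * f (k - n)) = epi (of_int k) * (f n * f (k - n))" for n
    proof -
      have "epi (of_int n) * epi (of_int (k - n)) = epi (of_int k)"
        unfolding epi_add[symmetric] by simp
      thus ?thesis by (metis mult.assoc mult.left_commute)
    qed
    thus "(\<Sum>\<^sub>\<infinity>n. epi (of_int n) * f n * (epi (of_int (k - n)) * f (k - n))) = epi (of_int k) * c k"
      unfolding c_def by (simp only: infsum_cmult_right')
  qed
  finally have 2: "((\<lambda>k. epi (of_int k) * c k) has_sum jtheta \<tau> (1/2) ^ 2) UNIV" .
  have "((\<lambda>k. c (2 * k)) has_sum (jtheta \<tau> 0 ^ 2 + jtheta \<tau> (1/2) ^ 2) / 2) UNIV"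
    by (rule has_sum_int_even_part[OF has_sum_add[OF 1 2]])
  moreover have "c (2 * k) = jtheta (2 * \<tau>) 0 * epi (2 * \<tau> * of_int k ^ 2 + 2 * of_int k * 0)" for k
  proof -
    have "c (2 * k) = (\<Sum>\<^sub>\<infinity>m. epi (2 * \<tau> * of_int k ^ 2 + 2 * of_int k * 0) *
        epi (2 * \<tau> * of_int m ^ 2 + 2 * of_int m * 0))"
      unfolding c_def
      by (rule infsum_reindex_bij_witness[where i = "\<lambda>m. k + m" and j = "\<lambda>n. n - k"])
         (auto simp: f_def epi_add[symmetric] power2_eq_square algebra_simps)
    thus ?thesis
      by (simp add: infsum_cmult_right' jtheta_def)
  qed
  ultimately have "((\<lambda>k. jtheta (2 * \<tau>) 0 * epi (2 * \<tau> * of_int k ^ 2 + 2 * of_int k * 0)) has_sum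
      (jtheta \<tau> 0 ^ 2 + jtheta \<tau> (1/2) ^ 2) / 2) UNIV"
    by simp
  from has_sum_unique[OF this has_sum_cmult_right[OF th2, of "jtheta (2 * \<tau>) 0"]]
  show ?thesis
    by (simp add: power2_eq_square field_simps)
qed

lemma lambert_half_terms:
  shows "lcoeff \<tau> (1/2) n * epi (2 * of_int n * (z - jsigma \<tau>))
      = epi (of_int n) * (epi (of_int n * \<tau>) / (1 + epi (2 * of_int n * \<tau>))) * epi (2 * of_int n * z)"
proof -
  have "2 * of_int n * (z - jsigma \<tau>) = (of_int n + of_int n * \<tau> + 2 * of_int n * z) - 2 * of_int n"
    by (simp add: jsigma_def field_simps)
  hence "epi (2 * of_int n * (z - jsigma \<tau>)) = epi (of_int n) * epi (of_int n * \<tau>) * epi (2 * of_int n * z)"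
    by (simp only: epi_diff epi_even epi_add) simp
  thus ?thesis
    by (simp add: lcoeff_def epi_add)
qed

lemma lambert_half_sums:
  assumes "Im \<tau> > 0"
  shows "((\<lambda>n. epi (of_int n) * (epi (of_int n * \<tau>) / (1 + epi (2 * of_int n * \<tau>)))) has_sum
            lambert_const \<tau> (1/2) * jtheta \<tau> (1/2) / jtheta \<tau> 0) UNIV"
    and "((\<lambda>n. epi (of_int n * \<tau>) / (1 + epi (2 * of_int n * \<tau>))) has_sum
            lambert_const \<tau> (1/2) * jtheta \<tau> 0 / jtheta \<tau> (1/2)) UNIV"
proof -
  show "((\<lambda>n. epi (of_int n) * (epi (of_int n * \<tau>) / (1 + epi (2 * of_int n * \<tau>)))) has_sum
            lambert_const \<tau> (1/2) * jtheta \<tau> (1/2) / jtheta \<tau> 0) UNIV"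
    using lambert_has_sum[OF assms half_notin_period_lattice[OF assms], of 0] assms
    unfolding lambert_half_terms by simp
  have sq: "epi (of_int n) * x * epi (2 * of_int n * (1/2)) = x" for n :: int and x
    by (simp add: epi_of_int)
  have "jtheta \<tau> (1/2 + 1/2) = jtheta \<tau> 0"
    using jtheta_add_1[of \<tau> 0] by simp
  with lambert_has_sum[OF assms half_notin_period_lattice[OF assms], of "1/2"] assms
  show "((\<lambda>n. epi (of_int n * \<tau>) / (1 + epi (2 * of_int n * \<tau>))) has_sum
            lambert_const \<tau> (1/2) * jtheta \<tau> 0 / jtheta \<tau> (1/2)) UNIV"
    unfolding lambert_half_terms sq by simp
qed

definition lambert_ratio :: "complex \<Rightarrow> complex" where
  "lambert_ratio \<tau> = lambert_const \<tau> (1/2) / (jtheta \<tau> 0 * jtheta \<tau> (1/2))"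

lemma lambert_ratio_double:
  assumes "Im \<tau> > 0"
  shows "lambert_ratio (2 * \<tau>) = lambert_ratio \<tau>"
proof -
  note nz = jtheta_constants_nonzero[OF assms]
  have im2: "Im (2 * \<tau>) > 0" using assms by simp
  note nz2 = jtheta_constants_nonzero[OF im2]
  define g where "g n = epi (of_int n * \<tau>) / (1 + epi (2 * of_int n * \<tau>))" for n :: int
  define S where "S = lambert_const \<tau> (1/2) * jtheta \<tau> 0 / jtheta \<tau> (1/2)
    + lambert_const \<tau> (1/2) * jtheta \<tau> (1/2) / jtheta \<tau> 0"
  have "((\<lambda>n. g n + epi (of_int n) * g n) has_sum S) UNIV"
    unfolding g_def S_def by (intro has_sum_add lambert_half_sums assms)
  hence "((\<lambda>n. g (2 * n)) has_sum S / 2) UNIV"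
    by (rule has_sum_int_even_part)
  moreover have "g (2 * n) = epi (of_int n * (2 * \<tau>)) / (1 + epi (2 * of_int n * (2 * \<tau>)))" for n
    by (simp add: g_def mult_ac)
  ultimately have "((\<lambda>n. epi (of_int n * (2 * \<tau>)) / (1 + epi (2 * of_int n * (2 * \<tau>)))) has_sum S / 2) UNIV"
    by simp
  from has_sum_unique[OF this lambert_half_sums(2)[OF im2]]
  have "S / 2 = lambert_ratio (2 * \<tau>) * jtheta (2 * \<tau>) 0 ^ 2"
    using nz2 by (simp add: lambert_ratio_def power2_eq_square)
  moreover have "S = lambert_ratio \<tau> * (jtheta \<tau> 0 ^ 2 + jtheta \<tau> (1/2) ^ 2)"
    using nz by (simp add: S_def lambert_ratio_def field_simps power2_eq_square)
  ultimately have "lambert_ratio (2 * \<tau>) * jtheta (2 * \<tau>) 0 ^ 2 = lambert_ratio \<tau> * jtheta (2 * \<tau>) 0 ^ 2"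
    unfolding jtheta_square_landen[OF assms] by auto
  thus ?thesis
    using nz2 by simp
qed

lemma norm_lambert_half_bound:
  assumes "Im \<tau> > 0"
  defines "\<rho> \<equiv> exp (- (pi * Im \<tau>))"
  shows "norm (lambert_ratio \<tau> * jtheta \<tau> 0 ^ 2 - 1/2) \<le> 2 * \<rho> / (1 - \<rho>) ^ 2"
proof -
  have \<rho>: "0 < \<rho>" "\<rho> < 1" using assms(1) by (auto simp: \<rho>_def)
  note nz = jtheta_constants_nonzero[OF assms(1)]
  define g where "g n = epi (of_int n * \<tau>) / (1 + epi (2 * of_int n * \<tau>))" for n :: int
  have "(g has_sum lambert_const \<tau> (1/2) * jtheta \<tau> 0 / jtheta \<tau> (1/2)) UNIV"
    unfolding g_def by (rule lambert_half_sums(2)[OF assms(1)])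
  also have "lambert_const \<tau> (1/2) * jtheta \<tau> 0 / jtheta \<tau> (1/2) = lambert_ratio \<tau> * jtheta \<tau> 0 ^ 2"
    using nz by (simp add: lambert_ratio_def power2_eq_square)
  finally have sums: "(\<lambda>n. g (int (Suc n)) + g (- int (Suc n))) sums (lambert_ratio \<tau> * jtheta \<tau> 0 ^ 2 - g 0)"
    by (rule has_sum_int_imp_sums_pair)
  have g_minus: "g (- n) = g n" for n
  proof -
    define X where "X = epi (of_int n * \<tau>)"
    have X: "X \<noteq> 0" by (simp add: X_def)
    have X2: "epi (2 * of_int n * \<tau>) = X * X"
      unfolding X_def epi_add[symmetric] by (simp add: algebra_simps)
    have eqs: "of_int (- n) * \<tau> = - (of_int n * \<tau>)" "2 * of_int (- n) * \<tau> = - (2 * of_int n * \<tau>)"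
      by simp_all
    have "g (- n) = inverse X / (1 + inverse (X * X))"
      unfolding g_def eqs epi_minus X2 X_def[symmetric] ..
    also have "\<dots> = X / (1 + X * X)"
      using X by (simp add: divide_simps add.commute)
    finally show ?thesis by (simp add: g_def X2 X_def)
  qed
  have "g 0 = 1/2" by (simp add: g_def)
  with sums have sums: "(\<lambda>n. 2 * g (int (Suc n))) sums (lambert_ratio \<tau> * jtheta \<tau> 0 ^ 2 - 1/2)"
    by (simp only: g_minus mult_2)
  have norm_epi_nat: "norm (epi (of_int (int n) * \<tau>)) = \<rho> ^ n" for n
    unfolding norm_epi \<rho>_def using exp_minus_power_nat_abs[of "pi * Im \<tau>" "int n"] by (simp add: mult_ac)
  have "norm (2 * g (int (Suc n))) \<le> 2 * \<rho> / (1 - \<rho>) * \<rho> ^ n" for n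
  proof -
    have "norm (epi (2 * of_int (int (Suc n)) * \<tau>)) = \<rho> ^ (2 * Suc n)"
      using norm_epi_nat[of "2 * Suc n"] by (simp add: mult_ac)
    also have "\<dots> \<le> \<rho> ^ 1"
      using \<rho> by (intro power_decreasing) auto
    finally have "norm (epi (2 * of_int (int (Suc n)) * \<tau>)) \<le> \<rho>" by simp
    with norm_diff_ineq[of 1 "epi (2 * of_int (int (Suc n)) * \<tau>)"]
    have d: "1 - \<rho> \<le> norm (1 + epi (2 * of_int (int (Suc n)) * \<tau>))"
      by simp
    have "norm (2 * g (int (Suc n))) = 2 * \<rho> ^ Suc n / norm (1 + epi (2 * of_int (int (Suc n)) * \<tau>))"
      unfolding g_def norm_mult norm_divide norm_epi_nat by simp
    also have "\<dots> \<le> 2 * \<rho> ^ Suc n / (1 - \<rho>)"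
      using d \<rho> by (intro divide_left_mono mult_pos_pos) auto
    finally show ?thesis by simp
  qed
  moreover have sm: "(\<lambda>n. 2 * \<rho> / (1 - \<rho>) * \<rho> ^ n) sums (2 * \<rho> / (1 - \<rho>) * (1 / (1 - \<rho>)))"
    using \<rho> by (intro sums_mult geometric_sums) auto
  ultimately have "norm (\<Sum>n. 2 * g (int (Suc n))) \<le> (\<Sum>n. 2 * \<rho> / (1 - \<rho>) * \<rho> ^ n)"
    by (intro norm_suminf_le) (auto simp: sums_iff)
  thus ?thesis
    using sums sm by (simp add: sums_iff power2_eq_square)
qed

text \<open>The ratio is invariant under \<open>\<tau> \<mapsto> 2\<tau>\<close> by Landen's transformation, and tends to \<open>1/2\<close> as
  the nome tends to \<open>0\<close>.\<close>

lemma lambert_ratio_eq: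
  assumes "Im \<tau> > 0"
  shows "lambert_ratio \<tau> = 1/2"
proof -
  define \<rho> where "\<rho> k = exp (- (pi * (2 ^ k * Im \<tau>)))" for k
  define T where "T k = of_real (2 ^ k) * \<tau>" for k
  have T: "Im (T k) > 0" for k using assms by (simp add: T_def)
  have const: "lambert_ratio (T k) = lambert_ratio \<tau>" for k
  proof (induction k)
    case (Suc k)
    have "T (Suc k) = 2 * T k" by (simp add: T_def)
    thus ?case using lambert_ratio_double[OF T] Suc by simp
  qed (simp add: T_def)
  have "\<rho> \<longlonglongrightarrow> 0"
    unfolding \<rho>_def using assms by (intro exp_power_scale_tendsto_0) auto
  hence "(\<lambda>k. 2 * \<rho> k / (1 - \<rho> k) ^ 2) \<longlonglongrightarrow> 2 * 0 / (1 - 0) ^ 2"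
    by (intro tendsto_intros) auto
  hence lim: "(\<lambda>k. 2 * \<rho> k / (1 - \<rho> k) ^ 2) \<longlonglongrightarrow> 0"
    by simp
  have "norm (lambert_ratio \<tau> * jtheta (T k) 0 ^ 2 - 1/2) \<le> 2 * \<rho> k / (1 - \<rho> k) ^ 2" for k
    using norm_lambert_half_bound[OF T[of k]] unfolding const by (simp add: T_def \<rho>_def)
  hence "(\<lambda>k. lambert_ratio \<tau> * jtheta (T k) 0 ^ 2 - 1/2) \<longlonglongrightarrow> 0"
    by (intro Lim_null_comparison[OF always_eventually lim]) auto
  moreover have "(\<lambda>k. lambert_ratio \<tau> * jtheta (T k) 0 ^ 2 - 1/2) \<longlonglongrightarrow> lambert_ratio \<tau> * 1 ^ 2 - 1/2"
    unfolding T_def using assms by (intro tendsto_intros jtheta_scale_tendsto_1) auto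
  ultimately have "lambert_ratio \<tau> * 1 ^ 2 - 1/2 = 0"
    using LIMSEQ_unique by blast
  thus ?thesis by simp
qed

lemma lambert_const_values:
  assumes "Im \<tau> > 0"
  shows "lambert_const \<tau> (1/2) = jtheta \<tau> 0 * jtheta \<tau> (1/2) / 2"
    and "lambert_const \<tau> (\<tau>/2) = jtheta \<tau> 0 * jtheta \<tau> (\<tau>/2) / 2"
    and "lambert_const \<tau> (1/2 + \<tau>/2) = jtheta \<tau> (1/2) * jtheta \<tau> (\<tau>/2) / 2"
proof -
  note nz = jtheta_constants_nonzero[OF assms]
  note notin = half_notin_period_lattice[OF assms] tau_half_notin_period_lattice[OF assms]
  show 1: "lambert_const \<tau> (1/2) = jtheta \<tau> 0 * jtheta \<tau> (1/2) / 2"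
    using lambert_ratio_eq[OF assms] nz by (simp add: lambert_ratio_def field_simps)
  have "\<tau>/2 + jsigma \<tau> = 1/2" by (simp add: jsigma_def field_simps)
  with lambert_const_mult_jtheta_eq[OF assms notin(1,2)]
  show "lambert_const \<tau> (\<tau>/2) = jtheta \<tau> 0 * jtheta \<tau> (\<tau>/2) / 2"
    using nz by (simp only: 1 jtheta_half_add_jsigma) (simp add: field_simps)
  have "1/2 + \<tau>/2 + jsigma \<tau> = 0 + 1" by (simp add: jsigma_def field_simps)
  with lambert_const_mult_jtheta_eq[OF assms notin(1,3)]
  show "lambert_const \<tau> (1/2 + \<tau>/2) = jtheta \<tau> (1/2) * jtheta \<tau> (\<tau>/2) / 2"
    using nz by (simp only: 1 jtheta_half_add_jsigma jtheta_add_1) (simp add: field_simps)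
qed

subsection \<open>The functions ND, CD and SD as theta quotients\<close>

definition nd_theta :: "complex \<Rightarrow> complex \<Rightarrow> complex" where
  "nd_theta \<tau> z = jtheta \<tau> 0 * jtheta \<tau> (1/2) * jtheta \<tau> (z + 1/2) / jtheta \<tau> z"

definition cd_theta :: "complex \<Rightarrow> complex \<Rightarrow> complex" where
  "cd_theta \<tau> z = epi (\<tau>/2 + z) * jtheta \<tau> 0 * jtheta \<tau> (\<tau>/2) * jtheta \<tau> (z + \<tau>/2) / (4 * jtheta \<tau> z)"

definition sd_theta :: "complex \<Rightarrow> complex \<Rightarrow> complex" where
  "sd_theta \<tau> z = - \<i> * epi (\<tau>/2 + z) * jtheta \<tau> (1/2) * jtheta \<tau> (\<tau>/2) *
     jtheta \<tau> (z + (1/2 + \<tau>/2)) / (4 * jtheta \<tau> z)"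

lemma nd_theta_sums:
  assumes "Im \<tau> > 0" "\<bar>Im z\<bar> < Im \<tau> / 2"
  shows "(\<lambda>n. (-1) ^ Suc n * cos (2 * of_nat (Suc n) * of_real pi * z)
            / cos (of_nat (Suc n) * of_real pi * \<tau>)) sums ((nd_theta \<tau> z - 1) / 2)"
proof -
  define u where "u n = epi (of_int n) * (epi (of_int n * \<tau>) / (1 + epi (2 * of_int n * \<tau>))) * epi (2 * of_int n * z)" for n :: int
  have "(u has_sum lambert_const \<tau> (1/2) * jtheta \<tau> (z + 1/2) / jtheta \<tau> z) UNIV"
    using lambert_has_sum[OF assms(1) half_notin_period_lattice[OF assms(1)] assms(2)]
    unfolding lambert_half_terms u_def .
  also have "lambert_const \<tau> (1/2) * jtheta \<tau> (z + 1/2) / jtheta \<tau> z = nd_theta \<tau> z / 2"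
    by (simp add: lambert_const_values[OF assms(1)] nd_theta_def)
  finally have "(\<lambda>n. u (int (Suc n)) + u (- int (Suc n))) sums (nd_theta \<tau> z / 2 - u 0)"
    by (rule has_sum_int_imp_sums_pair)
  moreover have "u (int m) + u (- int m) = (-1) ^ m * cos (2 * of_nat m * of_real pi * z)
            / cos (of_nat m * of_real pi * \<tau>)" for m
  proof -
    define X Y where "X = epi (of_nat m * \<tau>)" and "Y = epi (2 * of_nat m * z)"
    have nz: "X \<noteq> 0" "Y \<noteq> 0" by (simp_all add: X_def Y_def)
    have X2: "epi (2 * of_nat m * \<tau>) = X * X"
      unfolding X_def epi_add[symmetric] by (simp add: algebra_simps)
    have 1: "u (int m) = (-1) ^ m * (X / (1 + X * X)) * Y"
      by (simp add: u_def epi_of_nat X2 X_def Y_def)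
    have "epi (- of_nat m) = (-1) ^ m"
      by (simp add: epi_minus epi_of_nat flip: power_inverse)
    hence "u (- int m) = (-1) ^ m * (inverse X / (1 + inverse (X * X))) * inverse Y"
      unfolding X_def Y_def X2[symmetric, unfolded X_def] epi_minus[symmetric] by (simp add: u_def)
    also have "inverse X / (1 + inverse (X * X)) = X / (1 + X * X)"
      using nz by (simp add: divide_simps add.commute)
    finally have 2: "u (- int m) = (-1) ^ m * (X / (1 + X * X)) * inverse Y" .
    have c: "cos (2 * of_nat m * of_real pi * z) = (Y + inverse Y) / 2"
      using cos_pi_eq_epi[of "2 * of_nat m * z"] by (simp add: Y_def epi_minus mult_ac)
    have c': "cos (of_nat m * of_real pi * \<tau>) = (X + inverse X) / 2"
      using cos_pi_eq_epi[of "of_nat m * \<tau>"] by (simp add: X_def epi_minus mult_ac)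
    have X: "X + inverse X = (1 + X * X) / X"
      using nz by (simp add: field_simps)
    obtain D where D: "1 + X * X = D" by blast
    have "D \<noteq> 0"
      using lcoeff_denominator_nonzero[OF half_notin_period_lattice[OF assms(1)], of "int m"]
      by (simp add: epi_add X2 flip: D)
    thus ?thesis
      unfolding 1 2 c c' X D using nz by (simp add: field_simps)
  qed
  ultimately show ?thesis
    by (simp add: u_def diff_divide_distrib del: of_nat_Suc power_Suc)
qed

lemma lambert_odd_terms:
  assumes "w = \<tau>/2 + \<delta>"
  shows "epi (\<tau>/2 + z) * (lcoeff \<tau> w n * epi (2 * of_int n * (z - jsigma \<tau>)))
      = epi (of_int n) * (epi ((of_int n + 1/2) * \<tau>) / (1 - epi (2 * \<delta>) * epi ((2 * of_int n + 1) * \<tau>))) *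
          epi ((2 * of_int n + 1) * z)"
proof -
  have "\<tau>/2 + z + 2 * of_int n * (z - jsigma \<tau>) =
      (of_int n + (of_int n + 1/2) * \<tau> + (2 * of_int n + 1) * z) - 2 * of_int n"
    by (simp add: jsigma_def field_simps)
  hence 1: "epi (\<tau>/2 + z) * epi (2 * of_int n * (z - jsigma \<tau>)) =
      epi (of_int n) * epi ((of_int n + 1/2) * \<tau>) * epi ((2 * of_int n + 1) * z)"
    unfolding epi_add[symmetric] by (simp only: epi_diff epi_even) simp
  have "2 * w + 2 * of_int n * \<tau> = 2 * \<delta> + (2 * of_int n + 1) * \<tau>"
    by (simp add: assms algebra_simps)
  hence 2: "lcoeff \<tau> w n = 1 / (1 - epi (2 * \<delta>) * epi ((2 * of_int n + 1) * \<tau>))"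
    by (simp only: lcoeff_def epi_add)
  have "epi (\<tau>/2 + z) * (lcoeff \<tau> w n * epi (2 * of_int n * (z - jsigma \<tau>)))
      = lcoeff \<tau> w n * (epi (\<tau>/2 + z) * epi (2 * of_int n * (z - jsigma \<tau>)))"
    by (simp add: mult_ac)
  thus ?thesis
    unfolding 1 2 by (simp add: mult_ac)
qed

lemma cd_theta_sums:
  assumes "Im \<tau> > 0" "\<bar>Im z\<bar> < Im \<tau> / 2"
  shows "(\<lambda>n. (-1) ^ n * cos ((2 * of_nat n + 1) * of_real pi * z)
            / sin ((of_nat n + 1/2) * of_real pi * \<tau>)) sums (- 2 * \<i> * cd_theta \<tau> z)"
proof -
  define u where "u n = epi (of_int n) * (epi ((of_int n + 1/2) * \<tau>) / (1 - epi (2 * 0) * epi ((2 * of_int n + 1) * \<tau>))) *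
          epi ((2 * of_int n + 1) * z)" for n :: int
  have "(u has_sum (epi (\<tau>/2 + z) * (lambert_const \<tau> (\<tau>/2) * jtheta \<tau> (z + \<tau>/2) / jtheta \<tau> z))) UNIV"
    using has_sum_cmult_right[OF lambert_has_sum[OF assms(1) tau_half_notin_period_lattice(1)[OF assms(1)] assms(2)],
        of "epi (\<tau>/2 + z)"]
    unfolding lambert_odd_terms[where \<delta> = 0, simplified add_0_right, OF refl] u_def .
  also have "epi (\<tau>/2 + z) * (lambert_const \<tau> (\<tau>/2) * jtheta \<tau> (z + \<tau>/2) / jtheta \<tau> z) = 2 * cd_theta \<tau> z"
    by (simp add: lambert_const_values[OF assms(1)] cd_theta_def)
  finally have "(\<lambda>n. u (int n) + u (- 1 - int n)) sums (2 * cd_theta \<tau> z)"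
    by (rule has_sum_int_imp_sums_half)
  hence "(\<lambda>n. - \<i> * (u (int n) + u (- 1 - int n))) sums (- \<i> * (2 * cd_theta \<tau> z))"
    by (rule sums_mult)
  moreover have "- \<i> * (u (int m) + u (- 1 - int m)) = (-1) ^ m * cos ((2 * of_nat m + 1) * of_real pi * z)
            / sin ((of_nat m + 1/2) * of_real pi * \<tau>)" for m
  proof -
    define X Y where "X = epi ((of_nat m + 1/2) * \<tau>)" and "Y = epi ((2 * of_nat m + 1) * z)"
    have nz: "X \<noteq> 0" "Y \<noteq> 0" by (simp_all add: X_def Y_def)
    have X2: "epi ((2 * of_nat m + 1) * \<tau>) = X * X"
      unfolding X_def epi_add[symmetric] by (simp add: algebra_simps)
    have "(2 * of_nat m + 1) * \<tau> = 2 * (\<tau>/2 + of_nat m * \<tau>)"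
      by (simp add: algebra_simps)
    hence X1: "X * X \<noteq> 1"
      using lcoeff_denominator_nonzero[OF tau_half_notin_period_lattice(1)[OF assms(1)], of "int m"]
      unfolding X2[symmetric] by (simp add: algebra_simps)
    have 1: "u (int m) = (-1) ^ m * (X / (1 - X * X)) * Y"
      by (simp add: u_def epi_of_nat X2 X_def Y_def)
    have eqs: "of_int (- 1 - int m) = - (of_nat m + 1 :: complex)"
        "- (of_nat m + 1) + 1/2 = - (of_nat m + 1/2 :: complex)"
        "2 * - (of_nat m + 1) + 1 = - (2 * of_nat m + 1 :: complex)"
      by simp_all
    have "epi (- (of_nat m + 1)) = - ((-1) ^ m)"
      unfolding epi_minus epi_add epi_of_nat epi_1 by (simp flip: power_inverse)
    hence "u (- 1 - int m) = - ((-1) ^ m) * (inverse X / (1 - inverse (X * X))) * inverse Y"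
      unfolding u_def eqs mult_minus_left epi_minus X2 X_def[symmetric] Y_def[symmetric]
      by simp
    also have "inverse X / (1 - inverse (X * X)) = - (X / (1 - X * X))"
      using nz X1 by (simp add: divide_simps) (simp add: algebra_simps)
    finally have 2: "u (- 1 - int m) = (-1) ^ m * (X / (1 - X * X)) * inverse Y" by simp
    have c: "cos ((2 * of_nat m + 1) * of_real pi * z) = (Y + inverse Y) / 2"
      using cos_pi_eq_epi[of "(2 * of_nat m + 1) * z"] by (simp only: Y_def epi_minus mult_ac)
    have s: "sin ((of_nat m + 1/2) * of_real pi * \<tau>) = (X - inverse X) / (2 * \<i>)"
      using sin_pi_eq_epi[of "(of_nat m + 1/2) * \<tau>"] by (simp only: X_def epi_minus mult_ac)
    have X: "X - inverse X = - ((1 - X * X) / X)"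
      using nz by (simp add: field_simps)
    obtain D where D: "1 - X * X = D" by blast
    have "D \<noteq> 0" using X1 by (auto simp flip: D)
    thus ?thesis
      unfolding 1 2 c s X D using nz by (simp add: field_simps)
  qed
  moreover have "- \<i> * (2 * cd_theta \<tau> z) = - 2 * \<i> * cd_theta \<tau> z"
    by simp
  ultimately show ?thesis
    by (simp only:)
qed

lemma sd_theta_sums:
  assumes "Im \<tau> > 0" "\<bar>Im z\<bar> < Im \<tau> / 2"
  shows "(\<lambda>n. (-1) ^ n * sin ((2 * of_nat n + 1) * of_real pi * z)
            / cos ((of_nat n + 1/2) * of_real pi * \<tau>)) sums (2 * sd_theta \<tau> z)"
proof -
  define u where "u n = epi (of_int n) * (epi ((of_int n + 1/2) * \<tau>) / (1 - epi (2 * (1/2)) * epi ((2 * of_int n + 1) * \<tau>))) *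
          epi ((2 * of_int n + 1) * z)" for n :: int
  have w: "1/2 + \<tau>/2 = \<tau>/2 + 1/2" by simp
  have "(u has_sum (epi (\<tau>/2 + z) * (lambert_const \<tau> (1/2 + \<tau>/2) * jtheta \<tau> (z + (1/2 + \<tau>/2)) / jtheta \<tau> z))) UNIV"
    using has_sum_cmult_right[OF lambert_has_sum[OF assms(1) tau_half_notin_period_lattice(2)[OF assms(1)] assms(2)],
        of "epi (\<tau>/2 + z)"]
    unfolding lambert_odd_terms[OF w] u_def .
  also have "epi (\<tau>/2 + z) * (lambert_const \<tau> (1/2 + \<tau>/2) * jtheta \<tau> (z + (1/2 + \<tau>/2)) / jtheta \<tau> z) = 2 * \<i> * sd_theta \<tau> z"
    by (simp add: lambert_const_values[OF assms(1)] sd_theta_def)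
  finally have "(\<lambda>n. u (int n) + u (- 1 - int n)) sums (2 * \<i> * sd_theta \<tau> z)"
    by (rule has_sum_int_imp_sums_half)
  hence "(\<lambda>n. - \<i> * (u (int n) + u (- 1 - int n))) sums (- \<i> * (2 * \<i> * sd_theta \<tau> z))"
    by (rule sums_mult)
  moreover have "- \<i> * (u (int m) + u (- 1 - int m)) = (-1) ^ m * sin ((2 * of_nat m + 1) * of_real pi * z)
            / cos ((of_nat m + 1/2) * of_real pi * \<tau>)" for m
  proof -
    define X Y where "X = epi ((of_nat m + 1/2) * \<tau>)" and "Y = epi ((2 * of_nat m + 1) * z)"
    have nz: "X \<noteq> 0" "Y \<noteq> 0" by (simp_all add: X_def Y_def)
    have X2: "epi ((2 * of_nat m + 1) * \<tau>) = X * X"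
      unfolding X_def epi_add[symmetric] by (simp add: algebra_simps)
    have 1: "u (int m) = (-1) ^ m * (X / (1 + X * X)) * Y"
      by (simp add: u_def epi_of_nat X2 X_def Y_def)
    have eqs: "of_int (- 1 - int m) = - (of_nat m + 1 :: complex)"
        "- (of_nat m + 1) + 1/2 = - (of_nat m + 1/2 :: complex)"
        "2 * - (of_nat m + 1) + 1 = - (2 * of_nat m + 1 :: complex)"
      by simp_all
    have "epi (- (of_nat m + 1)) = - ((-1) ^ m)"
      unfolding epi_minus epi_add epi_of_nat epi_1 by (simp flip: power_inverse)
    hence "u (- 1 - int m) = - ((-1) ^ m) * (inverse X / (1 + inverse (X * X))) * inverse Y"
      unfolding u_def eqs mult_minus_left epi_minus X2 X_def[symmetric] Y_def[symmetric]
      by simp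
    also have "inverse X / (1 + inverse (X * X)) = X / (1 + X * X)"
      using nz by (simp add: divide_simps add.commute)
    finally have 2: "u (- 1 - int m) = - ((-1) ^ m) * (X / (1 + X * X)) * inverse Y" .
    have s: "sin ((2 * of_nat m + 1) * of_real pi * z) = (Y - inverse Y) / (2 * \<i>)"
      using sin_pi_eq_epi[of "(2 * of_nat m + 1) * z"] by (simp only: Y_def epi_minus mult_ac)
    have c: "cos ((of_nat m + 1/2) * of_real pi * \<tau>) = (X + inverse X) / 2"
      using cos_pi_eq_epi[of "(of_nat m + 1/2) * \<tau>"] by (simp only: X_def epi_minus mult_ac)
    have X: "X + inverse X = (1 + X * X) / X"
      using nz by (simp add: field_simps)
    have "2 * (1/2 + \<tau>/2) + 2 * of_int (int m) * \<tau> = 1 + (2 * of_nat m + 1) * \<tau>"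
      by (simp add: algebra_simps)
    hence nz': "1 + X * X \<noteq> 0"
      using lcoeff_denominator_nonzero[OF tau_half_notin_period_lattice(2)[OF assms(1)], of "int m"]
      by (simp only: epi_add X2 epi_1) simp
    obtain D where D: "1 + X * X = D" by blast
    have "D \<noteq> 0" using nz' by (simp flip: D)
    thus ?thesis
      unfolding 1 2 c s X D using nz by (simp add: field_simps)
  qed
  moreover have "- \<i> * (2 * \<i> * sd_theta \<tau> z) = 2 * sd_theta \<tau> z"
    by simp
  ultimately show ?thesis
    by (simp only:)
qed

subsection \<open>Elliptic functions with a single simple pole\<close>

lemma period_parallelogram_decomposition:
  assumes "Im \<tau> > 0"
  obtains v a b where "v \<in> period_lattice \<tau>" "0 \<le> a" "a \<le> 1" "0 \<le> b" "b \<le> (1::real)"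
    "z = of_real a + of_real b * \<tau> + v"
proof -
  define b where "b = Im z / Im \<tau>"
  define a where "a = Re z - b * Re \<tau>"
  have "z = of_real a + of_real b * \<tau>"
    using assms by (simp add: complex_eq_iff a_def b_def)
  hence "z = of_real (frac a) + of_real (frac b) * \<tau> + (of_int \<lfloor>a\<rfloor> + of_int \<lfloor>b\<rfloor> * \<tau>)"
    by (simp add: frac_def algebra_simps)
  moreover have "of_int \<lfloor>a\<rfloor> + of_int \<lfloor>b\<rfloor> * \<tau> \<in> period_lattice \<tau>"
    unfolding period_lattice_def by blast
  ultimately show ?thesis
    using that[of _ "frac a" "frac b"] frac_lt_1[of a] frac_lt_1[of b] by (simp add: less_imp_le)
qed

lemma quasi_periodic_of_int:
  fixes f :: "complex \<Rightarrow> complex"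
  assumes "\<And>z. f (z + \<omega>) = c * f z" "norm c = 1"
  shows "norm (f (z + of_int n * \<omega>)) = norm (f z)"
proof (induction n rule: int_induct[where k = 0])
  case (step1 i)
  have eq: "z + of_int (i + 1) * \<omega> = z + of_int i * \<omega> + \<omega>" by (simp add: algebra_simps)
  show ?case using step1 unfolding eq assms(1) norm_mult assms(2) by simp
next
  case (step2 i)
  have eq: "z + of_int i * \<omega> = z + of_int (i - 1) * \<omega> + \<omega>" by (simp add: algebra_simps)
  show ?case using step2 unfolding eq assms(1) norm_mult assms(2) by simp
qed simp

lemma quasi_periodic_period_lattice:
  fixes f :: "complex \<Rightarrow> complex"
  assumes "\<And>z. f (z + 1) = s * f z" "\<And>z. f (z + \<tau>) = t * f z" "norm s = 1" "norm t = 1"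
    and "v \<in> period_lattice \<tau>"
  shows "norm (f (z + v)) = norm (f z)"
proof -
  obtain m n where "v = of_int m + of_int n * \<tau>"
    using assms(5) by (auto simp: period_lattice_def)
  thus ?thesis
    using quasi_periodic_of_int[of f 1 s z m, OF assms(1,3)]
      quasi_periodic_of_int[of f \<tau> t "z + of_int m" n, OF assms(2,4)]
    by (simp add: add.assoc)
qed

lemma period_lattice_add_iff:
  assumes "v \<in> period_lattice \<tau>"
  shows "u + v \<in> period_lattice \<tau> \<longleftrightarrow> u \<in> period_lattice \<tau>"
  using period_lattice_add[of u \<tau> v] period_lattice_add[of "u + v" \<tau> "- v"]
    uminus_in_period_lattice[OF assms] assms by auto

lemma open_notin_period_lattice:
  assumes "Im \<tau> > 0"
  shows "open {z. z - p \<notin> period_lattice \<tau>}"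
proof -
  have "{z. z - p \<notin> period_lattice \<tau>} = {z. jtheta \<tau> (z - p + jsigma \<tau>) \<noteq> 0}"
    by (simp add: jtheta_eq_0_iff[OF assms])
  also have "open \<dots>"
    by (intro open_Collect_neq continuous_on_const holomorphic_on_imp_continuous_on
        holomorphic_intros assms)
  finally show ?thesis .
qed

theorem quasi_periodic_eqI:
  fixes f g :: "complex \<Rightarrow> complex"
  assumes \<tau>: "Im \<tau> > 0"
    and hol: "f holomorphic_on {z. z - p \<notin> period_lattice \<tau>}" "g holomorphic_on {z. z - p \<notin> period_lattice \<tau>}"
    and f: "\<And>z. f (z + 1) = s * f z" "\<And>z. f (z + \<tau>) = t * f z"
    and g: "\<And>z. g (z + 1) = s * g z" "\<And>z. g (z + \<tau>) = t * g z"
    and st: "norm s = 1" "norm t = 1" "s \<noteq> 1 \<or> t \<noteq> 1"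
    and lim: "((\<lambda>h. h * f (h + p)) \<longlongrightarrow> R) (at 0)" "((\<lambda>h. h * g (h + p)) \<longlongrightarrow> R) (at 0)"
    and z: "z - p \<notin> period_lattice \<tau>"
  shows "f z = g z"
proof -
  define d where "d z = f z - g z" for z
  define H where "H = remove_sings d"
  have hol_d: "d holomorphic_on {z. z - p \<notin> period_lattice \<tau>}"
    unfolding d_def by (intro holomorphic_intros hol)
  have d1: "d (z + 1) = s * d z" and d\<tau>: "d (z + \<tau>) = t * d z" for z
    by (simp_all only: d_def f g right_diff_distrib)
  note d_shift = quasi_periodic_period_lattice[of d, OF d1 d\<tau> st(1,2)]
  have reg_ev: "eventually (\<lambda>w. w - p \<notin> period_lattice \<tau>) (at c)" for c
  proof -
    have "filterlim (\<lambda>w. w - p) (at (c - p)) (at c)"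
      by (auto simp: filterlim_at eventually_at_filter intro!: tendsto_intros)
    thus ?thesis
      using eventually_notin_period_lattice[OF \<tau>, of "c - p"] by (rule eventually_compose_filterlim[rotated])
  qed
  have ana: "d analytic_on {c}" if "c - p \<notin> period_lattice \<tau>" for c
    unfolding analytic_at using open_notin_period_lattice[OF \<tau>, of p] hol_d that by blast
  have H_ana: "H analytic_on {c}" and H_d: "c - p \<notin> period_lattice \<tau> \<Longrightarrow> H c = d c" for c
  proof -
    show "c - p \<notin> period_lattice \<tau> \<Longrightarrow> H c = d c"
      using ana by (simp add: H_def)
    show "H analytic_on {c}"
    proof (cases "c - p \<in> period_lattice \<tau>")
      case False
      thus ?thesis unfolding H_def by (intro remove_sings_analytic_on ana)
    next
      case True
      obtain r where r: "r > 0" "\<And>w. w \<in> ball c r - {c} \<Longrightarrow> w - p \<notin> period_lattice \<tau>"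
        using reg_ev[of c] unfolding eventually_at by (auto simp: dist_commute)
      have hol_r: "d holomorphic_on ball c r - {c}"
        using r(2) by (intro holomorphic_on_subset[OF hol_d]) blast
      have "((\<lambda>h. h * d (h + p)) \<longlongrightarrow> R - R) (at 0)"
        using tendsto_diff[OF lim] by (simp add: d_def algebra_simps)
      hence "((\<lambda>h. norm (h * d (h + p))) \<longlongrightarrow> 0) (at 0)"
        using tendsto_norm_zero by simp
      moreover have "norm (h * d (h + p)) = norm (h * d (c + h))" for h
        using d_shift[OF True, of "h + p"] by (simp add: norm_mult add_ac)
      ultimately have "((\<lambda>h. h * d (c + h)) \<longlongrightarrow> 0) (at 0)"
        using tendsto_norm_zero_iff[of "\<lambda>h. h * d (c + h)" "at 0"] by simp
      hence "((\<lambda>w. (w - c) * d w) \<longlongrightarrow> 0) (at c)"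
        by (subst Lim_at_zero) simp
      then obtain k where k: "k holomorphic_on ball c r" "\<And>w. w \<in> ball c r - {c} \<Longrightarrow> k w = d w"
        using holomorphic_on_extend_lim[OF hol_r] r(1) by auto
      have "isCont k c"
        using holomorphic_on_imp_continuous_on[OF k(1)] r(1) by (simp add: continuous_on_eq_continuous_at)
      hence "k \<midarrow>c\<rightarrow> k c" by (rule isContD)
      moreover have "eventually (\<lambda>w. w \<in> ball c r - {c}) (at c)"
        using r(1) by (intro eventually_at_in_open) auto
      hence "eventually (\<lambda>w. k w = d w) (at c)"
        by eventually_elim (rule k)
      ultimately have "d \<midarrow>c\<rightarrow> k c"
        by (rule Lim_transform_eventually)
      moreover have "isolated_singularity_at d c"
        unfolding isolated_singularity_at_def using r(1) hol_r
        by (intro exI[of _ r]) (simp add: analytic_on_open open_delete)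
      ultimately show ?thesis
        unfolding H_def by (rule remove_sings_analytic_at[rotated])
    qed
  qed
  hence hol_H: "H holomorphic_on UNIV"
    by (intro analytic_imp_holomorphic) (subst analytic_on_analytic_at, blast)
  define Q where "Q = (\<lambda>(a, b). of_real a + of_real b * \<tau>) ` ({0..1::real} \<times> {0..1::real})"
  have "compact Q"
    unfolding Q_def case_prod_beta
    by (intro compact_continuous_image continuous_intros compact_Times) auto
  hence "bounded (H ` Q)"
    by (intro compact_imp_bounded compact_continuous_image
        continuous_on_subset[OF holomorphic_on_imp_continuous_on[OF hol_H]]) auto
  then obtain M where M: "\<And>q. q \<in> Q \<Longrightarrow> norm (H q) \<le> M"
    by (auto simp: bounded_iff)
  have bound_reg: "norm (H w) \<le> M" if "w - p \<notin> period_lattice \<tau>" for w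
  proof -
    obtain v a b where v: "v \<in> period_lattice \<tau>" "0 \<le> a" "a \<le> 1" "0 \<le> b" "b \<le> (1::real)"
        "w = of_real a + of_real b * \<tau> + v"
      using period_parallelogram_decomposition[OF \<tau>] by metis
    define q where "q = of_real a + of_real b * \<tau>"
    have "q \<in> Q" using v by (auto simp: Q_def q_def)
    have w: "w = q + v" using v by (simp add: q_def)
    have "q - p \<notin> period_lattice \<tau>"
      using that period_lattice_add_iff[OF v(1), of "q - p"] by (simp add: w algebra_simps)
    hence "norm (H w) = norm (H q)"
      using H_d that d_shift[OF v(1), of q] by (simp add: w)
    thus ?thesis using M[OF \<open>q \<in> Q\<close>] by simp
  qed
  have "norm (H c) \<le> M" for c
  proof (rule tendsto_upperbound)
    have "isCont H c"
      using H_ana by (rule analytic_at_imp_isCont)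
    thus "((\<lambda>w. norm (H w)) \<longlongrightarrow> norm (H c)) (at c)"
      by (intro tendsto_norm isContD)
    show "eventually (\<lambda>w. norm (H w) \<le> M) (at c)"
      using reg_ev[of c] by eventually_elim (rule bound_reg)
  qed auto
  hence "bounded (range H)"
    by (auto simp: bounded_iff)
  with hol_H have "H constant_on UNIV"
    by (rule Liouville_theorem)
  then obtain K where K: "\<And>w. H w = K"
    by (auto simp: constant_on_def)
  have one: "1 \<in> period_lattice \<tau>"
    unfolding period_lattice_def by (rule CollectI, rule exI[of _ 1], rule exI[of _ 0]) simp
  have tau: "\<tau> \<in> period_lattice \<tau>"
    using of_int_tau_in_period_lattice[of 1 \<tau>] by simp
  have "z + 1 - p \<notin> period_lattice \<tau>" "z + \<tau> - p \<notin> period_lattice \<tau>"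
    using z period_lattice_add_iff[OF one, of "z - p"] period_lattice_add_iff[OF tau, of "z - p"]
    by (simp_all add: algebra_simps)
  hence "d z = K" "d (z + 1) = K" "d (z + \<tau>) = K"
    using z by (simp_all add: H_d[symmetric] K)
  hence "s * d z = d z" "t * d z = d z"
    by (simp_all add: d1 d\<tau>)
  hence "d z = 0"
    using st(3) by auto
  thus ?thesis
    by (simp add: d_def)
qed

lemma jtheta_add_tau_shifted:
  "jtheta \<tau> (z + \<tau> + a) = epi (- \<tau> - 2 * z - 2 * a) * jtheta \<tau> (z + a)"
proof -
  have "z + \<tau> + a = z + a + \<tau>" by simp
  moreover have "- \<tau> - 2 * (z + a) = - \<tau> - 2 * z - 2 * a" by simp
  ultimately show ?thesis using jtheta_add_tau[of \<tau> "z + a"] by (simp only:)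
qed

lemma jtheta_add_1_shifted: "jtheta \<tau> (z + 1 + a) = jtheta \<tau> (z + a)"
  using jtheta_add_1[of \<tau> "z + a"] by (simp add: add_ac)

lemma nd_theta_add:
  "nd_theta \<tau> (z + 1) = nd_theta \<tau> z" "nd_theta \<tau> (z + \<tau>) = - nd_theta \<tau> z"
  unfolding nd_theta_def jtheta_add_1_shifted jtheta_add_1 jtheta_add_tau jtheta_add_tau_shifted
  by (simp_all add: epi_diff)

lemma cd_theta_add:
  "cd_theta \<tau> (z + 1) = - cd_theta \<tau> z" "cd_theta \<tau> (z + \<tau>) = cd_theta \<tau> z"
proof -
  show "cd_theta \<tau> (z + 1) = - cd_theta \<tau> z"
    unfolding cd_theta_def jtheta_add_1_shifted jtheta_add_1 by (simp add: epi_add)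
  have "epi (\<tau> / 2 + (z + \<tau>)) * epi (- \<tau> - 2 * z - 2 * (\<tau>/2)) = epi (- \<tau> - 2 * z) * epi (\<tau>/2 + z)"
    unfolding epi_add[symmetric] by (simp add: algebra_simps)
  hence "cd_theta \<tau> (z + \<tau>) = (epi (- \<tau> - 2 * z) * epi (\<tau>/2 + z)) * jtheta \<tau> 0 * jtheta \<tau> (\<tau>/2) *
      jtheta \<tau> (z + \<tau>/2) / (4 * (epi (- \<tau> - 2 * z) * jtheta \<tau> z))"
    unfolding cd_theta_def jtheta_add_tau_shifted jtheta_add_tau by (simp add: mult_ac)
  thus "cd_theta \<tau> (z + \<tau>) = cd_theta \<tau> z"
    by (simp add: cd_theta_def)
qed

lemma sd_theta_add:
  "sd_theta \<tau> (z + 1) = - sd_theta \<tau> z" "sd_theta \<tau> (z + \<tau>) = - sd_theta \<tau> z"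
proof -
  show "sd_theta \<tau> (z + 1) = - sd_theta \<tau> z"
    unfolding sd_theta_def jtheta_add_1_shifted jtheta_add_1 by (simp add: epi_add)
  have "epi (\<tau> / 2 + (z + \<tau>)) * epi (- \<tau> - 2 * z - 2 * (1/2 + \<tau>/2)) =
      epi (- \<tau> - 2 * z + (\<tau>/2 + z) - 1)"
    unfolding epi_add[symmetric] by (rule arg_cong[of _ _ epi]) (simp add: field_simps)
  hence "epi (\<tau> / 2 + (z + \<tau>)) * epi (- \<tau> - 2 * z - 2 * (1/2 + \<tau>/2)) =
      - (epi (- \<tau> - 2 * z) * epi (\<tau>/2 + z))"
    by (simp only: epi_add epi_diff[of _ 1] epi_1) simp
  moreover have "sd_theta \<tau> (z + \<tau>) = - \<i> * (epi (\<tau> / 2 + (z + \<tau>)) * epi (- \<tau> - 2 * z - 2 * (1/2 + \<tau>/2))) *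
      jtheta \<tau> (1/2) * jtheta \<tau> (\<tau>/2) *
      jtheta \<tau> (z + (1/2 + \<tau>/2)) / (4 * (epi (- \<tau> - 2 * z) * jtheta \<tau> z))"
    unfolding sd_theta_def jtheta_add_tau_shifted jtheta_add_tau by (simp only: mult_ac)
  ultimately have "sd_theta \<tau> (z + \<tau>) = - \<i> * (- (epi (- \<tau> - 2 * z) * epi (\<tau>/2 + z))) * jtheta \<tau> (1/2) * jtheta \<tau> (\<tau>/2) *
      jtheta \<tau> (z + (1/2 + \<tau>/2)) / (4 * (epi (- \<tau> - 2 * z) * jtheta \<tau> z))"
    by (simp only:)
  thus "sd_theta \<tau> (z + \<tau>) = - sd_theta \<tau> z"
    by (simp add: sd_theta_def)
qed

lemma holomorphic_nd_cd_sd_theta: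
  assumes "Im \<tau> > 0"
  shows "nd_theta \<tau> holomorphic_on {z. jtheta \<tau> z \<noteq> 0}"
    and "cd_theta \<tau> holomorphic_on {z. jtheta \<tau> z \<noteq> 0}"
    and "sd_theta \<tau> holomorphic_on {z. jtheta \<tau> z \<noteq> 0}"
  unfolding nd_theta_def[abs_def] cd_theta_def[abs_def] sd_theta_def[abs_def]
  by (auto intro!: holomorphic_intros assms)

lemma theta_quotient_residue:
  assumes "Im \<tau> > 0" "w \<notin> period_lattice \<tau>"
    and f: "\<And>z. f z = c z * jtheta \<tau> (z + w) / jtheta \<tau> z" and c: "isCont c (jsigma \<tau>)"
  shows "((\<lambda>h. h * f (h + jsigma \<tau>)) \<longlongrightarrow> \<i> * c (jsigma \<tau>) / (2 * of_real pi * lambert_const \<tau> w)) (at 0)"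
proof -
  define N where "N z = c z * jtheta \<tau> (z + w)" for z
  have nz: "jtheta \<tau> (w + jsigma \<tau>) \<noteq> 0"
    using jtheta_eq_0_iff[OF assms(1), of w] assms(2) by simp
  have "isCont N (jsigma \<tau>)"
    unfolding N_def by (intro continuous_intros c isCont_o2[OF _ isCont_jtheta[OF assms(1)]])
  hence "((\<lambda>h. N (h + jsigma \<tau>)) \<longlongrightarrow> N (jsigma \<tau>)) (at 0)"
    by (simp add: isCont_iff add.commute)
  from tendsto_mult[OF this jtheta_inverse_limit[OF assms(1,2)]]
  have "((\<lambda>h. N (h + jsigma \<tau>) * (h / jtheta \<tau> (h + jsigma \<tau>))) \<longlongrightarrow>
      N (jsigma \<tau>) * (\<i> / (2 * of_real pi * lambert_const \<tau> w * jtheta \<tau> (w + jsigma \<tau>)))) (at 0)" .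
  moreover have "N (h + jsigma \<tau>) * (h / jtheta \<tau> (h + jsigma \<tau>)) = h * f (h + jsigma \<tau>)" for h
    by (simp add: f N_def)
  moreover have "N (jsigma \<tau>) * (\<i> / (2 * of_real pi * lambert_const \<tau> w * jtheta \<tau> (w + jsigma \<tau>)))
      = \<i> * c (jsigma \<tau>) / (2 * of_real pi * lambert_const \<tau> w)"
    using nz by (simp add: N_def add.commute mult.commute mult.left_commute)
  ultimately show ?thesis
    by simp
qed

lemma isCont_epi [continuous_intros]: "isCont f a \<Longrightarrow> isCont (\<lambda>z. epi (f z)) a"
  unfolding epi_def by (intro continuous_intros)

lemma nd_theta_residue:
  assumes "Im \<tau> > 0"
  shows "((\<lambda>h. h * nd_theta \<tau> (h + jsigma \<tau>)) \<longlongrightarrow> \<i> / of_real pi) (at 0)"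
proof -
  have "((\<lambda>h. h * nd_theta \<tau> (h + jsigma \<tau>)) \<longlongrightarrow>
      \<i> * (jtheta \<tau> 0 * jtheta \<tau> (1/2)) / (2 * of_real pi * lambert_const \<tau> (1/2))) (at 0)"
    by (rule theta_quotient_residue[OF assms half_notin_period_lattice[OF assms],
        where c = "\<lambda>_. jtheta \<tau> 0 * jtheta \<tau> (1/2)"]) (simp_all add: nd_theta_def)
  thus ?thesis
    using jtheta_constants_nonzero[OF assms] by (simp add: lambert_const_values[OF assms])
qed

lemma cd_theta_residue:
  assumes "Im \<tau> > 0"
  shows "((\<lambda>h. h * cd_theta \<tau> (h + jsigma \<tau>)) \<longlongrightarrow> - 1 / (4 * of_real pi)) (at 0)"
proof -
  have eq: "\<tau>/2 + jsigma \<tau> = 1/2" by (simp add: jsigma_def field_simps)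
  have "((\<lambda>h. h * cd_theta \<tau> (h + jsigma \<tau>)) \<longlongrightarrow>
      \<i> * (epi (\<tau>/2 + jsigma \<tau>) * jtheta \<tau> 0 * jtheta \<tau> (\<tau>/2) / 4) / (2 * of_real pi * lambert_const \<tau> (\<tau>/2))) (at 0)"
    by (rule theta_quotient_residue[OF assms tau_half_notin_period_lattice(1)[OF assms],
        where c = "\<lambda>z. epi (\<tau>/2 + z) * jtheta \<tau> 0 * jtheta \<tau> (\<tau>/2) / 4"])
       (auto simp: cd_theta_def intro!: continuous_intros)
  also have "\<i> * (epi (\<tau>/2 + jsigma \<tau>) * jtheta \<tau> 0 * jtheta \<tau> (\<tau>/2) / 4) / (2 * of_real pi * lambert_const \<tau> (\<tau>/2))
      = - 1 / (4 * of_real pi)"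
    using jtheta_constants_nonzero[OF assms] unfolding eq epi_half lambert_const_values[OF assms]
    by (simp add: field_simps)
  finally show ?thesis .
qed

lemma sd_theta_residue:
  assumes "Im \<tau> > 0"
  shows "((\<lambda>h. h * sd_theta \<tau> (h + jsigma \<tau>)) \<longlongrightarrow> \<i> / (4 * of_real pi)) (at 0)"
proof -
  have eq: "\<tau>/2 + jsigma \<tau> = 1/2" by (simp add: jsigma_def field_simps)
  have "((\<lambda>h. h * sd_theta \<tau> (h + jsigma \<tau>)) \<longlongrightarrow>
      \<i> * (- \<i> * epi (\<tau>/2 + jsigma \<tau>) * jtheta \<tau> (1/2) * jtheta \<tau> (\<tau>/2) / 4) /
        (2 * of_real pi * lambert_const \<tau> (1/2 + \<tau>/2))) (at 0)"
    by (rule theta_quotient_residue[OF assms tau_half_notin_period_lattice(2)[OF assms],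
        where c = "\<lambda>z. - \<i> * epi (\<tau>/2 + z) * jtheta \<tau> (1/2) * jtheta \<tau> (\<tau>/2) / 4"])
       (auto simp: sd_theta_def intro!: continuous_intros)
  also have "\<i> * (- \<i> * epi (\<tau>/2 + jsigma \<tau>) * jtheta \<tau> (1/2) * jtheta \<tau> (\<tau>/2) / 4) /
        (2 * of_real pi * lambert_const \<tau> (1/2 + \<tau>/2)) = \<i> / (4 * of_real pi)"
    using jtheta_constants_nonzero[OF assms] unfolding eq epi_half lambert_const_values[OF assms]
    by (simp add: field_simps)
  finally show ?thesis .
qed

subsection \<open>The imaginary transformation\<close>

lemma Im_minus_inverse:
  assumes "Im \<tau> > 0"
  shows "Im (- 1 / \<tau>) > 0"
proof -
  have "\<tau> \<noteq> 0" using assms by auto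
  thus ?thesis using assms by (simp add: Im_divide cmod_power2[symmetric])
qed

lemma jtheta_inversion_zero_iff:
  assumes "Im \<tau> > 0"
  shows "jtheta (- 1 / \<tau>) (z / \<tau>) = 0 \<longleftrightarrow> jtheta \<tau> z = 0"
    and "z - (jsigma \<tau> + \<tau>) \<in> period_lattice \<tau> \<longleftrightarrow> jtheta \<tau> z = 0"
proof -
  define \<tau>' where "\<tau>' = - 1 / \<tau>"
  have nz: "\<tau> \<noteq> 0" using assms by auto
  have tau: "- \<tau> \<in> period_lattice \<tau>"
    using of_int_tau_in_period_lattice[of "-1" \<tau>] by simp
  have 1: "z - (jsigma \<tau> + \<tau>) \<in> period_lattice \<tau> \<longleftrightarrow> z - jsigma \<tau> \<in> period_lattice \<tau>"
    using period_lattice_add_iff[OF tau, of "z - jsigma \<tau>"] by (simp add: algebra_simps)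
  also have "\<dots> \<longleftrightarrow> jtheta \<tau> z = 0"
    using jtheta_eq_0_iff[OF assms, of "z - jsigma \<tau>"] by simp
  finally show 2: "z - (jsigma \<tau> + \<tau>) \<in> period_lattice \<tau> \<longleftrightarrow> jtheta \<tau> z = 0" .
  have sigma: "jsigma \<tau> + \<tau> = \<tau> * jsigma \<tau>'"
    using nz by (simp add: jsigma_def \<tau>'_def field_simps)
  have "z / \<tau> - jsigma \<tau>' \<in> period_lattice \<tau>' \<longleftrightarrow> z - \<tau> * jsigma \<tau>' \<in> period_lattice \<tau>"
  proof
    assume "z / \<tau> - jsigma \<tau>' \<in> period_lattice \<tau>'"
    then obtain m n where "z / \<tau> - jsigma \<tau>' = of_int m + of_int n * \<tau>'"
      by (auto simp: period_lattice_def)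
    hence "z - \<tau> * jsigma \<tau>' = \<tau> * (of_int m + of_int n * \<tau>')"
      using nz by (simp add: field_simps)
    also have "\<dots> = of_int (- n) + of_int m * \<tau>"
      using nz by (simp add: \<tau>'_def field_simps)
    finally show "z - \<tau> * jsigma \<tau>' \<in> period_lattice \<tau>"
      unfolding period_lattice_def by blast
  next
    assume "z - \<tau> * jsigma \<tau>' \<in> period_lattice \<tau>"
    then obtain m n where "z - \<tau> * jsigma \<tau>' = of_int m + of_int n * \<tau>"
      by (auto simp: period_lattice_def)
    hence "z / \<tau> - jsigma \<tau>' = (of_int m + of_int n * \<tau>) / \<tau>"
      using nz by (simp add: field_simps)
    also have "\<dots> = of_int n + of_int (- m) * \<tau>'"
      using nz by (simp add: \<tau>'_def field_simps)
    finally show "z / \<tau> - jsigma \<tau>' \<in> period_lattice \<tau>'"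
      unfolding period_lattice_def by blast
  qed
  thus "jtheta (- 1 / \<tau>) (z / \<tau>) = 0 \<longleftrightarrow> jtheta \<tau> z = 0"
    using jtheta_eq_0_iff[OF Im_minus_inverse[OF assms], of "z / \<tau> - jsigma \<tau>'"] 2 sigma
    by (simp add: \<tau>'_def)
qed

lemma inversion_residue:
  assumes "Im \<tau> > 0" and lim: "((\<lambda>h. h * f (h + jsigma (- 1 / \<tau>))) \<longlongrightarrow> R) (at 0)"
  shows "((\<lambda>h. h * (c / \<tau> * f ((h + (jsigma \<tau> + \<tau>)) / \<tau>))) \<longlongrightarrow> c * R) (at 0)"
proof -
  have nz: "\<tau> \<noteq> 0" using assms(1) by auto
  have sigma: "(h + (jsigma \<tau> + \<tau>)) / \<tau> = h / \<tau> + jsigma (- 1 / \<tau>)" for h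
    using nz by (simp add: jsigma_def field_simps)
  have "filterlim (\<lambda>h. h / \<tau>) (at 0) (at 0)"
    using nz by (auto simp: filterlim_at eventually_at_filter intro!: tendsto_eq_intros)
  from filterlim_compose[OF lim this]
  have "((\<lambda>h. c * (h / \<tau> * f (h / \<tau> + jsigma (- 1 / \<tau>)))) \<longlongrightarrow> c * R) (at 0)"
    by (intro tendsto_mult tendsto_const)
  thus ?thesis
    unfolding sigma by (simp add: mult_ac)
qed

lemma inversion_shift:
  fixes f :: "complex \<Rightarrow> complex"
  assumes "\<tau> \<noteq> 0" "\<And>z. f (z + 1) = t * f z" "\<And>z. f (z + (- 1 / \<tau>)) = s * f z" "s * s = 1"
  shows "f ((z + 1) / \<tau>) = s * f (z / \<tau>)" "f ((z + \<tau>) / \<tau>) = t * f (z / \<tau>)"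
proof -
  have "(z + 1) / \<tau> + (- 1 / \<tau>) = z / \<tau>" by (simp add: add_divide_distrib)
  with assms(3)[of "(z + 1) / \<tau>"] have "f (z / \<tau>) = s * f ((z + 1) / \<tau>)" by simp
  hence "s * f (z / \<tau>) = (s * s) * f ((z + 1) / \<tau>)" by simp
  thus "f ((z + 1) / \<tau>) = s * f (z / \<tau>)" using assms(4) by simp
  show "f ((z + \<tau>) / \<tau>) = t * f (z / \<tau>)"
    using assms(1) assms(2)[of "z / \<tau>"] by (simp add: add_divide_distrib)
qed

lemma theta_quotient_inversion:
  assumes \<tau>: "Im \<tau> > 0"
    and hol: "f holomorphic_on {z. jtheta \<tau> z \<noteq> 0}"
      "g holomorphic_on {z. jtheta (- 1 / \<tau>) z \<noteq> 0}"
    and f: "\<And>z. f (z + 1) = s * f z" "\<And>z. f (z + \<tau>) = t * f z"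
    and g: "\<And>z. g (z + 1) = t * g z" "\<And>z. g (z + (- 1 / \<tau>)) = s * g z"
    and st: "s = 1 \<or> s = -1" "t = -1"
    and lim: "((\<lambda>h. h * f (h + jsigma \<tau>)) \<longlongrightarrow> R) (at 0)"
      "((\<lambda>h. h * g (h + jsigma (- 1 / \<tau>))) \<longlongrightarrow> R') (at 0)"
    and c: "c * R' = t * R"
    and z: "jtheta \<tau> z \<noteq> 0"
  shows "f z = c / \<tau> * g (z / \<tau>)"
proof (rule quasi_periodic_eqI[OF \<tau>, where p = "jsigma \<tau> + \<tau>" and f = f and R = "t * R"
      and g = "\<lambda>z. c / \<tau> * g (z / \<tau>)"])
  have nz: "\<tau> \<noteq> 0" using \<tau> by auto
  have reg: "{z. z - (jsigma \<tau> + \<tau>) \<notin> period_lattice \<tau>} = {z. jtheta \<tau> z \<noteq> 0}"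
    using jtheta_inversion_zero_iff(2)[OF \<tau>] by auto
  show "f holomorphic_on {z. z - (jsigma \<tau> + \<tau>) \<notin> period_lattice \<tau>}"
    unfolding reg by (rule hol)
  have "(\<lambda>z. g (z / \<tau>)) holomorphic_on {z. jtheta \<tau> z \<noteq> 0}"
  proof -
    have "(\<lambda>z. z / \<tau>) holomorphic_on {z. jtheta \<tau> z \<noteq> 0}"
      using nz by (intro holomorphic_intros) auto
    moreover have "(\<lambda>z. z / \<tau>) ` {z. jtheta \<tau> z \<noteq> 0} \<subseteq> {z. jtheta (- 1 / \<tau>) z \<noteq> 0}"
      using jtheta_inversion_zero_iff(1)[OF \<tau>] by blast
    ultimately have "g \<circ> (\<lambda>z. z / \<tau>) holomorphic_on {z. jtheta \<tau> z \<noteq> 0}"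
      by (rule holomorphic_on_compose_gen[OF _ hol(2)])
    thus ?thesis by (simp add: o_def)
  qed
  thus "(\<lambda>z. c / \<tau> * g (z / \<tau>)) holomorphic_on {z. z - (jsigma \<tau> + \<tau>) \<notin> period_lattice \<tau>}"
    unfolding reg by (intro holomorphic_intros)
  show "z - (jsigma \<tau> + \<tau>) \<notin> period_lattice \<tau>"
    using z jtheta_inversion_zero_iff(2)[OF \<tau>] by simp
  have "s * s = 1" using st by auto
  note g' = inversion_shift[of \<tau> g t s, OF nz g this]
  show "c / \<tau> * g ((z + 1) / \<tau>) = s * (c / \<tau> * g (z / \<tau>))" for z
    by (simp add: g')
  show "c / \<tau> * g ((z + \<tau>) / \<tau>) = t * (c / \<tau> * g (z / \<tau>))" for z
    by (simp add: g')
  show "norm s = 1" "norm t = 1" "s \<noteq> 1 \<or> t \<noteq> 1"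
    using st by auto
  show "((\<lambda>h. h * (c / \<tau> * g ((h + (jsigma \<tau> + \<tau>)) / \<tau>))) \<longlongrightarrow> t * R) (at 0)"
    using inversion_residue[OF \<tau> lim(2), of c] c by simp
  have eq: "h * f (h + (jsigma \<tau> + \<tau>)) = t * (h * f (h + jsigma \<tau>))" for h
    using f(2)[of "h + jsigma \<tau>"] by (simp add: add.assoc)
  show "((\<lambda>h. h * f (h + (jsigma \<tau> + \<tau>))) \<longlongrightarrow> t * R) (at 0)"
    unfolding eq by (rule tendsto_mult_left[OF lim(1)])
qed (rule f)+

theorem nd_theta_inversion:
  assumes "Im \<tau> > 0" "jtheta \<tau> z \<noteq> 0"
  shows "nd_theta \<tau> z = 4 * \<i> / \<tau> * cd_theta (- 1 / \<tau>) (z / \<tau>)"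
proof -
  note \<tau>' = Im_minus_inverse[OF assms(1)]
  show ?thesis
    by (rule theta_quotient_inversion[OF assms(1) holomorphic_nd_cd_sd_theta(1)[OF assms(1)]
          holomorphic_nd_cd_sd_theta(2)[OF \<tau>'] _ _ _ _ _ _ nd_theta_residue[OF assms(1)]
          cd_theta_residue[OF \<tau>'], where s = 1 and t = "-1"])
       (use assms in \<open>simp_all add: nd_theta_add cd_theta_add[of "- 1 / \<tau>", simplified]\<close>)
qed

theorem sd_theta_inversion:
  assumes "Im \<tau> > 0" "jtheta \<tau> z \<noteq> 0"
  shows "sd_theta \<tau> z = - 1 / \<tau> * sd_theta (- 1 / \<tau>) (z / \<tau>)"
proof -
  note \<tau>' = Im_minus_inverse[OF assms(1)]
  show ?thesis
    by (rule theta_quotient_inversion[OF assms(1) holomorphic_nd_cd_sd_theta(3)[OF assms(1)]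
          holomorphic_nd_cd_sd_theta(3)[OF \<tau>'] _ _ _ _ _ _ sd_theta_residue[OF assms(1)]
          sd_theta_residue[OF \<tau>'], where s = "-1" and t = "-1"])
       (use assms in \<open>simp_all add: sd_theta_add sd_theta_add[of "- 1 / \<tau>", simplified]\<close>)
qed

lemma cd_theta_minus: "cd_theta \<tau> (- z) = cd_theta \<tau> z"
proof -
  have "jtheta \<tau> (- z + \<tau>/2) = jtheta \<tau> (z - \<tau>/2)"
    using jtheta_minus[of \<tau> "z - \<tau>/2"] by (simp add: algebra_simps)
  moreover have "jtheta \<tau> (z + \<tau>/2) = epi (- \<tau> - 2 * (z - \<tau>/2)) * jtheta \<tau> (z - \<tau>/2)"
    using jtheta_add_tau[of \<tau> "z - \<tau>/2"] by (simp add: add.commute)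
  moreover have "epi (\<tau>/2 + z) * epi (- \<tau> - 2 * (z - \<tau>/2)) = epi (\<tau>/2 + - z)"
    unfolding epi_add[symmetric] by (simp add: algebra_simps)
  ultimately show ?thesis
    by (simp add: cd_theta_def jtheta_minus mult_ac)
qed

theorem cd_theta_inversion:
  assumes "Im \<tau> > 0" "jtheta \<tau> z \<noteq> 0"
  shows "cd_theta \<tau> z = \<i> / (4 * \<tau>) * nd_theta (- 1 / \<tau>) (z / \<tau>)"
proof -
  have nz: "\<tau> \<noteq> 0" using assms by auto
  have "jtheta (- 1 / \<tau>) (z / \<tau>) \<noteq> 0"
    using jtheta_inversion_zero_iff(1)[OF assms(1)] assms(2) by simp
  from nd_theta_inversion[OF Im_minus_inverse[OF assms(1)] this]
  have "nd_theta (- 1 / \<tau>) (z / \<tau>) = - 4 * \<i> * \<tau> * cd_theta \<tau> z"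
    using nz by (simp add: cd_theta_minus)
  thus ?thesis
    using nz by simp
qed

subsection \<open>Jacobi's theta functions\<close>

lemma theta3_eq_jtheta:
  assumes "Im \<tau> > 0"
  shows "theta3 \<tau> (of_real pi * z) = jtheta \<tau> z"
proof -
  define t where "t n = epi (\<tau> * of_int n ^ 2 + 2 * of_int n * z)" for n :: int
  have "(\<lambda>n. t (int (Suc n)) + t (- int (Suc n))) sums (jtheta \<tau> z - t 0)"
    unfolding t_def by (rule has_sum_int_imp_sums_pair[OF has_sum_jtheta[OF assms]])
  hence "(\<lambda>n. (t (int (Suc n)) + t (- int (Suc n))) / 2) sums ((jtheta \<tau> z - t 0) / 2)"
    by (rule sums_divide)
  moreover have "(t (int m) + t (- int m)) / 2 = qpow \<tau> ((of_nat m)^2) * cos (2 * of_nat m * (of_real pi * z))" for m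
  proof -
    have c: "cos (2 * of_nat m * (of_real pi * z)) = (epi (2 * of_nat m * z) + epi (- (2 * of_nat m * z))) / 2"
      using cos_pi_eq_epi[of "2 * of_nat m * z"] by (simp only: mult_ac)
    show ?thesis
      unfolding c by (simp add: t_def epi_add epi_diff epi_minus qpow_eq_epi field_simps)
  qed
  ultimately have "(\<lambda>n. qpow \<tau> ((of_nat (Suc n))^2) * cos (2 * of_nat (Suc n) * (of_real pi * z))) sums
      ((jtheta \<tau> z - t 0) / 2)"
    by (simp only:)
  note suminf_eq = sums_unique[OF this, symmetric]
  show ?thesis
    unfolding theta3_def suminf_eq by (simp add: t_def field_simps)
qed

lemma theta4_eq_jtheta:
  assumes "Im \<tau> > 0"
  shows "theta4 \<tau> (of_real pi * z) = jtheta \<tau> (z + 1/2)"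
proof -
  define t where "t n = epi (\<tau> * of_int n ^ 2 + 2 * of_int n * (z + 1/2))" for n :: int
  have "(\<lambda>n. t (int (Suc n)) + t (- int (Suc n))) sums (jtheta \<tau> (z + 1/2) - t 0)"
    unfolding t_def by (rule has_sum_int_imp_sums_pair[OF has_sum_jtheta[OF assms]])
  hence "(\<lambda>n. (t (int (Suc n)) + t (- int (Suc n))) / 2) sums ((jtheta \<tau> (z + 1/2) - t 0) / 2)"
    by (rule sums_divide)
  moreover have "(t (int m) + t (- int m)) / 2 =
      (-1) ^ m * qpow \<tau> ((of_nat m)^2) * cos (2 * of_nat m * (of_real pi * z))" for m
  proof -
    have c: "cos (2 * of_nat m * (of_real pi * z)) = (epi (2 * of_nat m * z) + epi (- (2 * of_nat m * z))) / 2"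
      using cos_pi_eq_epi[of "2 * of_nat m * z"] by (simp only: mult_ac)
    have t: "t n = epi (of_int n) * epi (\<tau> * of_int n ^ 2) * epi (2 * of_int n * z)" for n
      unfolding t_def epi_add[symmetric] by (simp add: algebra_simps)
    have "epi (- of_nat m) = (-1) ^ m"
      by (simp add: epi_minus epi_of_nat flip: power_inverse)
    thus ?thesis
      unfolding c t by (simp add: epi_of_nat qpow_eq_epi field_simps)
  qed
  ultimately have "(\<lambda>n. (-1) ^ Suc n * qpow \<tau> ((of_nat (Suc n))^2) * cos (2 * of_nat (Suc n) * (of_real pi * z))) sums
      ((jtheta \<tau> (z + 1/2) - t 0) / 2)"
    by (simp only:)
  note suminf_eq = sums_unique[OF this, symmetric]
  show ?thesis
    unfolding theta4_def suminf_eq by (simp add: t_def field_simps)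
qed

lemma theta2_eq_jtheta:
  assumes "Im \<tau> > 0"
  shows "theta2 \<tau> (of_real pi * z) = epi (\<tau>/4 + z) * jtheta \<tau> (z + \<tau>/2)"
proof -
  define t where "t n = epi (\<tau>/4 + z) * epi (\<tau> * of_int n ^ 2 + 2 * of_int n * (z + \<tau>/2))" for n :: int
  have "(\<lambda>n. t (int n) + t (- 1 - int n)) sums (epi (\<tau>/4 + z) * jtheta \<tau> (z + \<tau>/2))"
    unfolding t_def by (rule has_sum_int_imp_sums_half[OF has_sum_cmult_right[OF has_sum_jtheta[OF assms]]])
  hence "(\<lambda>n. (t (int n) + t (- 1 - int n)) / 2) sums (epi (\<tau>/4 + z) * jtheta \<tau> (z + \<tau>/2) / 2)"
    by (rule sums_divide)
  moreover have "(t (int m) + t (- 1 - int m)) / 2 =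
      qpow \<tau> ((of_nat m + 1/2)^2) * cos ((2 * of_nat m + 1) * (of_real pi * z))" for m
  proof -
    have c: "cos ((2 * of_nat m + 1) * (of_real pi * z)) =
        (epi ((2 * of_nat m + 1) * z) + epi (- ((2 * of_nat m + 1) * z))) / 2"
      using cos_pi_eq_epi[of "(2 * of_nat m + 1) * z"] by (simp only: mult_ac)
    have "t (int m) = epi (\<tau> * (of_nat m + 1/2)^2) * epi ((2 * of_nat m + 1) * z)"
      unfolding t_def epi_add[symmetric] by (rule arg_cong[of _ _ epi]) (simp add: field_simps power2_eq_square)
    moreover have "t (- 1 - int m) = epi (\<tau> * (of_nat m + 1/2)^2) * epi (- ((2 * of_nat m + 1) * z))"
      unfolding t_def epi_add[symmetric] by (rule arg_cong[of _ _ epi]) (simp add: field_simps power2_eq_square)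
    ultimately show ?thesis
      unfolding c by (simp add: qpow_eq_epi distrib_left)
  qed
  ultimately have "(\<lambda>n. qpow \<tau> ((of_nat n + 1/2)^2) * cos ((2 * of_nat n + 1) * (of_real pi * z))) sums
      (epi (\<tau>/4 + z) * jtheta \<tau> (z + \<tau>/2) / 2)"
    by (simp only:)
  note suminf_eq = sums_unique[OF this, symmetric]
  show ?thesis
    unfolding theta2_def suminf_eq by (simp add: field_simps)
qed

lemma theta1_eq_jtheta:
  assumes "Im \<tau> > 0"
  shows "theta1 \<tau> (of_real pi * z) = - \<i> * epi (\<tau>/4 + z) * jtheta \<tau> (z + (1/2 + \<tau>/2))"
proof -
  define t where "t n = epi (\<tau>/4 + z) * epi (\<tau> * of_int n ^ 2 + 2 * of_int n * (z + (1/2 + \<tau>/2)))" for n :: int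
  have "(\<lambda>n. t (int n) + t (- 1 - int n)) sums (epi (\<tau>/4 + z) * jtheta \<tau> (z + (1/2 + \<tau>/2)))"
    unfolding t_def by (rule has_sum_int_imp_sums_half[OF has_sum_cmult_right[OF has_sum_jtheta[OF assms]]])
  hence "(\<lambda>n. (t (int n) + t (- 1 - int n)) / (2 * \<i>)) sums (epi (\<tau>/4 + z) * jtheta \<tau> (z + (1/2 + \<tau>/2)) / (2 * \<i>))"
    by (rule sums_divide)
  moreover have "(t (int m) + t (- 1 - int m)) / (2 * \<i>) =
      (-1) ^ m * qpow \<tau> ((of_nat m + 1/2)^2) * sin ((2 * of_nat m + 1) * (of_real pi * z))" for m
  proof -
    have s: "sin ((2 * of_nat m + 1) * (of_real pi * z)) =
        (epi ((2 * of_nat m + 1) * z) - epi (- ((2 * of_nat m + 1) * z))) / (2 * \<i>)"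
      using sin_pi_eq_epi[of "(2 * of_nat m + 1) * z"] by (simp only: mult_ac)
    have "t (int m) = epi (of_nat m) * epi (\<tau> * (of_nat m + 1/2)^2) * epi ((2 * of_nat m + 1) * z)"
      unfolding t_def epi_add[symmetric] by (rule arg_cong[of _ _ epi]) (simp add: field_simps power2_eq_square)
    moreover have "t (- 1 - int m) = epi (- (of_nat m + 1)) * epi (\<tau> * (of_nat m + 1/2)^2) * epi (- ((2 * of_nat m + 1) * z))"
      unfolding t_def epi_add[symmetric] by (rule arg_cong[of _ _ epi]) (simp add: field_simps power2_eq_square)
    moreover have "epi (- (of_nat m + 1)) = - ((-1) ^ m)"
      unfolding epi_minus epi_add epi_of_nat epi_1 by (simp flip: power_inverse)
    ultimately show ?thesis
      unfolding s by (simp add: qpow_eq_epi epi_of_nat right_diff_distrib)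
  qed
  ultimately have "(\<lambda>n. (-1) ^ n * qpow \<tau> ((of_nat n + 1/2)^2) * sin ((2 * of_nat n + 1) * (of_real pi * z))) sums
      (epi (\<tau>/4 + z) * jtheta \<tau> (z + (1/2 + \<tau>/2)) / (2 * \<i>))"
    by (simp only:)
  note suminf_eq = sums_unique[OF this, symmetric]
  show ?thesis
    unfolding theta1_def suminf_eq by (simp add: field_simps)
qed

lemma theta_constants:
  assumes "Im \<tau> > 0"
  shows "theta2 \<tau> 0 = epi (\<tau>/4) * jtheta \<tau> (\<tau>/2)" "theta3 \<tau> 0 = jtheta \<tau> 0"
    "theta4 \<tau> 0 = jtheta \<tau> (1/2)"
  using theta2_eq_jtheta[OF assms, of 0] theta3_eq_jtheta[OF assms, of 0] theta4_eq_jtheta[OF assms, of 0]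
  by simp_all

lemma jacobi_K_nonzero:
  assumes "Im \<tau> > 0"
  shows "jacobi_K \<tau> \<noteq> 0"
  using jtheta_constants_nonzero[OF assms] by (simp add: jacobi_K_def theta_constants[OF assms])

lemma remove_sings_scale_eqI:
  fixes f g :: "complex \<Rightarrow> complex"
  assumes "c \<noteq> 0" "eventually (\<lambda>w. f (c * w) = g w) (at z)" "isCont g z"
  shows "remove_sings f (c * z) = g z"
proof (rule remove_sings_eqI)
  have lim: "filterlim (\<lambda>u. u / c) (at z) (at (c * z))"
    unfolding filterlim_at using assms(1)
    by (auto simp: eventually_at_filter field_simps intro!: tendsto_eq_intros always_eventually)
  have "((\<lambda>u. g (u / c)) \<longlongrightarrow> g z) (at (c * z))"
    by (rule filterlim_compose[OF isContD[OF assms(3)] lim])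
  moreover have "eventually (\<lambda>u. g (u / c) = f u) (at (c * z))"
    using eventually_compose_filterlim[OF assms(2) lim] by eventually_elim (use assms(1) in simp)
  ultimately show "f \<midarrow>c * z\<rightarrow> g z"
    by (rule Lim_transform_eventually)
qed

lemma jacobi_at_2Kz:
  assumes "Im \<tau> > 0"
  shows "jacobi_sn \<tau> (2 * jacobi_K \<tau> * z) = theta3 \<tau> 0 / theta2 \<tau> 0 * (theta1 \<tau> (of_real pi * z) / theta4 \<tau> (of_real pi * z))"
    and "jacobi_cn \<tau> (2 * jacobi_K \<tau> * z) = theta4 \<tau> 0 / theta2 \<tau> 0 * (theta2 \<tau> (of_real pi * z) / theta4 \<tau> (of_real pi * z))"
    and "jacobi_dn \<tau> (2 * jacobi_K \<tau> * z) = theta4 \<tau> 0 / theta3 \<tau> 0 * (theta3 \<tau> (of_real pi * z) / theta4 \<tau> (of_real pi * z))"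
  using jacobi_K_nonzero[OF assms] by (simp_all add: jacobi_sn_def jacobi_cn_def jacobi_dn_def Let_def)

lemma eventually_jtheta_nonzero:
  assumes "Im \<tau> > 0"
  shows "eventually (\<lambda>z. jtheta \<tau> (z + a) \<noteq> 0) (at z\<^sub>0)"
proof -
  obtain b where "jtheta \<tau> (b + a) \<noteq> 0"
    using jtheta_not_identically_0[OF assms] by (metis diff_add_cancel)
  moreover have "(\<lambda>z. jtheta \<tau> (z + a)) holomorphic_on UNIV"
    by (intro holomorphic_intros assms)
  ultimately show ?thesis
    using non_zero_neighbour_alt[of "\<lambda>z. jtheta \<tau> (z + a)" UNIV z\<^sub>0 b] connected_UNIV by simp
qed

lemma isCont_jtheta' [continuous_intros]:
  "Im \<tau> > 0 \<Longrightarrow> isCont f a \<Longrightarrow> isCont (\<lambda>z. jtheta \<tau> (f z)) a"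
  by (rule isCont_o2[OF _ isCont_jtheta])

theorem ND_eq_nd_theta:
  assumes "Im \<tau> > 0" "jtheta \<tau> z \<noteq> 0"
  shows "ND z \<tau> = nd_theta \<tau> z"
proof -
  note nz = jtheta_constants_nonzero[OF assms(1)]
  have "remove_sings (\<lambda>u. 1 / jacobi_dn \<tau> u) (2 * jacobi_K \<tau> * z) =
      jtheta \<tau> 0 / jtheta \<tau> (1/2) * jtheta \<tau> (z + 1/2) / jtheta \<tau> z"
    by (rule remove_sings_scale_eqI)
       (use assms nz jacobi_K_nonzero[OF assms(1)] in
         \<open>auto simp: jacobi_at_2Kz theta_constants theta3_eq_jtheta theta4_eq_jtheta intro!: continuous_intros\<close>)
  thus ?thesis
    using nz unfolding ND_def jacobi_nd_def nd_theta_def jacobi_k'_def jacobi_K_def theta_constants[OF assms(1)]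
    by (simp add: power2_eq_square)
qed

theorem CD_eq_cd_theta:
  assumes "Im \<tau> > 0" "jtheta \<tau> z \<noteq> 0"
  shows "CD z \<tau> = cd_theta \<tau> z"
proof -
  note nz = jtheta_constants_nonzero[OF assms(1)]
  have *: "remove_sings (\<lambda>u. jacobi_cn \<tau> u / jacobi_dn \<tau> u) (2 * jacobi_K \<tau> * z) =
      jtheta \<tau> 0 / (epi (\<tau>/4) * jtheta \<tau> (\<tau>/2)) * (epi (\<tau>/4 + z) * jtheta \<tau> (z + \<tau>/2)) / jtheta \<tau> z"
  proof (rule remove_sings_scale_eqI)
    show "eventually (\<lambda>w. jacobi_cn \<tau> (2 * jacobi_K \<tau> * w) / jacobi_dn \<tau> (2 * jacobi_K \<tau> * w) =
        jtheta \<tau> 0 / (epi (\<tau>/4) * jtheta \<tau> (\<tau>/2)) * (epi (\<tau>/4 + w) * jtheta \<tau> (w + \<tau>/2)) / jtheta \<tau> w) (at z)"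
      using eventually_jtheta_nonzero[OF assms(1), of "1/2" z]
      unfolding jacobi_at_2Kz[OF assms(1)] theta_constants[OF assms(1)]
        theta2_eq_jtheta[OF assms(1)] theta3_eq_jtheta[OF assms(1)] theta4_eq_jtheta[OF assms(1)]
      by eventually_elim (use nz in \<open>simp add: mult_ac\<close>)
  qed (use assms nz jacobi_K_nonzero[OF assms(1)] in \<open>auto intro!: continuous_intros\<close>)
  have e: "epi (\<tau>/2 + z) = epi (\<tau>/4) * epi (\<tau>/4 + z)"
    unfolding epi_add[symmetric] by (rule arg_cong[of _ _ epi]) simp
  show ?thesis
    using nz unfolding CD_def jacobi_cd_def cd_theta_def jacobi_k_def jacobi_K_def theta_constants[OF assms(1)] e
      *[unfolded jacobi_K_def theta_constants[OF assms(1)]]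
    by (simp add: power2_eq_square)
qed

theorem SD_eq_sd_theta:
  assumes "Im \<tau> > 0" "jtheta \<tau> z \<noteq> 0"
  shows "SD z \<tau> = sd_theta \<tau> z"
proof -
  note nz = jtheta_constants_nonzero[OF assms(1)]
  define c where "c = jtheta \<tau> 0 ^ 2 / (epi (\<tau>/4) * jtheta \<tau> (\<tau>/2) * jtheta \<tau> (1/2))"
  have *: "remove_sings (\<lambda>u. jacobi_sn \<tau> u / jacobi_dn \<tau> u) (2 * jacobi_K \<tau> * z) =
      c * (- \<i> * epi (\<tau>/4 + z) * jtheta \<tau> (z + (1/2 + \<tau>/2))) / jtheta \<tau> z"
  proof (rule remove_sings_scale_eqI)
    show "eventually (\<lambda>w. jacobi_sn \<tau> (2 * jacobi_K \<tau> * w) / jacobi_dn \<tau> (2 * jacobi_K \<tau> * w) =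
        c * (- \<i> * epi (\<tau>/4 + w) * jtheta \<tau> (w + (1/2 + \<tau>/2))) / jtheta \<tau> w) (at z)"
      using eventually_jtheta_nonzero[OF assms(1), of "1/2" z]
      unfolding jacobi_at_2Kz[OF assms(1)] theta_constants[OF assms(1)]
        theta1_eq_jtheta[OF assms(1)] theta3_eq_jtheta[OF assms(1)] theta4_eq_jtheta[OF assms(1)]
      by eventually_elim (use nz in \<open>simp add: c_def power2_eq_square mult_ac\<close>)
  qed (use assms nz jacobi_K_nonzero[OF assms(1)] in \<open>auto intro!: continuous_intros\<close>)
  have e: "epi (\<tau>/2 + z) = epi (\<tau>/4) * epi (\<tau>/4 + z)"
    unfolding epi_add[symmetric] by (rule arg_cong[of _ _ epi]) simp
  show ?thesis
    using nz unfolding SD_def jacobi_sd_def sd_theta_def jacobi_k_def jacobi_k'_def jacobi_K_def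
      theta_constants[OF assms(1)] e *[unfolded jacobi_K_def theta_constants[OF assms(1)]] c_def
    by (simp add: power2_eq_square)
qed

lemma qpow_eq_cos: "qpow \<tau> s / (1 + qpow \<tau> (2 * s)) = 1 / (2 * cos (s * of_real pi * \<tau>))"
proof -
  define X where "X = epi (s * \<tau>)"
  have "X \<noteq> 0" by (simp add: X_def)
  have X2: "qpow \<tau> (2 * s) = X * X" "qpow \<tau> s = X"
    unfolding X_def qpow_eq_epi epi_add[symmetric] by (simp_all add: algebra_simps)
  have "2 * cos (s * of_real pi * \<tau>) = X + inverse X"
    using cos_pi_eq_epi[of "s * \<tau>"] by (simp add: X_def epi_minus mult_ac)
  also have "\<dots> = (1 + X * X) / X"
    using \<open>X \<noteq> 0\<close> by (simp add: field_simps)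
  finally show ?thesis by (simp add: X2)
qed

lemma qpow_eq_sin: "qpow \<tau> s / (1 - qpow \<tau> (2 * s)) = \<i> / (2 * sin (s * of_real pi * \<tau>))"
proof -
  define X where "X = epi (s * \<tau>)"
  have "X \<noteq> 0" by (simp add: X_def)
  have X2: "qpow \<tau> (2 * s) = X * X" "qpow \<tau> s = X"
    unfolding X_def qpow_eq_epi epi_add[symmetric] by (simp_all add: algebra_simps)
  have sin: "sin (s * of_real pi * \<tau>) * (2 * \<i>) = X - inverse X"
    using sin_pi_eq_epi[of "s * \<tau>"] by (simp add: X_def epi_minus mult_ac)
  have "2 * S = - (\<i> * (S * (2 * \<i>)))" for S
    by (simp add: complex_eq_iff)
  hence "2 * sin (s * of_real pi * \<tau>) = - (\<i> * (sin (s * of_real pi * \<tau>) * (2 * \<i>)))" .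
  also have "\<dots> = \<i> * (inverse X - X)"
    unfolding sin by (simp add: right_diff_distrib)
  also have "inverse X - X = (1 - X * X) / X"
    using \<open>X \<noteq> 0\<close> by (simp add: field_simps)
  finally show ?thesis by (simp add: X2)
qed

theorem mainTheorem7:
  fixes \<tau> z :: complex and \<alpha> \<beta> :: real
  assumes "Im \<tau> > 0"
    and "z = of_real \<alpha> + of_real \<beta> * \<tau>"
  shows "(\<bar>\<beta>\<bar> < 1/2 \<longrightarrow>
      (\<exists>S. (\<lambda>n. (-1) ^ Suc n * qpow \<tau> (of_nat (Suc n)) * cos (2 * of_nat (Suc n) * of_real pi * z)
                 / (1 + qpow \<tau> (2 * of_nat (Suc n)))) sums S
           \<and> ND z \<tau> = 1 + 4 * S)
    \<and> (\<exists>S. (\<lambda>n. (-1) ^ Suc n * cos (2 * of_nat (Suc n) * of_real pi * z)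
                 / cos (of_nat (Suc n) * of_real pi * \<tau>)) sums S
           \<and> ND z \<tau> = 1 + 2 * S)
    \<and> (\<exists>S. (\<lambda>n. (-1) ^ n * qpow \<tau> (of_nat n + 1/2) * cos ((2 * of_nat n + 1) * of_real pi * z)
                 / (1 - qpow \<tau> (2 * of_nat n + 1))) sums S
           \<and> CD z \<tau> = S)
    \<and> (\<exists>S. (\<lambda>n. (-1) ^ n * cos ((2 * of_nat n + 1) * of_real pi * z)
                 / sin ((of_nat n + 1/2) * of_real pi * \<tau>)) sums S
           \<and> CD z \<tau> = \<i> / 2 * S)
    \<and> (\<exists>S. (\<lambda>n. (-1) ^ n * qpow \<tau> (of_nat n + 1/2) * sin ((2 * of_nat n + 1) * of_real pi * z)
                 / (1 + qpow \<tau> (2 * of_nat n + 1))) sums S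
           \<and> SD z \<tau> = S)
    \<and> (\<exists>S. (\<lambda>n. (-1) ^ n * sin ((2 * of_nat n + 1) * of_real pi * z)
                 / cos ((of_nat n + 1/2) * of_real pi * \<tau>)) sums S
           \<and> SD z \<tau> = 1 / 2 * S))
  \<and> (\<bar>\<alpha>\<bar> < 1/2 \<longrightarrow>
      (\<exists>S. (\<lambda>n. (-1) ^ n * cos ((2 * of_nat n + 1) * of_real pi * z / \<tau>)
                 / sin ((of_nat n + 1/2) * of_real pi / \<tau>)) sums S
           \<and> ND z \<tau> = 2 / \<tau> * S)
    \<and> (\<exists>S. (\<lambda>n. (-1) ^ Suc n * cos (2 * of_nat (Suc n) * of_real pi * z / \<tau>)
                 / cos (of_nat (Suc n) * of_real pi / \<tau>)) sums S
           \<and> CD z \<tau> = \<i> / (4 * \<tau>) + \<i> / (2 * \<tau>) * S)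
    \<and> (\<exists>S. (\<lambda>n. (-1) ^ n * sin ((2 * of_nat n + 1) * of_real pi * z / \<tau>)
                 / cos ((of_nat n + 1/2) * of_real pi / \<tau>)) sums S
           \<and> SD z \<tau> = - (1 / (2 * \<tau>)) * S))"
proof (intro conjI impI)
  note \<tau> = assms(1)
  define \<tau>' where "\<tau>' = - 1 / \<tau>"
  have nz: "\<tau> \<noteq> 0" using \<tau> by auto
  have \<tau>': "Im \<tau>' > 0" unfolding \<tau>'_def by (rule Im_minus_inverse[OF \<tau>])
  let ?N1 = "\<lambda>n. (-1) ^ Suc n * cos (2 * of_nat (Suc n) * of_real pi * z) / cos (of_nat (Suc n) * of_real pi * \<tau>)"
  let ?C1 = "\<lambda>n. (-1) ^ n * cos ((2 * of_nat n + 1) * of_real pi * z) / sin ((of_nat n + 1/2) * of_real pi * \<tau>)"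
  let ?S1 = "\<lambda>n. (-1) ^ n * sin ((2 * of_nat n + 1) * of_real pi * z) / cos ((of_nat n + 1/2) * of_real pi * \<tau>)"
  have odd: "2 * of_nat n + 1 = 2 * (of_nat n + 1/2 :: complex)" for n
    by simp
  {
    assume "\<bar>\<beta>\<bar> < 1/2"
    hence "\<bar>Im z\<bar> < Im \<tau> / 2"
      using \<tau> by (simp add: assms(2) abs_mult)
    note th = \<tau> this
    have th_nz: "jtheta \<tau> z \<noteq> 0" by (rule jtheta_nonzero_strip[OF th])
    note nd = nd_theta_sums[OF th] and cd = cd_theta_sums[OF th] and sd = sd_theta_sums[OF th]
    note eqs = ND_eq_nd_theta[OF \<tau> th_nz] CD_eq_cd_theta[OF \<tau> th_nz] SD_eq_sd_theta[OF \<tau> th_nz]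
    show "\<exists>S. ?N1 sums S \<and> ND z \<tau> = 1 + 2 * S"
      by (rule exI, rule conjI, rule nd) (simp add: eqs field_simps)
    show "\<exists>S. ?C1 sums S \<and> CD z \<tau> = \<i> / 2 * S"
      by (rule exI, rule conjI, rule cd) (simp add: eqs)
    show "\<exists>S. ?S1 sums S \<and> SD z \<tau> = 1 / 2 * S"
      by (rule exI, rule conjI, rule sd) (simp add: eqs)
    have q0: "(-1) ^ Suc n * qpow \<tau> (of_nat (Suc n)) * cos (2 * of_nat (Suc n) * of_real pi * z)
        / (1 + qpow \<tau> (2 * of_nat (Suc n))) = 1/2 * ?N1 n" for n
      using arg_cong[OF qpow_eq_cos[of \<tau> "of_nat (Suc n)"],
          of "\<lambda>x. (-1) ^ Suc n * cos (2 * of_nat (Suc n) * of_real pi * z) * x"]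
      by (simp add: mult_ac)
    show "\<exists>S. (\<lambda>n. (-1) ^ Suc n * qpow \<tau> (of_nat (Suc n)) * cos (2 * of_nat (Suc n) * of_real pi * z)
        / (1 + qpow \<tau> (2 * of_nat (Suc n)))) sums S \<and> ND z \<tau> = 1 + 4 * S"
      unfolding q0 by (rule exI, rule conjI, rule sums_mult[OF nd]) (simp add: eqs field_simps)
    have q1: "(-1) ^ n * qpow \<tau> (of_nat n + 1/2) * cos ((2 * of_nat n + 1) * of_real pi * z)
        / (1 - qpow \<tau> (2 * of_nat n + 1)) = \<i>/2 * ?C1 n" for n
      using arg_cong[OF qpow_eq_sin[of \<tau> "of_nat n + 1/2"],
          of "\<lambda>x. (-1) ^ n * cos ((2 * of_nat n + 1) * of_real pi * z) * x"]
      unfolding odd[symmetric] by (simp add: mult_ac)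
    show "\<exists>S. (\<lambda>n. (-1) ^ n * qpow \<tau> (of_nat n + 1/2) * cos ((2 * of_nat n + 1) * of_real pi * z)
        / (1 - qpow \<tau> (2 * of_nat n + 1))) sums S \<and> CD z \<tau> = S"
      unfolding q1 by (rule exI, rule conjI, rule sums_mult[OF cd]) (simp add: eqs)
    have q2: "(-1) ^ n * qpow \<tau> (of_nat n + 1/2) * sin ((2 * of_nat n + 1) * of_real pi * z)
        / (1 + qpow \<tau> (2 * of_nat n + 1)) = 1/2 * ?S1 n" for n
      using arg_cong[OF qpow_eq_cos[of \<tau> "of_nat n + 1/2"],
          of "\<lambda>x. (-1) ^ n * sin ((2 * of_nat n + 1) * of_real pi * z) * x"]
      unfolding odd[symmetric] by (simp add: mult_ac)
    show "\<exists>S. (\<lambda>n. (-1) ^ n * qpow \<tau> (of_nat n + 1/2) * sin ((2 * of_nat n + 1) * of_real pi * z)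
        / (1 + qpow \<tau> (2 * of_nat n + 1))) sums S \<and> SD z \<tau> = S"
      unfolding q2 by (rule exI, rule conjI, rule sums_mult[OF sd]) (simp add: eqs)
  }
  {
    assume \<alpha>: "\<bar>\<alpha>\<bar> < 1/2"
    have "z / \<tau> = of_real \<beta> - of_real \<alpha> * \<tau>'"
      using nz by (simp add: assms(2) \<tau>'_def field_simps)
    hence "\<bar>Im (z / \<tau>)\<bar> < Im \<tau>' / 2"
      using \<tau>' \<alpha> by (simp add: abs_mult)
    note th = \<tau>' this
    have th_nz: "jtheta \<tau> z \<noteq> 0"
      using jtheta_nonzero_strip[OF th] jtheta_inversion_zero_iff(1)[OF \<tau>] by (simp add: \<tau>'_def)
    note eqs = ND_eq_nd_theta[OF \<tau> th_nz] CD_eq_cd_theta[OF \<tau> th_nz] SD_eq_sd_theta[OF \<tau> th_nz]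
      nd_theta_inversion[OF \<tau> th_nz, folded \<tau>'_def] cd_theta_inversion[OF \<tau> th_nz, folded \<tau>'_def]
      sd_theta_inversion[OF \<tau> th_nz, folded \<tau>'_def]
    have arg: "a * of_real pi * \<tau>' = - (a * of_real pi / \<tau>)" "a * (z / \<tau>) = a * z / \<tau>" for a
      by (simp_all add: \<tau>'_def)
    note nd = nd_theta_sums[OF th, unfolded arg cos_minus]
      and cd = cd_theta_sums[OF th, unfolded arg sin_minus]
      and sd = sd_theta_sums[OF th, unfolded arg cos_minus]
    show "\<exists>S. (\<lambda>n. (-1) ^ n * cos ((2 * of_nat n + 1) * of_real pi * z / \<tau>)
        / sin ((of_nat n + 1/2) * of_real pi / \<tau>)) sums S \<and> ND z \<tau> = 2 / \<tau> * S"
      using sums_minus[OF cd] by (intro exI conjI) (auto simp: eqs)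
    show "\<exists>S. (\<lambda>n. (-1) ^ Suc n * cos (2 * of_nat (Suc n) * of_real pi * z / \<tau>)
        / cos (of_nat (Suc n) * of_real pi / \<tau>)) sums S \<and> CD z \<tau> = \<i> / (4 * \<tau>) + \<i> / (2 * \<tau>) * S"
      by (rule exI, rule conjI, rule nd) (use nz in \<open>simp add: eqs field_simps\<close>)
    show "\<exists>S. (\<lambda>n. (-1) ^ n * sin ((2 * of_nat n + 1) * of_real pi * z / \<tau>)
        / cos ((of_nat n + 1/2) * of_real pi / \<tau>)) sums S \<and> SD z \<tau> = - (1 / (2 * \<tau>)) * S"
      by (rule exI, rule conjI, rule sd) (simp add: eqs \<tau>'_def)
  }
qed

end
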